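(* Let $R$ and $S$ be rings and let ${}_SC_R$ be a faithfully semidualizing bimodule. Then for every integer $n\ge1$, $$[\mathcal{A}_C(R)]^{n}=\mathcal{A}_C(R)\quad\text{and}\quad[\mathcal{B}_C(S)]^{n}=\mathcal{B}_C(S).$$
   Context: Rings are associative with unit and modules are unitary; $\mathrm{Mod}\,R$ is the category of left $R$-modules, and right $R$-modules are identified with left $R^{op}$-modules. An $(S,R)$-bimodule $C={}_SC_R$ is semidualizing if: ${}_SC$ and $C_R$ both admit projective resolutions by finitely generated projective modules (over $S$, resp. $R^{op}$); the homothety maps $S\to\mathrm{Hom}_{R^{op}}(C,C)$ and $R\to\mathrm{Hom}_S(C,C)$ are isomorphisms; and $\mathrm{Ext}^i_S(C,C)=0=\mathrm{Ext}^i_{R^{op}}(C,C)$ for all $i\ge1$. It is faithfully semidualizing if moreover, for all left $S$-modules $N$ and right $R$-modules $M$: $\mathrm{Hom}_S(C,N)=0$ implies $N=0$, and $\mathrm{Hom}_{R^{op}}(C,M)=0$ implies $M=0$. The Auslander class $\mathcal{A}_C(R)$ consists of the left $R$-modules $M$ such that $\mathrm{Tor}^R_i(C,M)=0$ and $\mathrm{Ext}_S^i(C,C\otimes_RM)=0$ for all $i\ge1$ and the natural evaluation map $M\to\mathrm{Hom}_S(C,C\otimes_RM)$ is an isomorphism. The Bass class $\mathcal{B}_C(S)$ consists of the left $S$-modules $N$ such that $\mathrm{Ext}_S^i(C,N)=0$ and $\mathrm{Tor}^R_i(C,\mathrm{Hom}_S(C,N))=0$ for all $i\ge1$ and the natural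 evaluation map $C\otimes_R\mathrm{Hom}_S(C,N)\to N$ is an isomorphism. A sequence $\mathbf{X}$ in $\mathrm{Mod}\,R$ is $C\otimes_R-$ exact if $C\otimes_R\mathbf{X}$ is exact; a sequence $\mathbf{Y}$ in $\mathrm{Mod}\,S$ is $\mathrm{Hom}_S(C,-)$ exact if $\mathrm{Hom}_S(C,\mathbf{Y})$ is exact. Set $[\mathcal{A}_C(R)]^{1}=\mathcal{A}_C(R)$ and, inductively for $n\ge1$, let $[\mathcal{A}_C(R)]^{n+1}$ be the class of left $R$-modules $M$ for which there is an exact sequence $\cdots\to G_1\to G_0\to G^0\to G^1\to\cdots$ in $\mathrm{Mod}\,R$ that is $C\otimes_R-$ exact, with all $G_i,G^i\in[\mathcal{A}_C(R)]^{n}$ and $M\cong\mathrm{Coker}(G_1\to G_0)$. Set $[\mathcal{B}_C(S)]^{1}=\mathcal{B}_C(S)$ and, inductively for $n\ge1$, let $[\mathcal{B}_C(S)]^{n+1}$ be the class of left $S$-modules $M$ for which there is an exact sequence $\cdots\to V_1\to V_0\to V^0\to V^1\to\cdots$ in $\mathrm{Mod}\,S$ that is $\mathrm{Hom}_S(C,-)$ exact, with all $V_i,V^i\in[\mathcal{B}_C(S)]^{n}$ and $M\cong\mathrm{Ker}(V^0\to V^1)$. *)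

theory Defs
  imports "HOL-Algebra.Free_Abelian_Groups" "HOL-Algebra.Elementary_Groups"
    "HOL-Algebra.AbelCoset" "HOL-Algebra.Module"
begin

section \<open>Modules over a ring\<close>

text \<open>
  The locale \<^locale>\<open>module\<close> requires a commutative base ring. Left modules over arbitrary rings use
  the same record type; its ring fields \<open>mult\<close> and \<open>one\<close> play no role and are left
  undefined in the constructions below. Abelian groups without scalar action are
  \<open>ring\<close> records of which only the additive part is used.
\<close>

locale left_module = R?: ring R + M?: abelian_group M
  for R (structure) and M (structure) +
  assumes smult_closed [simp, intro]:
      "\<lbrakk>a \<in> carrier R; x \<in> carrier M\<rbrakk> \<Longrightarrow> a \<odot>\<^bsub>M\<^esub> x \<in> carrier M"
    and smult_l_distr:
      "\<lbrakk>a \<in> carrier R; b \<in> carrier R; x \<in> carrier M\<rbrakk> \<Longrightarrow>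
        (a \<oplus> b) \<odot>\<^bsub>M\<^esub> x = a \<odot>\<^bsub>M\<^esub> x \<oplus>\<^bsub>M\<^esub> b \<odot>\<^bsub>M\<^esub> x"
    and smult_r_distr:
      "\<lbrakk>a \<in> carrier R; x \<in> carrier M; y \<in> carrier M\<rbrakk> \<Longrightarrow>
        a \<odot>\<^bsub>M\<^esub> (x \<oplus>\<^bsub>M\<^esub> y) = a \<odot>\<^bsub>M\<^esub> x \<oplus>\<^bsub>M\<^esub> a \<odot>\<^bsub>M\<^esub> y"
    and smult_assoc1:
      "\<lbrakk>a \<in> carrier R; b \<in> carrier R; x \<in> carrier M\<rbrakk> \<Longrightarrow>
        (a \<otimes> b) \<odot>\<^bsub>M\<^esub> x = a \<odot>\<^bsub>M\<^esub> (b \<odot>\<^bsub>M\<^esub> x)"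
    and smult_one [simp]: "x \<in> carrier M \<Longrightarrow> \<one> \<odot>\<^bsub>M\<^esub> x = x"

definition opp_ring :: "('r, 'z) ring_scheme \<Rightarrow> ('r, 'z) ring_scheme"
  where "opp_ring R = R\<lparr>mult := \<lambda>a b. b \<otimes>\<^bsub>R\<^esub> a\<rparr>"

record ('s, 'r, 'c) bimodule = "('s, 'c) module" +
  rsmult :: "'c \<Rightarrow> 'r \<Rightarrow> 'c"

text \<open>A bimodule is itself (by record extension) its underlying left module; its underlying right
  \<open>R\<close>-module is the following left module over \<open>opp_ring R\<close>.\<close>

definition right_module :: "('s, 'r, 'c, 'z) bimodule_scheme \<Rightarrow> ('r, 'c) module"
  where "right_module C = \<lparr>carrier = carrier C, mult = undefined, one = undefined,
    zero = zero C, add = add C, smult = (\<lambda>r c. rsmult C c r)\<rparr>"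

definition is_bimodule ::
    "('s, 'x) ring_scheme \<Rightarrow> ('r, 'y) ring_scheme \<Rightarrow> ('s, 'r, 'c, 'z) bimodule_scheme \<Rightarrow> bool"
  where "is_bimodule S R C \<longleftrightarrow> left_module S C \<and> left_module (opp_ring R) (right_module C) \<and>
    (\<forall>s\<in>carrier S. \<forall>c\<in>carrier C. \<forall>r\<in>carrier R.
      s \<odot>\<^bsub>C\<^esub> rsmult C c r = rsmult C (s \<odot>\<^bsub>C\<^esub> c) r)"

text \<open>Homomorphisms are extensional, so that equality of homomorphisms is equality of functions.\<close>

definition mod_hom ::
    "('r, 'x) ring_scheme \<Rightarrow> ('r, 'm, 'y) module_scheme \<Rightarrow> ('r, 'n, 'z) module_scheme \<Rightarrow> ('m \<Rightarrow> 'n) set"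
  where "mod_hom R M N = {f \<in> carrier M \<rightarrow>\<^sub>E carrier N.
    (\<forall>x\<in>carrier M. \<forall>y\<in>carrier M. f (x \<oplus>\<^bsub>M\<^esub> y) = f x \<oplus>\<^bsub>N\<^esub> f y) \<and>
    (\<forall>r\<in>carrier R. \<forall>x\<in>carrier M. f (r \<odot>\<^bsub>M\<^esub> x) = r \<odot>\<^bsub>N\<^esub> f x)}"

definition mod_iso ::
    "('r, 'x) ring_scheme \<Rightarrow> ('r, 'm, 'y) module_scheme \<Rightarrow> ('r, 'n, 'z) module_scheme \<Rightarrow> ('m \<Rightarrow> 'n) set"
  where "mod_iso R M N = {f \<in> mod_hom R M N. bij_betw f (carrier M) (carrier N)}"

definition mod_isomorphic ::
    "('r, 'x) ring_scheme \<Rightarrow> ('r, 'm, 'y) module_scheme \<Rightarrow> ('r, 'n, 'z) module_scheme \<Rightarrow> bool"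
  where "mod_isomorphic R M N \<longleftrightarrow> mod_iso R M N \<noteq> {}"

definition zero_module :: "('r, 'm, 'z) module_scheme \<Rightarrow> bool"
  where "zero_module M \<longleftrightarrow> carrier M = {\<zero>\<^bsub>M\<^esub>}"

definition hom_group ::
    "('r, 'x) ring_scheme \<Rightarrow> ('r, 'm, 'y) module_scheme \<Rightarrow> ('r, 'n, 'z) module_scheme \<Rightarrow> ('m \<Rightarrow> 'n) ring"
  where "hom_group R M N = \<lparr>carrier = mod_hom R M N, mult = undefined, one = undefined,
    zero = (\<lambda>x\<in>carrier M. \<zero>\<^bsub>N\<^esub>), add = (\<lambda>f g. \<lambda>x\<in>carrier M. f x \<oplus>\<^bsub>N\<^esub> g x)\<rparr>"

text \<open>\<open>Hom\<^sub>S(C, N)\<close> as a left \<open>R\<close>-module: \<open>(r f)(c) = f (c r)\<close>.\<close>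

definition hom_module ::
    "('s, 'x) ring_scheme \<Rightarrow> ('s, 'r, 'c, 'y) bimodule_scheme \<Rightarrow> ('s, 'n, 'z) module_scheme \<Rightarrow>
      ('r, 'c \<Rightarrow> 'n) module"
  where "hom_module S C N = \<lparr>carrier = mod_hom S C N, mult = undefined, one = undefined,
    zero = (\<lambda>x\<in>carrier C. \<zero>\<^bsub>N\<^esub>), add = (\<lambda>f g. \<lambda>x\<in>carrier C. f x \<oplus>\<^bsub>N\<^esub> g x),
    smult = (\<lambda>r f. \<lambda>x\<in>carrier C. f (rsmult C x r))\<rparr>"

definition kernel_module ::
    "('r, 'm, 'y) module_scheme \<Rightarrow> ('r, 'n, 'z) module_scheme \<Rightarrow> ('m \<Rightarrow> 'n) \<Rightarrow> ('r, 'm, 'y) module_scheme"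
  where "kernel_module M N f = M\<lparr>carrier := a_kernel M N f\<rparr>"

definition quotient_module :: "('r, 'm, 'z) module_scheme \<Rightarrow> 'm set \<Rightarrow> ('r, 'm set) module"
  where "quotient_module M H = \<lparr>carrier = a_rcosets\<^bsub>M\<^esub> H, mult = undefined, one = undefined,
    zero = H, add = set_add M, smult = (\<lambda>r X. \<Union>x\<in>X. H +>\<^bsub>M\<^esub> (r \<odot>\<^bsub>M\<^esub> x))\<rparr>"

definition cokernel_module ::
    "('r, 'm, 'y) module_scheme \<Rightarrow> ('r, 'n, 'z) module_scheme \<Rightarrow> ('m \<Rightarrow> 'n) \<Rightarrow> ('r, 'n set) module"
  where "cokernel_module M N f = quotient_module N (f ` carrier M)"

definition exact_at ::
    "('a, 'x) ring_scheme \<Rightarrow> ('a \<Rightarrow> 'b) \<Rightarrow> ('b, 'y) ring_scheme \<Rightarrow> ('b \<Rightarrow> 'c) \<Rightarrow> ('c, 'z) ring_scheme \<Rightarrow> bool"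
  where "exact_at A f B g D \<longleftrightarrow> f ` carrier A = a_kernel B D g"

section \<open>Tensor products\<close>

text \<open>
  For a right \<open>R\<close>-module \<open>D\<close>, given as a left module over \<open>opp_ring R\<close>, and a left \<open>R\<close>-module \<open>M\<close>,
  the tensor product is the free abelian group on \<open>D \<times> M\<close> modulo the biadditivity relations and
  \<open>(d r, m) = (d, r m)\<close>.
\<close>

type_synonym ('d, 'm) tensors = "('d \<times> 'm \<Rightarrow>\<^sub>0 int) set"

definition tensor_free ::
    "('r, 'd, 'y) module_scheme \<Rightarrow> ('r, 'm, 'z) module_scheme \<Rightarrow> ('d \<times> 'm \<Rightarrow>\<^sub>0 int) monoid"
  where "tensor_free D M = free_Abelian_group (carrier D \<times> carrier M)"

definition tensor_relations ::
    "('r, 'x) ring_scheme \<Rightarrow> ('r, 'd, 'y) module_scheme \<Rightarrow> ('r, 'm, 'z) module_scheme \<Rightarrow>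
      ('d \<times> 'm \<Rightarrow>\<^sub>0 int) set"
  where "tensor_relations R D M = generate (tensor_free D M)
    ({frag_of (d \<oplus>\<^bsub>D\<^esub> d', m) - frag_of (d, m) - frag_of (d', m) | d d' m.
        d \<in> carrier D \<and> d' \<in> carrier D \<and> m \<in> carrier M} \<union>
     {frag_of (d, m \<oplus>\<^bsub>M\<^esub> m') - frag_of (d, m) - frag_of (d, m') | d m m'.
        d \<in> carrier D \<and> m \<in> carrier M \<and> m' \<in> carrier M} \<union>
     {frag_of (r \<odot>\<^bsub>D\<^esub> d, m) - frag_of (d, r \<odot>\<^bsub>M\<^esub> m) | r d m.
        r \<in> carrier R \<and> d \<in> carrier D \<and> m \<in> carrier M})"

definition tensor ::
    "('r, 'x) ring_scheme \<Rightarrow> ('r, 'd, 'y) module_scheme \<Rightarrow> ('r, 'm, 'z) module_scheme \<Rightarrow>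
      ('d, 'm) tensors ring"
  where "tensor R D M = (let Q = tensor_free D M Mod tensor_relations R D M in
    \<lparr>carrier = carrier Q, mult = undefined, one = undefined, zero = \<one>\<^bsub>Q\<^esub>, add = mult Q\<rparr>)"

definition pure_tensor ::
    "('r, 'x) ring_scheme \<Rightarrow> ('r, 'd, 'y) module_scheme \<Rightarrow> ('r, 'm, 'z) module_scheme \<Rightarrow>
      'd \<Rightarrow> 'm \<Rightarrow> ('d, 'm) tensors"
  where "pure_tensor R D M d m =
    tensor_relations R D M #>\<^bsub>tensor_free D M\<^esub> frag_of (d, m)"

text \<open>The homomorphism \<open>D \<otimes> M \<rightarrow> A\<close> with \<open>d \<otimes> m \<mapsto> \<beta> d m\<close>, for an \<open>R\<close>-balanced biadditive
  map \<open>\<beta>\<close>: extend \<open>\<beta>\<close> additively to the free abelian group and evaluate on representatives.\<close>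

definition tensor_lift ::
    "('r, 'x) ring_scheme \<Rightarrow> ('r, 'd, 'y) module_scheme \<Rightarrow> ('r, 'm, 'z) module_scheme \<Rightarrow>
      ('a, 'w) ring_scheme \<Rightarrow> ('d \<Rightarrow> 'm \<Rightarrow> 'a) \<Rightarrow> ('d, 'm) tensors \<Rightarrow> 'a"
  where "tensor_lift R D M A \<beta> = (\<lambda>X\<in>carrier (tensor R D M).
    the_elem ((\<lambda>x. \<Oplus>\<^bsub>A\<^esub>p\<in>Poly_Mapping.keys x.
      [Poly_Mapping.lookup x p] \<cdot>\<^bsub>A\<^esub> \<beta> (fst p) (snd p)) ` X))"

definition tensor_map ::
    "('r, 'x) ring_scheme \<Rightarrow> ('r, 'd, 'y) module_scheme \<Rightarrow> ('r, 'm, 'z) module_scheme \<Rightarrow>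
      ('r, 'e, 'v) module_scheme \<Rightarrow> ('r, 'n, 'w) module_scheme \<Rightarrow>
      ('d \<Rightarrow> 'e) \<Rightarrow> ('m \<Rightarrow> 'n) \<Rightarrow> ('d, 'm) tensors \<Rightarrow> ('e, 'n) tensors"
  where "tensor_map R D M E N f g =
    tensor_lift R D M (tensor R E N) (\<lambda>d m. pure_tensor R E N (f d) (g m))"

text \<open>\<open>C \<otimes>\<^sub>R M\<close> as a left \<open>S\<close>-module: \<open>s (c \<otimes> m) = (s c) \<otimes> m\<close>.\<close>

definition tensor_module ::
    "('r, 'x) ring_scheme \<Rightarrow> ('s, 'r, 'c, 'y) bimodule_scheme \<Rightarrow> ('r, 'm, 'z) module_scheme \<Rightarrow>
      ('s, ('c, 'm) tensors) module"
  where "tensor_module R C M = (let D = right_module C; T = tensor R D M in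
    \<lparr>carrier = carrier T, mult = undefined, one = undefined, zero = zero T, add = add T,
     smult = (\<lambda>s. tensor_map R D M D M (\<lambda>c. s \<odot>\<^bsub>C\<^esub> c) (\<lambda>m. m))\<rparr>)"

section \<open>Projective resolutions, Ext and Tor\<close>

definition free_module :: "('r, 'x) ring_scheme \<Rightarrow> 'b set \<Rightarrow> ('r, 'b \<Rightarrow> 'r) module"
  where "free_module R B = \<lparr>
    carrier = {f. (\<forall>b. f b \<in> carrier R) \<and> finite {b. f b \<noteq> \<zero>\<^bsub>R\<^esub>} \<and> {b. f b \<noteq> \<zero>\<^bsub>R\<^esub>} \<subseteq> B},
    mult = undefined, one = undefined, zero = (\<lambda>b. \<zero>\<^bsub>R\<^esub>), add = (\<lambda>f g b. f b \<oplus>\<^bsub>R\<^esub> g b),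
    smult = (\<lambda>r f b. r \<otimes>\<^bsub>R\<^esub> f b)\<rparr>"

text \<open>Projective means direct summand of a free module. As \<open>P\<close> is a quotient of the free
  module on its own elements, basis sets from the type of \<open>P\<close> suffice (\<open>projectiveI\<close> below).\<close>

definition projective :: "('r, 'x) ring_scheme \<Rightarrow> ('r, 'p, 'z) module_scheme \<Rightarrow> bool"
  where "projective R P \<longleftrightarrow> left_module R P \<and>
    (\<exists>(B :: 'p set) i q. i \<in> mod_hom R P (free_module R B) \<and> q \<in> mod_hom R (free_module R B) P \<and>
      (\<forall>x\<in>carrier P. q (i x) = x))"

definition finitely_generated :: "('r, 'x) ring_scheme \<Rightarrow> ('r, 'm, 'z) module_scheme \<Rightarrow> bool"
  where "finitely_generated R M \<longleftrightarrow> (\<exists>A\<subseteq>carrier M. finite A \<and>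
    carrier M = {\<Oplus>\<^bsub>M\<^esub>a\<in>A. k a \<odot>\<^bsub>M\<^esub> a | k. k \<in> A \<rightarrow> carrier R})"

definition projective_resolution ::
    "('r, 'x) ring_scheme \<Rightarrow> ('r, 'm, 'y) module_scheme \<Rightarrow>
      (nat \<Rightarrow> ('r, 'p) module) \<Rightarrow> (nat \<Rightarrow> 'p \<Rightarrow> 'p) \<Rightarrow> ('p \<Rightarrow> 'm) \<Rightarrow> bool"
  where "projective_resolution R M P d \<epsilon> \<longleftrightarrow>
    (\<forall>i. projective R (P i)) \<and>
    (\<forall>i. d i \<in> mod_hom R (P (Suc i)) (P i)) \<and>
    \<epsilon> \<in> mod_hom R (P 0) M \<and> \<epsilon> ` carrier (P 0) = carrier M \<and>
    exact_at (P 1) (d 0) (P 0) \<epsilon> M \<and>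
    (\<forall>i. exact_at (P (Suc (Suc i))) (d (Suc i)) (P (Suc i)) (d i) (P i))"

text \<open>
  All projective resolutions of a module \<open>M\<close> over \<open>R\<close> are taken inside the type \<open>res\<close> below. It is
  large enough: the index type is closed under formation of formal linear combinations, so that
  every module has a free resolution there (\<open>ex_projective_resolution\<close>). As the index type is
  infinite, every finitely generated projective module has a copy there, as a summand of a free
  module of finite rank (\<open>has_fg_projective_resolutionI\<close>).
\<close>

datatype ('r, 'm) res_index = Gen 'm | Comb "('r \<times> ('r, 'm) res_index) list"

type_synonym ('r, 'm) res = "('r, 'm) res_index \<Rightarrow> 'r"

definition has_fg_projective_resolution ::
    "('r, 'x) ring_scheme \<Rightarrow> ('r, 'm, 'y) module_scheme \<Rightarrow> bool"
  where "has_fg_projective_resolution R M \<longleftrightarrow>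
    (\<exists>(P :: nat \<Rightarrow> ('r, ('r, 'm) res) module) d \<epsilon>.
      projective_resolution R M P d \<epsilon> \<and> (\<forall>i. finitely_generated R (P i)))"

definition chosen_resolution ::
    "('r, 'x) ring_scheme \<Rightarrow> ('r, 'm, 'y) module_scheme \<Rightarrow>
      (nat \<Rightarrow> ('r, ('r, 'm) res) module) \<times> (nat \<Rightarrow> ('r, 'm) res \<Rightarrow> ('r, 'm) res) \<times> (('r, 'm) res \<Rightarrow> 'm)"
  where "chosen_resolution R M = (SOME (P, d, \<epsilon>). projective_resolution R M P d \<epsilon>)"

definition subquotient :: "('a, 'x) ring_scheme \<Rightarrow> 'a set \<Rightarrow> 'a set \<Rightarrow> 'a set monoid"
  where "subquotient A Z B = ((add_monoid A)\<lparr>carrier := Z\<rparr>) Mod B"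

definition precompose ::
    "('r, 'p, 'y) module_scheme \<Rightarrow> ('p \<Rightarrow> 'q) \<Rightarrow> ('q \<Rightarrow> 'n) \<Rightarrow> 'p \<Rightarrow> 'n"
  where "precompose P d f = compose (carrier P) f d"

definition Ext ::
    "nat \<Rightarrow> ('r, 'x) ring_scheme \<Rightarrow> ('r, 'm, 'y) module_scheme \<Rightarrow> ('r, 'n, 'z) module_scheme \<Rightarrow>
      (('r, 'm) res \<Rightarrow> 'n) set monoid"
  where "Ext i R M N = (case chosen_resolution R M of (P, d, \<epsilon>) \<Rightarrow>
    subquotient (hom_group R (P i) N)
      (a_kernel (hom_group R (P i) N) (hom_group R (P (Suc i)) N) (precompose (P (Suc i)) (d i)))
      (case i of 0 \<Rightarrow> {\<zero>\<^bsub>hom_group R (P 0) N\<^esub>}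
        | Suc j \<Rightarrow> precompose (P i) (d j) ` mod_hom R (P j) N))"

text \<open>\<open>Tor i R D M\<close> is \<open>Tor\<close> of a right \<open>R\<close>-module \<open>D\<close> (a left module over \<open>opp_ring R\<close>) and a left
  \<open>R\<close>-module \<open>M\<close>, computed from a resolution of \<open>D\<close>.\<close>

definition Tor ::
    "nat \<Rightarrow> ('r, 'x) ring_scheme \<Rightarrow> ('r, 'd, 'y) module_scheme \<Rightarrow> ('r, 'm, 'z) module_scheme \<Rightarrow>
      (('r, 'd) res, 'm) tensors set monoid"
  where "Tor i R D M = (case chosen_resolution (opp_ring R) D of (P, d, \<epsilon>) \<Rightarrow>
    let T = (\<lambda>j. tensor R (P j) M);
        \<delta> = (\<lambda>j. tensor_map R (P (Suc j)) M (P j) M (d j) (\<lambda>m. m))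
    in subquotient (T i)
      (case i of 0 \<Rightarrow> carrier (T 0) | Suc j \<Rightarrow> a_kernel (T i) (T j) (\<delta> j))
      (\<delta> i ` carrier (T (Suc i))))"

section \<open>Semidualizing bimodules, Auslander and Bass classes\<close>

definition semidualizing ::
    "('s, 'x) ring_scheme \<Rightarrow> ('r, 'y) ring_scheme \<Rightarrow> ('s, 'r, 'c, 'z) bimodule_scheme \<Rightarrow> bool"
  where "semidualizing S R C \<longleftrightarrow>
    is_bimodule S R C \<and>
    has_fg_projective_resolution S C \<and>
    has_fg_projective_resolution (opp_ring R) (right_module C) \<and>
    bij_betw (\<lambda>s. \<lambda>c\<in>carrier C. s \<odot>\<^bsub>C\<^esub> c) (carrier S)
      (mod_hom (opp_ring R) (right_module C) (right_module C)) \<and>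
    bij_betw (\<lambda>r. \<lambda>c\<in>carrier C. rsmult C c r) (carrier R) (mod_hom S C C) \<and>
    (\<forall>i\<ge>1. trivial_group (Ext i S C C)) \<and>
    (\<forall>i\<ge>1. trivial_group (Ext i (opp_ring R) (right_module C) (right_module C)))"

text \<open>
  A nonzero module contains a nonzero cyclic module, that is, a quotient of the ring, and
  \<open>Hom(C, -)\<close> is left exact. So the faithfulness conditions for modules of an arbitrary type follow
  from those for modules carried by sets of ring elements, the type used here
  (\<open>hom_faithful_any_type\<close>).
\<close>

definition hom_faithful :: "('r, 'x) ring_scheme \<Rightarrow> ('r, 'c, 'z) module_scheme \<Rightarrow> bool"
  where "hom_faithful R C \<longleftrightarrow> (\<forall>N :: ('r, 'r set) module. left_module R N \<longrightarrow>
    mod_hom R C N = {\<lambda>c\<in>carrier C. \<zero>\<^bsub>N\<^esub>} \<longrightarrow> zero_module N)"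

definition faithfully_semidualizing ::
    "('s, 'x) ring_scheme \<Rightarrow> ('r, 'y) ring_scheme \<Rightarrow> ('s, 'r, 'c, 'z) bimodule_scheme \<Rightarrow> bool"
  where "faithfully_semidualizing S R C \<longleftrightarrow> semidualizing S R C \<and>
    hom_faithful S C \<and> hom_faithful (opp_ring R) (right_module C)"

definition auslander_class ::
    "('s, 'x) ring_scheme \<Rightarrow> ('r, 'y) ring_scheme \<Rightarrow> ('s, 'r, 'c, 'z) bimodule_scheme \<Rightarrow>
      ('r, 'm) module set"
  where "auslander_class S R C = {M. left_module R M \<and>
    (\<forall>i\<ge>1. trivial_group (Tor i R (right_module C) M)) \<and>
    (\<forall>i\<ge>1. trivial_group (Ext i S C (tensor_module R C M))) \<and>
    (\<lambda>m\<in>carrier M. \<lambda>c\<in>carrier C. pure_tensor R (right_module C) M c m)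
      \<in> mod_iso R M (hom_module S C (tensor_module R C M))}"

definition bass_class ::
    "('s, 'x) ring_scheme \<Rightarrow> ('r, 'y) ring_scheme \<Rightarrow> ('s, 'r, 'c, 'z) bimodule_scheme \<Rightarrow>
      ('s, 'n) module set"
  where "bass_class S R C = {N. left_module S N \<and>
    (\<forall>i\<ge>1. trivial_group (Ext i S C N)) \<and>
    (\<forall>i\<ge>1. trivial_group (Tor i R (right_module C) (hom_module S C N))) \<and>
    tensor_lift R (right_module C) (hom_module S C N) N (\<lambda>c f. f c)
      \<in> mod_iso S (tensor_module R C (hom_module S C N)) N}"

section \<open>Iterated classes\<close>

definition exact_complex :: "(int \<Rightarrow> ('a, 'x) ring_scheme) \<Rightarrow> (int \<Rightarrow> 'a \<Rightarrow> 'a) \<Rightarrow> bool"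
  where "exact_complex X d \<longleftrightarrow>
    (\<forall>i. exact_at (X i) (d i) (X (i + 1)) (d (i + 1)) (X (i + 2)))"

definition exact_sequence ::
    "('r, 'x) ring_scheme \<Rightarrow> (int \<Rightarrow> ('r, 'm) module) \<Rightarrow> (int \<Rightarrow> 'm \<Rightarrow> 'm) \<Rightarrow> bool"
  where "exact_sequence R X d \<longleftrightarrow>
    (\<forall>i. left_module R (X i)) \<and> (\<forall>i. d i \<in> mod_hom R (X i) (X (i + 1))) \<and> exact_complex X d"

definition tensor_exact ::
    "('r, 'x) ring_scheme \<Rightarrow> ('s, 'r, 'c, 'y) bimodule_scheme \<Rightarrow>
      (int \<Rightarrow> ('r, 'm) module) \<Rightarrow> (int \<Rightarrow> 'm \<Rightarrow> 'm) \<Rightarrow> bool"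
  where "tensor_exact R C X d \<longleftrightarrow> (let D = right_module C in
    exact_complex (\<lambda>i. tensor_module R C (X i))
      (\<lambda>i. tensor_map R D (X i) D (X (i + 1)) (\<lambda>c. c) (d i)))"

definition hom_exact ::
    "('s, 'x) ring_scheme \<Rightarrow> ('s, 'r, 'c, 'y) bimodule_scheme \<Rightarrow>
      (int \<Rightarrow> ('s, 'n) module) \<Rightarrow> (int \<Rightarrow> 'n \<Rightarrow> 'n) \<Rightarrow> bool"
  where "hom_exact S C Y d \<longleftrightarrow>
    exact_complex (\<lambda>i. hom_module S C (Y i)) (\<lambda>i f. compose (carrier C) (d i) f)"

text \<open>
  The sequence \<open>\<cdots> \<rightarrow> G\<^sub>1 \<rightarrow> G\<^sub>0 \<rightarrow> G\<^sup>0 \<rightarrow> G\<^sup>1 \<rightarrow> \<cdots>\<close> is indexed by the integers, with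
  \<open>X j = G\<^sup>j\<close> for \<open>j \<ge> 0\<close> and \<open>X (- 1 - j) = G\<^sub>j\<close>; the differential \<open>d j\<close> goes from \<open>X j\<close> to
  \<open>X (j + 1)\<close>. Thus \<open>d (-2)\<close> is \<open>G\<^sub>1 \<rightarrow> G\<^sub>0\<close> and \<open>d 0\<close> is \<open>G\<^sup>0 \<rightarrow> G\<^sup>1\<close>.
  All modules of a sequence are carried by the same type as \<open>M\<close>; that type is arbitrary.
\<close>

definition auslander_step ::
    "('r, 'y) ring_scheme \<Rightarrow> ('s, 'r, 'c, 'z) bimodule_scheme \<Rightarrow>
      ('r, 'm) module set \<Rightarrow> ('r, 'm) module set"
  where "auslander_step R C \<G> = {M. left_module R M \<and>
    (\<exists>X d. exact_sequence R X d \<and> tensor_exact R C X d \<and> (\<forall>i. X i \<in> \<G>) \<and>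
      mod_isomorphic R M (cokernel_module (X (-2)) (X (-1)) (d (-2))))}"

definition bass_step ::
    "('s, 'x) ring_scheme \<Rightarrow> ('s, 'r, 'c, 'z) bimodule_scheme \<Rightarrow>
      ('s, 'n) module set \<Rightarrow> ('s, 'n) module set"
  where "bass_step S C \<V> = {M. left_module S M \<and>
    (\<exists>Y d. exact_sequence S Y d \<and> hom_exact S C Y d \<and> (\<forall>i. Y i \<in> \<V>) \<and>
      mod_isomorphic S M (kernel_module (Y 0) (Y 1) (d 0)))}"

text \<open>The iterated classes are meaningful for \<open>n \<ge> 1\<close>.\<close>

definition auslander_iter ::
    "('s, 'x) ring_scheme \<Rightarrow> ('r, 'y) ring_scheme \<Rightarrow> ('s, 'r, 'c, 'z) bimodule_scheme \<Rightarrow> nat \<Rightarrow>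
      ('r, 'm) module set"
  where "auslander_iter S R C n = (auslander_step R C ^^ (n - 1)) (auslander_class S R C)"

definition bass_iter ::
    "('s, 'x) ring_scheme \<Rightarrow> ('r, 'y) ring_scheme \<Rightarrow> ('s, 'r, 'c, 'z) bimodule_scheme \<Rightarrow> nat \<Rightarrow>
      ('s, 'n) module set"
  where "bass_iter S R C n = (bass_step S C ^^ (n - 1)) (bass_class S R C)"

section \<open>Adequacy of the type choices\<close>

text \<open>
  Nothing below enters the definitions. Projectivity does not depend on the type of the basis
  (\<open>projectiveI\<close>) and gives the lifting property for modules of arbitrary types
  (\<open>projective_lifting\<close>). Projective resolutions exist in the type used to define \<open>Ext\<close> and
  \<open>Tor\<close> (\<open>ex_projective_resolution\<close>). A resolution by finitely generated projectives in any type
  yields one in that type (\<open>has_fg_projective_resolutionI\<close>). \<open>Hom\<close>-faithfulness extends to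
  modules of arbitrary types (\<open>hom_faithful_any_type\<close>).
\<close>

lemma (in left_module) smult_l_null: "x \<in> carrier M \<Longrightarrow> \<zero> \<odot>\<^bsub>M\<^esub> x = \<zero>\<^bsub>M\<^esub>"
proof -
  assume x: "x \<in> carrier M"
  then have "\<zero> \<odot>\<^bsub>M\<^esub> x \<oplus>\<^bsub>M\<^esub> \<zero> \<odot>\<^bsub>M\<^esub> x = \<zero> \<odot>\<^bsub>M\<^esub> x \<oplus>\<^bsub>M\<^esub> \<zero>\<^bsub>M\<^esub>"
    using smult_l_distr[of \<zero> \<zero> x] by simp
  with x show ?thesis by (metis M.add.right_cancel M.zero_closed M.add.m_comm R.zero_closed smult_closed)
qed

lemma (in left_module) smult_r_null: "r \<in> carrier R \<Longrightarrow> r \<odot>\<^bsub>M\<^esub> \<zero>\<^bsub>M\<^esub> = \<zero>\<^bsub>M\<^esub>"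
proof -
  assume x: "r \<in> carrier R"
  then have "r \<odot>\<^bsub>M\<^esub> \<zero>\<^bsub>M\<^esub> \<oplus>\<^bsub>M\<^esub> r \<odot>\<^bsub>M\<^esub> \<zero>\<^bsub>M\<^esub> = r \<odot>\<^bsub>M\<^esub> \<zero>\<^bsub>M\<^esub> \<oplus>\<^bsub>M\<^esub> \<zero>\<^bsub>M\<^esub>"
    using smult_r_distr[of r "\<zero>\<^bsub>M\<^esub>" "\<zero>\<^bsub>M\<^esub>"] by simp
  with x show ?thesis by (metis M.add.right_cancel M.zero_closed M.add.m_comm smult_closed)
qed

lemma (in left_module) finsum_smult:
  assumes "finite A" "g \<in> A \<rightarrow> carrier M" "r \<in> carrier R"
  shows "r \<odot>\<^bsub>M\<^esub> (\<Oplus>\<^bsub>M\<^esub>a\<in>A. g a) = (\<Oplus>\<^bsub>M\<^esub>a\<in>A. r \<odot>\<^bsub>M\<^esub> g a)"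
  using assms
proof (induction A)
  case empty then show ?case by (simp add: smult_r_null)
next
  case (insert a A)
  then have "finsum M g A \<in> carrier M" "g a \<in> carrier M" "g \<in> A \<rightarrow> carrier M" by auto
  with insert show ?case by (simp add: smult_r_distr Pi_def)
qed

lemma mod_hom_zero:
  assumes "left_module R M" "left_module R N" "f \<in> mod_hom R M N"
  shows "f \<zero>\<^bsub>M\<^esub> = \<zero>\<^bsub>N\<^esub>"
proof -
  interpret M: left_module R M by fact
  interpret N: left_module R N by fact
  have "f \<zero>\<^bsub>M\<^esub> = f (\<zero>\<^bsub>R\<^esub> \<odot>\<^bsub>M\<^esub> \<zero>\<^bsub>M\<^esub>)" by (simp add: M.smult_l_null)
  also have "\<dots> = \<zero>\<^bsub>R\<^esub> \<odot>\<^bsub>N\<^esub> f \<zero>\<^bsub>M\<^esub>" using assms(3) by (auto simp: mod_hom_def)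
  also have "\<dots> = \<zero>\<^bsub>N\<^esub>" using assms(3) by (intro N.smult_l_null) (auto simp: mod_hom_def)
  finally show ?thesis .
qed

lemma mod_hom_compose:
  assumes "left_module R M" "f \<in> mod_hom R M N" "g \<in> mod_hom R N Q"
  shows "compose (carrier M) g f \<in> mod_hom R M Q"
proof -
  interpret left_module R M by fact
  show ?thesis using assms(2,3)
    by (auto simp: mod_hom_def compose_def PiE_def Pi_def)
qed

lemma left_module_submodule:
  assumes "left_module R M" "H \<subseteq> carrier M" "\<zero>\<^bsub>M\<^esub> \<in> H"
    "\<And>x y. x \<in> H \<Longrightarrow> y \<in> H \<Longrightarrow> x \<oplus>\<^bsub>M\<^esub> y \<in> H"
    "\<And>r x. r \<in> carrier R \<Longrightarrow> x \<in> H \<Longrightarrow> r \<odot>\<^bsub>M\<^esub> x \<in> H"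
  shows "left_module R (M\<lparr>carrier := H\<rparr>)"
proof -
  interpret left_module R M by fact
  have neg: "(\<ominus>\<^bsub>R\<^esub> \<one>\<^bsub>R\<^esub>) \<odot>\<^bsub>M\<^esub> x \<oplus>\<^bsub>M\<^esub> x = \<zero>\<^bsub>M\<^esub>" if "x \<in> carrier M" for x
    using smult_l_distr[of "\<ominus>\<^bsub>R\<^esub> \<one>\<^bsub>R\<^esub>" "\<one>\<^bsub>R\<^esub>" x] that by (simp add: R.l_neg smult_l_null)
  have sub: "x \<in> carrier M" if "x \<in> H" for x using assms(2) that by auto
  have "\<exists>y\<in>H. y \<oplus>\<^bsub>M\<^esub> x = \<zero>\<^bsub>M\<^esub>" if "x \<in> H" for x
    using neg[OF sub[OF that]] assms(5)[OF _ that, of "\<ominus>\<^bsub>R\<^esub> \<one>\<^bsub>R\<^esub>"] by auto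
  then have "abelian_group (M\<lparr>carrier := H\<rparr>)"
    using assms(3-) sub by (intro abelian_groupI) (auto simp: M.a_ac)
  then show ?thesis
    using assms sub by (auto intro!: left_module.intro left_module_axioms.intro R.ring_axioms
      simp: smult_l_distr smult_r_distr smult_assoc1)
qed

lemma left_module_kernel_module:
  assumes "left_module R M" "left_module R N" "f \<in> mod_hom R M N"
  shows "left_module R (kernel_module M N f)"
proof -
  interpret M: left_module R M by fact
  interpret N: left_module R N by fact
  show ?thesis unfolding kernel_module_def
    using assms(3) mod_hom_zero[OF assms]
    by (intro left_module_submodule assms)
      (auto simp: a_kernel_def kernel_def mod_hom_def N.smult_r_null)
qed

lemma left_module_free_module:
  fixes R (structure)
  assumes "ring R" shows "left_module R (free_module R B)"
proof -
  interpret ring R by fact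
  have fin: "finite {b. f b \<oplus> g b \<noteq> \<zero>}" "{b. f b \<oplus> g b \<noteq> \<zero>} \<subseteq> B"
    if "\<forall>b. f b \<in> carrier R" "\<forall>b. g b \<in> carrier R"
      "finite {b. f b \<noteq> \<zero>}" "finite {b. g b \<noteq> \<zero>}" "{b. f b \<noteq> \<zero>} \<subseteq> B" "{b. g b \<noteq> \<zero>} \<subseteq> B" for f g
  proof -
    have *: "{b. f b \<oplus> g b \<noteq> \<zero>} \<subseteq> {b. f b \<noteq> \<zero>} \<union> {b. g b \<noteq> \<zero>}" by auto
    show "finite {b. f b \<oplus> g b \<noteq> \<zero>}" using * that by (meson finite_UnI finite_subset)
    show "{b. f b \<oplus> g b \<noteq> \<zero>} \<subseteq> B" using * that by blast
  qed
  have smul: "finite {b. r \<otimes> f b \<noteq> \<zero>}" "{b. r \<otimes> f b \<noteq> \<zero>} \<subseteq> B"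
    if "r \<in> carrier R" "finite {b. f b \<noteq> \<zero>}" "{b. f b \<noteq> \<zero>} \<subseteq> B" for r f
  proof -
    have *: "{b. r \<otimes> f b \<noteq> \<zero>} \<subseteq> {b. f b \<noteq> \<zero>}" using that by auto
    show "finite {b. r \<otimes> f b \<noteq> \<zero>}" using * that by (meson finite_subset)
    show "{b. r \<otimes> f b \<noteq> \<zero>} \<subseteq> B" using * that by blast
  qed
  have neg: "\<exists>g. ((\<forall>b. g b \<in> carrier R) \<and> finite {b. g b \<noteq> \<zero>} \<and> {b. g b \<noteq> \<zero>} \<subseteq> B) \<and>
      (\<lambda>b. g b \<oplus> f b) = (\<lambda>b. \<zero>)"
    if "\<forall>b. f b \<in> carrier R" "finite {b. f b \<noteq> \<zero>}" "{b. f b \<noteq> \<zero>} \<subseteq> B" for f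
  proof (intro exI conjI)
    have *: "{b. \<ominus> f b \<noteq> \<zero>} \<subseteq> {b. f b \<noteq> \<zero>}" by auto
    show "finite {b. \<ominus> f b \<noteq> \<zero>}" using * that by (meson finite_subset)
    show "{b. \<ominus> f b \<noteq> \<zero>} \<subseteq> B" using * that by blast
  qed (use that in \<open>auto simp: l_neg\<close>)
  have "abelian_group (free_module R B)"
  proof (rule abelian_groupI)
    fix x assume "x \<in> carrier (free_module R B)"
    then show "\<exists>y\<in>carrier (free_module R B). y \<oplus>\<^bsub>free_module R B\<^esub> x = \<zero>\<^bsub>free_module R B\<^esub>"
      using neg[of x] by (simp add: free_module_def Bex_def)
  next
    fix x y assume "x \<in> carrier (free_module R B)" "y \<in> carrier (free_module R B)"
    then show "x \<oplus>\<^bsub>free_module R B\<^esub> y \<in> carrier (free_module R B)"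
      using fin[of x y] by (simp add: free_module_def)
  qed (auto simp: free_module_def a_ac fun_eq_iff)
  then show ?thesis
    apply (intro left_module.intro left_module_axioms.intro assms)
        apply assumption
    subgoal for a x using smul[of a x] by (simp add: free_module_def)
    by (auto simp: free_module_def l_distr r_distr m_assoc fun_eq_iff)
qed

definition unit_vector :: "('r, 'x) ring_scheme \<Rightarrow> 'b \<Rightarrow> 'b \<Rightarrow> 'r"
  where "unit_vector R b = (\<lambda>b'. if b' = b then \<one>\<^bsub>R\<^esub> else \<zero>\<^bsub>R\<^esub>)"

definition free_lift ::
    "('r, 'x) ring_scheme \<Rightarrow> 'b set \<Rightarrow> ('r, 'm, 'z) module_scheme \<Rightarrow> ('b \<Rightarrow> 'm) \<Rightarrow> ('b \<Rightarrow> 'r) \<Rightarrow> 'm"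
  where "free_lift R B M m = (\<lambda>f\<in>carrier (free_module R B).
    \<Oplus>\<^bsub>M\<^esub>b\<in>{b. f b \<noteq> \<zero>\<^bsub>R\<^esub>}. f b \<odot>\<^bsub>M\<^esub> m b)"

lemma unit_vector_closed:
  fixes R (structure)
  assumes "ring R" "b \<in> B" shows "unit_vector R b \<in> carrier (free_module R B)"
proof -
  interpret ring R by fact
  have "{b'. unit_vector R b b' \<noteq> \<zero>} \<subseteq> {b}" by (auto simp: unit_vector_def)
  moreover have "\<forall>b'. unit_vector R b b' \<in> carrier R" by (auto simp: unit_vector_def)
  ultimately show ?thesis using assms(2)
    by (auto simp: free_module_def dest: finite_subset)
qed

lemma free_lift_superset:
  assumes "left_module R M" "m \<in> B \<rightarrow> carrier M" "f \<in> carrier (free_module R B)"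
    and "finite A" "{b. f b \<noteq> \<zero>\<^bsub>R\<^esub>} \<subseteq> A" "A \<subseteq> B"
  shows "free_lift R B M m f = (\<Oplus>\<^bsub>M\<^esub>b\<in>A. f b \<odot>\<^bsub>M\<^esub> m b)"
proof -
  interpret left_module R M by fact
  have mA: "m b \<in> carrier M" if "b \<in> A" for b using that assms by auto
  show ?thesis unfolding free_lift_def using assms(3-)
    by (simp, intro M.add.finprod_mono_neutral_cong_left)
      (auto simp: mA smult_l_null free_module_def)
qed

lemma free_lift_hom:
  assumes "left_module R M" "m \<in> B \<rightarrow> carrier M"
  shows "free_lift R B M m \<in> mod_hom R (free_module R B) M"
proof -
  interpret left_module R M by fact
  let ?F = "free_module R B"
  interpret F: left_module R ?F by (rule left_module_free_module) (rule R.ring_axioms)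
  have add: "free_lift R B M m (f \<oplus>\<^bsub>?F\<^esub> g) = free_lift R B M m f \<oplus>\<^bsub>M\<^esub> free_lift R B M m g"
    if "f \<in> carrier ?F" "g \<in> carrier ?F" for f g
  proof -
    define A where "A = {b. f b \<noteq> \<zero>\<^bsub>R\<^esub>} \<union> {b. g b \<noteq> \<zero>\<^bsub>R\<^esub>}"
    have A: "finite A" "A \<subseteq> B" and c: "\<And>b. f b \<in> carrier R" "\<And>b. g b \<in> carrier R"
      using that by (auto simp: A_def free_module_def)
    have mA: "m b \<in> carrier M" if "b \<in> A" for b using that A assms by auto
    have e: "f \<oplus>\<^bsub>?F\<^esub> g = (\<lambda>b. f b \<oplus>\<^bsub>R\<^esub> g b)" by (simp add: free_module_def)
    have s: "{b. (f \<oplus>\<^bsub>?F\<^esub> g) b \<noteq> \<zero>\<^bsub>R\<^esub>} \<subseteq> A" by (auto simp: e A_def)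
    have "free_lift R B M m (f \<oplus>\<^bsub>?F\<^esub> g) = (\<Oplus>\<^bsub>M\<^esub>b\<in>A. (f b \<oplus>\<^bsub>R\<^esub> g b) \<odot>\<^bsub>M\<^esub> m b)"
      using F.a_closed[OF that] s A by (subst free_lift_superset[OF assms, of _ A]) (simp_all add: e)
    also have "\<dots> = (\<Oplus>\<^bsub>M\<^esub>b\<in>A. f b \<odot>\<^bsub>M\<^esub> m b \<oplus>\<^bsub>M\<^esub> g b \<odot>\<^bsub>M\<^esub> m b)"
      by (rule M.finsum_cong') (auto simp: mA c smult_l_distr)
    also have "\<dots> = (\<Oplus>\<^bsub>M\<^esub>b\<in>A. f b \<odot>\<^bsub>M\<^esub> m b) \<oplus>\<^bsub>M\<^esub> (\<Oplus>\<^bsub>M\<^esub>b\<in>A. g b \<odot>\<^bsub>M\<^esub> m b)"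
      by (rule M.finsum_addf) (auto simp: mA c)
    also have "\<dots> = free_lift R B M m f \<oplus>\<^bsub>M\<^esub> free_lift R B M m g"
      using that A by (simp add: free_lift_superset[OF assms, of _ A] A_def)
    finally show ?thesis .
  qed
  have smul: "free_lift R B M m (r \<odot>\<^bsub>?F\<^esub> f) = r \<odot>\<^bsub>M\<^esub> free_lift R B M m f"
    if "f \<in> carrier ?F" "r \<in> carrier R" for f r
  proof -
    define A where "A = {b. f b \<noteq> \<zero>\<^bsub>R\<^esub>}"
    have A: "finite A" "A \<subseteq> B" and c: "\<And>b. f b \<in> carrier R"
      using that by (auto simp: A_def free_module_def)
    have mA: "m b \<in> carrier M" if "b \<in> A" for b using that A assms by auto
    have e: "r \<odot>\<^bsub>?F\<^esub> f = (\<lambda>b. r \<otimes>\<^bsub>R\<^esub> f b)" by (simp add: free_module_def)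
    have s: "{b. (r \<odot>\<^bsub>?F\<^esub> f) b \<noteq> \<zero>\<^bsub>R\<^esub>} \<subseteq> A" using that by (auto simp: e A_def)
    have "free_lift R B M m (r \<odot>\<^bsub>?F\<^esub> f) = (\<Oplus>\<^bsub>M\<^esub>b\<in>A. (r \<otimes>\<^bsub>R\<^esub> f b) \<odot>\<^bsub>M\<^esub> m b)"
      using F.smult_closed[OF that(2,1)] s A by (subst free_lift_superset[OF assms, of _ A]) (simp_all add: e)
    also have "\<dots> = (\<Oplus>\<^bsub>M\<^esub>b\<in>A. r \<odot>\<^bsub>M\<^esub> (f b \<odot>\<^bsub>M\<^esub> m b))"
      by (rule M.finsum_cong') (auto simp: mA c that smult_assoc1)
    also have "\<dots> = r \<odot>\<^bsub>M\<^esub> (\<Oplus>\<^bsub>M\<^esub>b\<in>A. f b \<odot>\<^bsub>M\<^esub> m b)"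
      by (rule finsum_smult[symmetric]) (auto simp: A mA c that)
    also have "\<dots> = r \<odot>\<^bsub>M\<^esub> free_lift R B M m f"
      using that A by (simp add: free_lift_superset[OF assms, of _ A] A_def)
    finally show ?thesis .
  qed
  have cl: "free_lift R B M m f \<in> carrier M" if "f \<in> carrier ?F" for f
    using that assms(2) by (auto simp: free_lift_def free_module_def intro!: M.finsum_closed)
  show ?thesis
    using add smul cl by (auto simp: mod_hom_def free_lift_def)
qed

lemma free_lift_unit_vector:
  assumes "left_module R M" "m \<in> B \<rightarrow> carrier M" "b \<in> B"
  shows "free_lift R B M m (unit_vector R b) = m b"
proof -
  interpret left_module R M by fact
  have "free_lift R B M m (unit_vector R b) = (\<Oplus>\<^bsub>M\<^esub>b'\<in>{b}. unit_vector R b b' \<odot>\<^bsub>M\<^esub> m b')"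
    using assms R.ring_axioms
    by (intro free_lift_superset unit_vector_closed) (auto simp: unit_vector_def)
  also have "\<dots> = m b" using funcset_mem[OF assms(2,3)] by (simp add: unit_vector_def)
  finally show ?thesis .
qed

lemma free_hom_eq:
  assumes "left_module R M" "f \<in> mod_hom R (free_module R B) M" "g \<in> mod_hom R (free_module R B) M"
    and eq: "\<And>b. b \<in> B \<Longrightarrow> f (unit_vector R b) = g (unit_vector R b)"
  shows "f = g"
proof -
  interpret left_module R M by fact
  let ?F = "free_module R B"
  have LF: "left_module R ?F" by (rule left_module_free_module) (rule R.ring_axioms)
  interpret F: left_module R ?F by fact
  have "f x = g x" if "finite A" "A \<subseteq> B" "x \<in> carrier ?F" "{b. x b \<noteq> \<zero>\<^bsub>R\<^esub>} \<subseteq> A" for A x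
    using that
  proof (induction A arbitrary: x)
    case empty
    then have "x = \<zero>\<^bsub>?F\<^esub>" by (auto simp: free_module_def)
    then show ?case using mod_hom_zero[OF LF assms(1,2)] mod_hom_zero[OF LF assms(1,3)] by simp
  next
    case (insert b A)
    let ?u = "unit_vector R b"
    define y where "y = x(b := \<zero>\<^bsub>R\<^esub>)"
    have u: "?u \<in> carrier ?F" using insert.prems R.ring_axioms by (intro unit_vector_closed) auto
    have xb: "x b \<in> carrier R" using insert.prems by (auto simp: free_module_def)
    have "{b. y b \<noteq> \<zero>\<^bsub>R\<^esub>} \<subseteq> {b. x b \<noteq> \<zero>\<^bsub>R\<^esub>}" by (auto simp: y_def)
    moreover from this have "finite {b. y b \<noteq> \<zero>\<^bsub>R\<^esub>}"
      using insert.prems(2) by (auto simp: free_module_def intro: finite_subset)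
    moreover have "y b' \<in> carrier R" for b' using insert.prems(2) by (auto simp: free_module_def y_def)
    moreover have "{b. y b \<noteq> \<zero>\<^bsub>R\<^esub>} \<subseteq> A" using insert.prems(3) by (auto simp: y_def)
    ultimately have y: "y \<in> carrier ?F" "{b. y b \<noteq> \<zero>\<^bsub>R\<^esub>} \<subseteq> A"
      using insert.prems(1) by (auto simp: free_module_def)
    have x: "x = x b \<odot>\<^bsub>?F\<^esub> ?u \<oplus>\<^bsub>?F\<^esub> y"
      using insert.prems xb by (auto simp: free_module_def unit_vector_def y_def fun_eq_iff)
    have hx: "h x = x b \<odot>\<^bsub>M\<^esub> h ?u \<oplus>\<^bsub>M\<^esub> h y" if "h \<in> mod_hom R ?F M" for h
      using that u xb y(1) F.smult_closed[OF xb u]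
      by (subst x) (simp add: mod_hom_def)
    have "f y = g y" using insert.IH[of y] y insert.prems(1) by auto
    then show ?case using hx[OF assms(2)] hx[OF assms(3)] eq[of b] insert.prems(1) by simp
  qed
  from this[of "{b. x b \<noteq> \<zero>\<^bsub>R\<^esub>}" x for x] have "f x = g x" if "x \<in> carrier ?F" for x
    using that by (auto simp: free_module_def)
  then show ?thesis using assms(2,3)
    by (intro PiE_ext[of f "carrier ?F" "\<lambda>_. carrier M" g]) (auto simp: mod_hom_def)
qed

lemma free_module_lifting:
  assumes "left_module R M" "left_module R N" "g \<in> mod_hom R M N" "g ` carrier M = carrier N"
    and "f \<in> mod_hom R (free_module R B) N"
  shows "\<exists>h\<in>mod_hom R (free_module R B) M. \<forall>x\<in>carrier (free_module R B). g (h x) = f x"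
proof -
  interpret M: left_module R M by fact
  let ?F = "free_module R B"
  have LF: "left_module R ?F" by (rule left_module_free_module) (rule M.R.ring_axioms)
  have "\<exists>y\<in>carrier M. g y = f (unit_vector R b)" if "b \<in> B" for b
  proof -
    have "f (unit_vector R b) \<in> carrier N"
      using assms(5) unit_vector_closed[OF M.R.ring_axioms that] by (auto simp: mod_hom_def)
    then show ?thesis using assms(4) by (metis imageE)
  qed
  then obtain m where m: "\<And>b. b \<in> B \<Longrightarrow> m b \<in> carrier M \<and> g (m b) = f (unit_vector R b)" by metis
  let ?h = "free_lift R B M m"
  have h: "?h \<in> mod_hom R ?F M" using m by (intro free_lift_hom assms) auto
  have "compose (carrier ?F) g ?h = f"
    using m by (intro free_hom_eq[OF assms(2), of _ B] mod_hom_compose[OF LF h] assms)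
      (simp add: compose_def unit_vector_closed[OF M.R.ring_axioms] free_lift_unit_vector[OF assms(1)] Pi_def)
  then have "g (?h x) = f x" if "x \<in> carrier ?F" for x using that by (metis compose_eq)
  with h show ?thesis by blast
qed

theorem projective_lifting:
  fixes P :: "('r, 'p, 'z) module_scheme"
  assumes "projective R P" "left_module R M" "left_module R N"
    and "g \<in> mod_hom R M N" "g ` carrier M = carrier N" "f \<in> mod_hom R P N"
  shows "\<exists>h\<in>mod_hom R P M. \<forall>x\<in>carrier P. g (h x) = f x"
proof -
  obtain B :: "'p set" and i q where P: "left_module R P" and i: "i \<in> mod_hom R P (free_module R B)"
    and q: "q \<in> mod_hom R (free_module R B) P" and qi: "\<forall>x\<in>carrier P. q (i x) = x"
    using assms(1) unfolding projective_def by blast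
  let ?F = "free_module R B"
  interpret P: left_module R P by fact
  have LF: "left_module R ?F" by (rule left_module_free_module) (rule P.R.ring_axioms)
  obtain h where h: "h \<in> mod_hom R ?F M" "\<forall>x\<in>carrier ?F. g (h x) = compose (carrier ?F) f q x"
    using free_module_lifting[OF assms(2-5) mod_hom_compose[OF LF q assms(6)]] by auto
  have "i x \<in> carrier ?F" if "x \<in> carrier P" for x using i that by (auto simp: mod_hom_def)
  then have "\<forall>x\<in>carrier P. g (compose (carrier P) h i x) = f x"
    using h qi by (simp add: compose_def)
  then show ?thesis using mod_hom_compose[OF P i h(1)] by blast
qed

theorem projectiveI:
  assumes "left_module R P" "i \<in> mod_hom R P (free_module R B)" "q \<in> mod_hom R (free_module R B) P"
    and "\<And>x. x \<in> carrier P \<Longrightarrow> q (i x) = x"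
  shows "projective R P"
proof -
  interpret P: left_module R P by fact
  let ?F = "free_module R B" and ?G = "free_module R (carrier P)"
  let ?e = "free_lift R (carrier P) P (\<lambda>x. x)"
  have LG: "left_module R ?G" by (rule left_module_free_module) (rule P.R.ring_axioms)
  have e: "?e \<in> mod_hom R ?G P" by (intro free_lift_hom assms) auto
  have "x \<in> ?e ` carrier ?G" if "x \<in> carrier P" for x
    using free_lift_unit_vector[OF assms(1), of "\<lambda>x. x" "carrier P" x] that
      unit_vector_closed[OF P.R.ring_axioms that] by (metis Pi_I image_eqI)
  then have "?e ` carrier ?G = carrier P" using e by (auto simp: mod_hom_def)
  then obtain k where k: "k \<in> mod_hom R ?F ?G" "\<forall>x\<in>carrier ?F. ?e (k x) = q x"
    using free_module_lifting[OF LG assms(1) e _ assms(3)] by blast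
  have "i x \<in> carrier ?F" if "x \<in> carrier P" for x using assms(2) that by (auto simp: mod_hom_def)
  then have "\<forall>x\<in>carrier P. ?e (compose (carrier P) k i x) = x"
    using k assms by (simp add: compose_def)
  then show ?thesis unfolding projective_def
    using assms(1) e mod_hom_compose[OF assms(1,2) k(1)] by blast
qed

lemma projective_free_module:
  assumes "ring R" shows "projective R (free_module R B)"
proof (rule projectiveI)
  let ?i = "\<lambda>x\<in>carrier (free_module R B). x"
  show L: "left_module R (free_module R B)" by (rule left_module_free_module) fact
  then interpret left_module R "free_module R B" .
  show "?i \<in> mod_hom R (free_module R B) (free_module R B)"
    by (auto simp: mod_hom_def)
  then show "?i \<in> mod_hom R (free_module R B) (free_module R B)" .
qed auto

lemma ex_free_cover:
  fixes c :: "'m \<Rightarrow> 'b"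
  assumes "left_module R M" "inj_on c (carrier M)"
  shows "\<exists>B e. e \<in> mod_hom R (free_module R (B :: 'b set)) M \<and>
    e ` carrier (free_module R B) = carrier M"
proof (intro exI conjI)
  interpret left_module R M by fact
  let ?B = "c ` carrier M" and ?m = "inv_into (carrier M) c"
  let ?e = "free_lift R ?B M ?m"
  have m: "?m \<in> ?B \<rightarrow> carrier M" by (auto simp: inv_into_into)
  show e: "?e \<in> mod_hom R (free_module R ?B) M" by (intro free_lift_hom assms m)
  have "x \<in> ?e ` carrier (free_module R ?B)" if "x \<in> carrier M" for x
    using free_lift_unit_vector[OF assms(1) m, of "c x"] that assms(2)
      unit_vector_closed[OF R.ring_axioms, of "c x" ?B] by (metis image_eqI inv_into_f_f)
  then show "?e ` carrier (free_module R ?B) = carrier M" using e by (auto simp: mod_hom_def)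
qed

definition res_code :: "('r, 'x) ring_scheme \<Rightarrow> ('r, 'm) res \<Rightarrow> ('r, 'm) res_index"
  where "res_code R f = Comb (SOME xs. set xs = (\<lambda>b. (f b, b)) ` {b. f b \<noteq> \<zero>\<^bsub>R\<^esub>})"

lemma inj_on_res_code:
  fixes R :: "('r, 'x) ring_scheme"
  shows "inj_on (res_code R) {f :: ('r, 'm) res. finite {b. f b \<noteq> \<zero>\<^bsub>R\<^esub>}}"
proof (rule inj_onI)
  fix f g :: "('r, 'm) res" assume fg: "f \<in> {f. finite {b. f b \<noteq> \<zero>\<^bsub>R\<^esub>}}" "g \<in> {f. finite {b. f b \<noteq> \<zero>\<^bsub>R\<^esub>}}"
    "res_code R f = res_code R g"
  have s: "set (SOME xs. set xs = (\<lambda>b. (f b, b)) ` {b. f b \<noteq> \<zero>\<^bsub>R\<^esub>}) = (\<lambda>b. (f b, b)) ` {b. f b \<noteq> \<zero>\<^bsub>R\<^esub>}"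
    if "finite {b. f b \<noteq> \<zero>\<^bsub>R\<^esub>}" for f :: "('r, 'm) res"
    using someI_ex[OF finite_list[OF finite_imageI[OF that]]] .
  have eq: "(\<lambda>b. (f b, b)) ` {b. f b \<noteq> \<zero>\<^bsub>R\<^esub>} = (\<lambda>b. (g b, b)) ` {b. g b \<noteq> \<zero>\<^bsub>R\<^esub>}"
    using arg_cong[of _ _ set, OF fg(3)[unfolded res_code_def res_index.inject]] fg(1,2)
    by (simp only: s mem_Collect_eq)
  have *: "f b \<noteq> \<zero>\<^bsub>R\<^esub> \<and> v = f b \<longleftrightarrow> g b \<noteq> \<zero>\<^bsub>R\<^esub> \<and> v = g b" for b v
  proof -
    have "(v, b) \<in> (\<lambda>b. (f b, b)) ` {b. f b \<noteq> \<zero>\<^bsub>R\<^esub>} \<longleftrightarrow> (v, b) \<in> (\<lambda>b. (g b, b)) ` {b. g b \<noteq> \<zero>\<^bsub>R\<^esub>}"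
      by (simp only: eq)
    then show ?thesis by (simp only: image_iff mem_Collect_eq prod.inject bex_simps) blast
  qed
  show "f = g"
  proof
    fix b show "f b = g b" using *[of b "f b"] *[of b "g b"] by (cases "f b = \<zero>\<^bsub>R\<^esub>") simp_all
  qed
qed

theorem ex_projective_resolution:
  fixes M :: "('r, 'm, 'y) module_scheme"
  assumes "left_module R M"
  shows "\<exists>(P :: nat \<Rightarrow> ('r, ('r, 'm) res) module) d \<epsilon>. projective_resolution R M P d \<epsilon>"
proof -
  interpret left_module R M by fact
  obtain B0 :: "('r, 'm) res_index set" and \<epsilon> where \<epsilon>: "\<epsilon> \<in> mod_hom R (free_module R B0) M"
    "\<epsilon> ` carrier (free_module R B0) = carrier M"
    using ex_free_cover[OF assms, of Gen] by (auto simp: inj_on_def)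
  have LF: "left_module R (free_module R B)" for B :: "('r, 'm) res_index set"
    by (rule left_module_free_module) (rule R.ring_axioms)
  have step: "\<exists>(B' :: ('r, 'm) res_index set) e. e \<in> mod_hom R (free_module R B') (free_module R B) \<and>
      e ` carrier (free_module R B') = H"
    if BH: "left_module R (free_module R B\<lparr>carrier := H\<rparr>)" "H \<subseteq> carrier (free_module R B)" for B :: "('r, 'm) res_index set" and H
  proof -
    have "inj_on (res_code R) H"
      using BH(2) by (intro inj_on_subset[OF inj_on_res_code]) (auto simp: free_module_def)
    then obtain B' :: "('r, 'm) res_index set" and e
      where e: "e \<in> mod_hom R (free_module R B') (free_module R B\<lparr>carrier := H\<rparr>)"
        "e ` carrier (free_module R B') = H"
      using ex_free_cover[OF BH(1), of "res_code R"] by auto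
    have "e x \<in> carrier (free_module R B)" if "x \<in> carrier (free_module R B')" for x
      using e(2) BH(2) that by blast
    then have "e \<in> mod_hom R (free_module R B') (free_module R B)"
      using e(1) by (simp add: mod_hom_def PiE_def Pi_def)
    with e(2) show ?thesis by blast
  qed
  have ker: "left_module R (free_module R B\<lparr>carrier := a_kernel (free_module R B) N f\<rparr>)"
      "a_kernel (free_module R B) N f \<subseteq> carrier (free_module R B)"
    if "left_module R N" "f \<in> mod_hom R (free_module R B) N"
    for B :: "('r, 'm) res_index set" and N :: "('r, 'n, 'q) module_scheme" and f
    using left_module_kernel_module[OF LF that] by (simp_all add: kernel_module_def a_kernel_def kernel_def subset_eq)
  define Q where "Q = (\<lambda>(B :: ('r, 'm) res_index set, H) (B' :: ('r, 'm) res_index set, H'). \<exists>e. e \<in> mod_hom R (free_module R B') (free_module R B) \<and>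
      e ` carrier (free_module R B') = H \<and>
      H' = a_kernel (free_module R B') (free_module R B) e)"
  define J where "J = (\<lambda>(B :: ('r, 'm) res_index set, H). H \<subseteq> carrier (free_module R B) \<and>
      left_module R (free_module R B\<lparr>carrier := H\<rparr>))"
  have x: "\<exists>y. J y \<and> Q x y" if "J x" for x
  proof -
    obtain B H where x: "x = (B, H)" by force
    obtain B' :: "('r, 'm) res_index set" and e
      where e: "e \<in> mod_hom R (free_module R B') (free_module R B)"
        "e ` carrier (free_module R B') = H"
      using step[of H B] \<open>J x\<close> by (auto simp: x J_def)
    have "J (B', a_kernel (free_module R B') (free_module R B) e)"
      using ker[OF LF e(1)] by (simp add: J_def)
    moreover have "Q x (B', a_kernel (free_module R B') (free_module R B) e)"
      using e by (auto simp: Q_def x)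
    ultimately show ?thesis by blast
  qed
  have 0: "J (B0, a_kernel (free_module R B0) M \<epsilon>)"
    using ker[OF assms \<epsilon>(1)] by (simp add: J_def)
  define s where "s = rec_nat (B0, a_kernel (free_module R B0) M \<epsilon>) (\<lambda>_ x. SOME y. J y \<and> Q x y)"
  have step': "J (s (Suc n)) \<and> Q (s n) (s (Suc n))" if "J (s n)" for n
    using someI_ex[OF x[OF that]] by (simp add: s_def)
  have s0: "s 0 = (B0, a_kernel (free_module R B0) M \<epsilon>)" by (simp add: s_def)
  have "J (s n)" for n by (induction n) (use 0 s0 step' in auto)
  then have s: "Q (s n) (s (Suc n))" for n using step' by blast
  define P where "P n = free_module R (fst (s n))" for n
  have "\<forall>n. \<exists>e. e \<in> mod_hom R (P (Suc n)) (P n) \<and> e ` carrier (P (Suc n)) = snd (s n) \<and>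
      snd (s (Suc n)) = a_kernel (P (Suc n)) (P n) e"
    using s by (simp add: Q_def P_def split_beta)
  then obtain d where d: "\<And>n. d n \<in> mod_hom R (P (Suc n)) (P n)"
      "\<And>n. d n ` carrier (P (Suc n)) = snd (s n)"
      "\<And>n. snd (s (Suc n)) = a_kernel (P (Suc n)) (P n) (d n)"
    by metis
  have "projective_resolution R M P d \<epsilon>"
    unfolding projective_resolution_def exact_at_def
  proof (intro conjI allI)
    have P0: "P 0 = free_module R B0" by (simp add: P_def s0)
    show "\<epsilon> \<in> mod_hom R (P 0) M" "\<epsilon> ` carrier (P 0) = carrier M" using \<epsilon> by (simp_all add: P0)
    show "d 0 ` carrier (P 1) = a_kernel (P 0) M \<epsilon>" using d(2)[of 0] by (simp add: s0 P0)
    show "projective R (P i)" for i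
      unfolding P_def by (rule projective_free_module) (rule R.ring_axioms)
    show "d (Suc i) ` carrier (P (Suc (Suc i))) = a_kernel (P (Suc i)) (P i) (d i)" for i
      using d(2)[of "Suc i"] d(3)[of i] by (rule trans)
  qed (rule d(1))
  then show ?thesis by blast
qed

definition transport_module ::
    "('m \<Rightarrow> 'n) \<Rightarrow> ('r, 'm, 'z) module_scheme \<Rightarrow> ('r, 'n) module"
  where "transport_module \<phi> M = (let \<psi> = inv_into (carrier M) \<phi> in
    \<lparr>carrier = \<phi> ` carrier M, mult = undefined, one = undefined, zero = \<phi> \<zero>\<^bsub>M\<^esub>,
     add = (\<lambda>x y. \<phi> (\<psi> x \<oplus>\<^bsub>M\<^esub> \<psi> y)), smult = (\<lambda>r x. \<phi> (r \<odot>\<^bsub>M\<^esub> \<psi> x))\<rparr>)"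

lemma left_module_transport_module:
  assumes "left_module R M" "inj_on \<phi> (carrier M)"
  shows "left_module R (transport_module \<phi> M)"
proof -
  interpret left_module R M by fact
  note [simp] = inv_into_f_f[OF assms(2)]
  have "abelian_group (transport_module \<phi> M)"
    by (rule abelian_groupI)
      (auto simp: transport_module_def Let_def M.a_ac M.r_neg intro!: bexI[of _ "\<ominus>\<^bsub>M\<^esub> _"])
  then show ?thesis
    by (auto intro!: left_module.intro left_module_axioms.intro R.ring_axioms
      simp: transport_module_def Let_def smult_l_distr smult_r_distr smult_assoc1)
qed

theorem hom_faithful_any_type:
  fixes N :: "('r, 'n, 'z) module_scheme"
  assumes "left_module R C" "hom_faithful R C" "left_module R N"
    and "mod_hom R C N = {\<lambda>c\<in>carrier C. \<zero>\<^bsub>N\<^esub>}"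
  shows "zero_module N"
proof (rule ccontr)
  interpret C: left_module R C by fact
  interpret N: left_module R N by fact
  assume "\<not> zero_module N"
  then obtain x where x: "x \<in> carrier N" "x \<noteq> \<zero>\<^bsub>N\<^esub>" by (auto simp: zero_module_def)
  define H where "H = (\<lambda>r. r \<odot>\<^bsub>N\<^esub> x) ` carrier R"
  let ?H = "N\<lparr>carrier := H\<rparr>"
  have zH: "\<zero>\<^bsub>N\<^esub> \<in> H" using N.smult_l_null[OF x(1)] by (force simp: H_def)
  have sub: "H \<subseteq> carrier N" using x by (auto simp: H_def)
  have add_H: "a \<oplus>\<^bsub>N\<^esub> b \<in> H" if "a \<in> H" "b \<in> H" for a b
  proof -
    obtain r s where "r \<in> carrier R" "s \<in> carrier R" "a = r \<odot>\<^bsub>N\<^esub> x" "b = s \<odot>\<^bsub>N\<^esub> x"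
      using \<open>a \<in> H\<close> \<open>b \<in> H\<close> unfolding H_def by blast
    then have "a \<oplus>\<^bsub>N\<^esub> b = (r \<oplus>\<^bsub>R\<^esub> s) \<odot>\<^bsub>N\<^esub> x" "r \<oplus>\<^bsub>R\<^esub> s \<in> carrier R"
      using x by (simp_all add: N.smult_l_distr)
    then show ?thesis unfolding H_def by blast
  qed
  have smult_H: "r \<odot>\<^bsub>N\<^esub> a \<in> H" if "r \<in> carrier R" "a \<in> H" for r a
  proof -
    obtain s where "s \<in> carrier R" "a = s \<odot>\<^bsub>N\<^esub> x"
      using \<open>a \<in> H\<close> unfolding H_def by blast
    then have "r \<odot>\<^bsub>N\<^esub> a = (r \<otimes>\<^bsub>R\<^esub> s) \<odot>\<^bsub>N\<^esub> x" "r \<otimes>\<^bsub>R\<^esub> s \<in> carrier R"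
      using that x by (simp_all add: N.smult_assoc1)
    then show ?thesis unfolding H_def by blast
  qed
  have LH: "left_module R ?H" by (rule left_module_submodule[OF assms(3) sub zH add_H smult_H])
  define \<phi> where "\<phi> y = {r \<in> carrier R. r \<odot>\<^bsub>N\<^esub> x = y}" for y
  have inj: "inj_on \<phi> (carrier ?H)" by (rule inj_onI) (auto simp: \<phi>_def H_def)
  let ?T = "transport_module \<phi> ?H" and ?\<psi> = "inv_into H \<phi>"
  note inv = inv_into_f_f[OF inj, simplified]
  have LT: "left_module R ?T" by (rule left_module_transport_module[OF LH inj])
  interpret T: left_module R ?T by fact
  have T: "carrier ?T = \<phi> ` H" "\<zero>\<^bsub>?T\<^esub> = \<phi> \<zero>\<^bsub>N\<^esub>"
    "\<And>a b. a \<oplus>\<^bsub>?T\<^esub> b = \<phi> (?\<psi> a \<oplus>\<^bsub>N\<^esub> ?\<psi> b)" "\<And>r a. r \<odot>\<^bsub>?T\<^esub> a = \<phi> (r \<odot>\<^bsub>N\<^esub> ?\<psi> a)"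
    by (simp_all add: transport_module_def Let_def)
  have psi: "(\<lambda>t\<in>carrier ?T. ?\<psi> t) \<in> mod_hom R ?T N"
  proof -
    have "?\<psi> t \<in> carrier N" if "t \<in> carrier ?T" for t
      using that sub by (auto simp: T(1) inv)
    moreover have "\<phi> a \<oplus>\<^bsub>?T\<^esub> \<phi> b = \<phi> (a \<oplus>\<^bsub>N\<^esub> b)" if "a \<in> H" "b \<in> H" for a b
      using that by (simp add: T(3) inv)
    moreover have "r \<odot>\<^bsub>?T\<^esub> \<phi> a = \<phi> (r \<odot>\<^bsub>N\<^esub> a)" if "a \<in> H" for r a
      using that by (simp add: T(4) inv)
    ultimately show ?thesis
      by (auto simp: mod_hom_def T(1) inv add_H smult_H)
  qed
  have "f c = \<zero>\<^bsub>?T\<^esub>" if f: "f \<in> mod_hom R C ?T" and c: "c \<in> carrier C" for f c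
  proof -
    have "compose (carrier C) (\<lambda>t\<in>carrier ?T. ?\<psi> t) f = (\<lambda>c\<in>carrier C. \<zero>\<^bsub>N\<^esub>)"
      using mod_hom_compose[OF assms(1) f psi] assms(4) by simp
    from fun_cong[OF this, of c] have "(\<lambda>t\<in>carrier ?T. ?\<psi> t) (f c) = \<zero>\<^bsub>N\<^esub>"
      using c by (simp add: compose_def)
    moreover have fc: "f c \<in> carrier ?T" using f c unfolding mod_hom_def by blast
    ultimately have 0: "?\<psi> (f c) = \<zero>\<^bsub>N\<^esub>" by simp
    obtain a where "a \<in> H" "f c = \<phi> a" using fc unfolding T(1) by blast
    then show ?thesis using 0 by (simp add: T(2) inv)
  qed
  then have "f = (\<lambda>c\<in>carrier C. \<zero>\<^bsub>?T\<^esub>)" if f: "f \<in> mod_hom R C ?T" for f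
  proof -
    have "f \<in> extensional (carrier C)" using f by (simp add: mod_hom_def PiE_def)
    then show ?thesis using \<open>\<And>f c. f \<in> mod_hom R C ?T \<Longrightarrow> c \<in> carrier C \<Longrightarrow> f c = \<zero>\<^bsub>?T\<^esub>\<close>[OF f]
      by (intro extensionalityI[of _ "carrier C"]) simp_all
  qed
  moreover have "(\<lambda>c\<in>carrier C. \<zero>\<^bsub>?T\<^esub>) \<in> mod_hom R C ?T"
    by (auto simp: mod_hom_def T.smult_r_null)
  ultimately have "mod_hom R C ?T = {\<lambda>c\<in>carrier C. \<zero>\<^bsub>?T\<^esub>}" by blast
  then have "zero_module ?T" using assms(2) LT by (auto simp: hom_faithful_def)
  moreover have "x \<in> H"
    unfolding H_def using N.smult_one[OF x(1), symmetric] C.R.one_closed by (rule image_eqI)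
  ultimately have "\<phi> x = \<phi> \<zero>\<^bsub>N\<^esub>" unfolding zero_module_def T(1,2) by blast
  then have "x = \<zero>\<^bsub>N\<^esub>" using inj_onD[OF inj, of x "\<zero>\<^bsub>N\<^esub>"] \<open>x \<in> H\<close> zH by simp
  then show False using x(2) by contradiction
qed

lemma transport_module_isos:
  assumes "left_module R M" "inj_on \<phi> (carrier M)"
  defines "T \<equiv> transport_module \<phi> M"
  shows "(\<lambda>x\<in>carrier M. \<phi> x) \<in> mod_hom R M T"
    and "(\<lambda>y\<in>carrier T. inv_into (carrier M) \<phi> y) \<in> mod_hom R T M"
    and "carrier T = \<phi> ` carrier M"
    and "\<zero>\<^bsub>T\<^esub> = \<phi> \<zero>\<^bsub>M\<^esub>"
proof -
  interpret left_module R M by fact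
  note inv = inv_into_f_f[OF assms(2)]
  show "(\<lambda>x\<in>carrier M. \<phi> x) \<in> mod_hom R M T"
    by (auto simp: mod_hom_def T_def transport_module_def Let_def inv)
  show "(\<lambda>y\<in>carrier T. inv_into (carrier M) \<phi> y) \<in> mod_hom R T M"
    by (auto simp: mod_hom_def T_def transport_module_def Let_def inv)
qed (simp_all add: T_def transport_module_def Let_def)

lemma mod_hom_finsum:
  assumes "left_module R M" "left_module R N" "f \<in> mod_hom R M N" "finite A" "g \<in> A \<rightarrow> carrier M"
  shows "f (\<Oplus>\<^bsub>M\<^esub>a\<in>A. g a) = (\<Oplus>\<^bsub>N\<^esub>a\<in>A. f (g a))"
proof -
  interpret M: left_module R M by fact
  interpret N: left_module R N by fact
  have cl: "f x \<in> carrier N" if "x \<in> carrier M" for x using assms(3) that by (auto simp: mod_hom_def)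
  show ?thesis using assms(4,5)
  proof (induction A)
    case empty then show ?case using mod_hom_zero[OF assms(1-3)] by simp
  next
    case (insert a A)
    then have g: "g a \<in> carrier M" "g \<in> A \<rightarrow> carrier M" by auto
    then have "(\<lambda>a. f (g a)) \<in> A \<rightarrow> carrier N" using cl by auto
    moreover have "f (g a \<oplus>\<^bsub>M\<^esub> finsum M g A) = f (g a) \<oplus>\<^bsub>N\<^esub> f (finsum M g A)"
      using assms(3) g M.finsum_closed[OF g(2)] by (simp add: mod_hom_def)
    ultimately show ?case using insert g cl by simp
  qed
qed

lemma finitely_generated_transport_module:
  assumes "left_module R M" "inj_on \<phi> (carrier M)" "finitely_generated R M"
  shows "finitely_generated R (transport_module \<phi> M)"
proof -
  interpret left_module R M by fact
  let ?T = "transport_module \<phi> M"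
  have LT: "left_module R ?T" by (rule left_module_transport_module[OF assms(1,2)])
  interpret T: left_module R ?T by fact
  note iso = transport_module_isos[OF assms(1,2)]
  obtain A where A: "A \<subseteq> carrier M" "finite A"
    "carrier M = {\<Oplus>\<^bsub>M\<^esub>a\<in>A. k a \<odot>\<^bsub>M\<^esub> a | k. k \<in> A \<rightarrow> carrier R}"
    using assms(3) unfolding finitely_generated_def by blast
  have injA: "inj_on \<phi> A" using A(1) assms(2) by (rule inj_on_subset[rotated])
  have phi: "\<phi> (\<Oplus>\<^bsub>M\<^esub>a\<in>A. k a \<odot>\<^bsub>M\<^esub> a) = (\<Oplus>\<^bsub>?T\<^esub>b\<in>\<phi> ` A. k (inv_into A \<phi> b) \<odot>\<^bsub>?T\<^esub> b)"
    if k: "k \<in> A \<rightarrow> carrier R" for k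
  proof -
    have cl: "k a \<odot>\<^bsub>M\<^esub> a \<in> carrier M" "k a \<in> carrier R" "a \<in> carrier M" if "a \<in> A" for a
      using that k A(1) by auto
    have sm: "\<phi> (k a \<odot>\<^bsub>M\<^esub> a) = k a \<odot>\<^bsub>?T\<^esub> \<phi> a" if "a \<in> A" for a
      using iso(1) cl[OF that] by (simp add: mod_hom_def)
    have pc: "\<phi> a \<in> carrier ?T" if "a \<in> A" for a using cl(3)[OF that] iso(3) by simp
    have sumcl: "(\<Oplus>\<^bsub>M\<^esub>a\<in>A. k a \<odot>\<^bsub>M\<^esub> a) \<in> carrier M" using cl(1) by (intro M.finsum_closed) auto
    have "\<phi> (\<Oplus>\<^bsub>M\<^esub>a\<in>A. k a \<odot>\<^bsub>M\<^esub> a) = (\<Oplus>\<^bsub>?T\<^esub>a\<in>A. (\<lambda>x\<in>carrier M. \<phi> x) (k a \<odot>\<^bsub>M\<^esub> a))"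
      using mod_hom_finsum[OF assms(1) LT iso(1) A(2), of "\<lambda>a. k a \<odot>\<^bsub>M\<^esub> a"] cl(1) sumcl by simp
    also have "\<dots> = (\<Oplus>\<^bsub>?T\<^esub>a\<in>A. k (inv_into A \<phi> (\<phi> a)) \<odot>\<^bsub>?T\<^esub> \<phi> a)"
      by (rule T.M.finsum_cong') (auto simp: cl sm inv_into_f_f[OF injA] pc)
    also have "\<dots> = (\<Oplus>\<^bsub>?T\<^esub>b\<in>\<phi> ` A. k (inv_into A \<phi> b) \<odot>\<^bsub>?T\<^esub> b)"
      using injA by (intro T.M.add.finprod_reindex[symmetric]) (auto simp: inv_into_f_f[OF injA] cl pc)
    finally show ?thesis .
  qed
  have "carrier ?T = {\<Oplus>\<^bsub>?T\<^esub>b\<in>\<phi> ` A. k b \<odot>\<^bsub>?T\<^esub> b | k. k \<in> \<phi> ` A \<rightarrow> carrier R}"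
  proof (intro equalityI subsetI)
    fix y assume "y \<in> carrier ?T"
    then obtain x where x: "x \<in> carrier M" "y = \<phi> x" using iso(3) by blast
    then obtain k where k: "k \<in> A \<rightarrow> carrier R" "x = (\<Oplus>\<^bsub>M\<^esub>a\<in>A. k a \<odot>\<^bsub>M\<^esub> a)" using A(3) by blast
    have "(\<lambda>b. k (inv_into A \<phi> b)) \<in> \<phi> ` A \<rightarrow> carrier R"
      using k(1) by (auto simp: inv_into_f_f[OF injA])
    then show "y \<in> {\<Oplus>\<^bsub>?T\<^esub>b\<in>\<phi> ` A. k b \<odot>\<^bsub>?T\<^esub> b | k. k \<in> \<phi> ` A \<rightarrow> carrier R}"
      unfolding mem_Collect_eq
      by (intro exI[of _ "\<lambda>b. k (inv_into A \<phi> b)"]) (simp only: x(2) k(2) phi[OF k(1)])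
  next
    fix y assume "y \<in> {\<Oplus>\<^bsub>?T\<^esub>b\<in>\<phi> ` A. k b \<odot>\<^bsub>?T\<^esub> b | k. k \<in> \<phi> ` A \<rightarrow> carrier R}"
    then obtain k where k: "k \<in> \<phi> ` A \<rightarrow> carrier R" "y = (\<Oplus>\<^bsub>?T\<^esub>b\<in>\<phi> ` A. k b \<odot>\<^bsub>?T\<^esub> b)" by blast
    have "b \<in> carrier ?T" if "b \<in> \<phi> ` A" for b using that A(1) iso(3) by blast
    then show "y \<in> carrier ?T" unfolding k(2) using k(1)
      by (intro T.M.finsum_closed Pi_I T.smult_closed) (auto dest: funcset_mem)
  qed
  moreover have "\<phi> ` A \<subseteq> carrier ?T" using A(1) iso(3) by blast
  ultimately show ?thesis unfolding finitely_generated_def using A(2) by blast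
qed

lemma projective_transport_module:
  fixes P :: "('r, 'p, 'z) module_scheme"
  assumes "projective R P" "inj_on \<phi> (carrier P)"
  shows "projective R (transport_module \<phi> P)"
proof -
  obtain B :: "'p set" and i q where P: "left_module R P" and i: "i \<in> mod_hom R P (free_module R B)"
    and q: "q \<in> mod_hom R (free_module R B) P" and qi: "\<forall>x\<in>carrier P. q (i x) = x"
    using assms(1) unfolding projective_def by blast
  interpret left_module R P by fact
  let ?T = "transport_module \<phi> P" and ?F = "free_module R B"
  have LT: "left_module R ?T" by (rule left_module_transport_module[OF P assms(2)])
  have LF: "left_module R ?F" by (rule left_module_free_module) (rule R.ring_axioms)
  note iso = transport_module_isos[OF P assms(2)]
  show ?thesis
  proof (rule projectiveI[OF LT mod_hom_compose[OF LT iso(2) i] mod_hom_compose[OF LF q iso(1)]])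
    fix y assume y: "y \<in> carrier ?T"
    then obtain x where x: "x \<in> carrier P" "y = \<phi> x" using iso(3) by blast
    have "i x \<in> carrier ?F" using i x(1) unfolding mod_hom_def by blast
    with x y qi show "compose (carrier ?F) (restrict \<phi> (carrier P)) q
        (compose (carrier ?T) i (restrict (inv_into (carrier P) \<phi>) (carrier ?T)) y) = y"
      by (simp add: compose_def inv_into_f_f[OF assms(2)])
  qed
qed

lemma ex_inj_res:
  fixes P :: "('r, 'p, 'z) module_scheme" and R :: "('r, 'x) ring_scheme"
  assumes "projective R P" "finitely_generated R P"
  shows "\<exists>\<phi> :: 'p \<Rightarrow> ('r, 'm) res. inj_on \<phi> (carrier P)"
proof -
  have P: "left_module R P" using assms(1) by (simp add: projective_def)
  interpret left_module R P by fact
  obtain A where A: "A \<subseteq> carrier P" "finite A"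
    "carrier P = {\<Oplus>\<^bsub>P\<^esub>a\<in>A. k a \<odot>\<^bsub>P\<^esub> a | k. k \<in> A \<rightarrow> carrier R}"
    using assms(2) unfolding finitely_generated_def by blast
  obtain c :: "'p \<Rightarrow> nat" where c: "inj_on c A" using finite_imp_inj_to_nat_seg[OF A(2)] by blast
  define h :: "'p \<Rightarrow> ('r, 'm) res_index"
    where "h a = Comb (replicate (c a) (\<zero>\<^bsub>R\<^esub>, Comb []))" for a
  have "length (case h a of Comb xs \<Rightarrow> xs) = c a" for a by (simp add: h_def)
  then have inj: "inj_on h A" using c by (metis inj_on_def)
  let ?F = "free_module R (h ` A)" and ?m = "inv_into A h"
  have LF: "left_module R ?F" by (rule left_module_free_module) (rule R.ring_axioms)
  have m: "?m \<in> h ` A \<rightarrow> carrier P" using A(1) by (auto simp: inv_into_f_f[OF inj])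
  have e: "free_lift R (h ` A) P ?m \<in> mod_hom R ?F P" by (rule free_lift_hom[OF P m])
  have "x \<in> free_lift R (h ` A) P ?m ` carrier ?F" if x: "x \<in> carrier P" for x
  proof -
    obtain k where k: "k \<in> A \<rightarrow> carrier R" "x = (\<Oplus>\<^bsub>P\<^esub>a\<in>A. k a \<odot>\<^bsub>P\<^esub> a)" using A(3) x by blast
    define f where "f b = (if b \<in> h ` A then k (?m b) else \<zero>\<^bsub>R\<^esub>)" for b
    have s: "{b. f b \<noteq> \<zero>\<^bsub>R\<^esub>} \<subseteq> h ` A" by (auto simp: f_def)
    have "f b \<in> carrier R" for b using k(1) by (auto simp: f_def inv_into_f_f[OF inj])
    with s have f: "f \<in> carrier ?F"
      using A(2) by (auto simp: free_module_def intro: finite_subset)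
    have cl: "k a \<odot>\<^bsub>P\<^esub> a \<in> carrier P" if "a \<in> A" for a using that k A(1) by auto
    have fh: "f (h a) = k a" if "a \<in> A" for a using that by (simp add: f_def inv_into_f_f[OF inj])
    have "free_lift R (h ` A) P ?m f = (\<Oplus>\<^bsub>P\<^esub>b\<in>h ` A. f b \<odot>\<^bsub>P\<^esub> ?m b)"
      using A(2) s by (intro free_lift_superset[OF P m f]) auto
    also have "\<dots> = (\<Oplus>\<^bsub>P\<^esub>a\<in>A. f (h a) \<odot>\<^bsub>P\<^esub> ?m (h a))"
      using inj by (intro M.add.finprod_reindex) (auto simp: inv_into_f_f[OF inj] fh cl)
    also have "\<dots> = x" unfolding k(2)
      by (rule M.finsum_cong') (auto simp: inv_into_f_f[OF inj] fh cl)
    finally show ?thesis using f by blast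
  qed
  then have e': "free_lift R (h ` A) P ?m ` carrier ?F = carrier P"
    using e by (auto simp: mod_hom_def)
  have id: "(\<lambda>x\<in>carrier P. x) \<in> mod_hom R P P" by (auto simp: mod_hom_def)
  obtain k where "\<forall>x\<in>carrier P. free_lift R (h ` A) P ?m (k x) = (\<lambda>x\<in>carrier P. x) x"
    using projective_lifting[OF assms(1) LF P e e' id] by blast
  then have "inj_on k (carrier P)" by (intro inj_on_inverseI[where g = "free_lift R (h ` A) P ?m"]) simp
  then show ?thesis by blast
qed

theorem has_fg_projective_resolutionI:
  fixes P :: "nat \<Rightarrow> ('r, 'p) module" and M :: "('r, 'm, 'y) module_scheme"
  assumes "left_module R M" "projective_resolution R M P d \<epsilon>" "\<And>i. finitely_generated R (P i)"
  shows "has_fg_projective_resolution R M"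
proof -
  have proj: "projective R (P i)" and d: "d i \<in> mod_hom R (P (Suc i)) (P i)" for i
    using assms(2) by (simp_all add: projective_resolution_def)
  have \<epsilon>: "\<epsilon> \<in> mod_hom R (P 0) M" "\<epsilon> ` carrier (P 0) = carrier M"
    using assms(2) by (simp_all add: projective_resolution_def)
  have ex0: "d 0 ` carrier (P (Suc 0)) = a_kernel (P 0) M \<epsilon>"
    and ex: "d (Suc i) ` carrier (P (Suc (Suc i))) = a_kernel (P (Suc i)) (P i) (d i)" for i
    using assms(2) by (simp_all add: projective_resolution_def exact_at_def)
  have L: "left_module R (P i)" for i using proj[of i] by (simp add: projective_def)
  obtain \<phi> :: "nat \<Rightarrow> 'p \<Rightarrow> ('r, 'm) res" where inj: "\<And>i. inj_on (\<phi> i) (carrier (P i))"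
    using ex_inj_res[OF proj assms(3)] by metis
  define T where "T i = transport_module (\<phi> i) (P i)" for i
  define \<psi> where "\<psi> i = (\<lambda>y\<in>carrier (T i). inv_into (carrier (P i)) (\<phi> i) y)" for i
  define \<Phi> where "\<Phi> i = (\<lambda>x\<in>carrier (P i). \<phi> i x)" for i
  have LT: "left_module R (T i)" for i
    unfolding T_def by (rule left_module_transport_module[OF L inj])
  have \<Phi>: "\<Phi> i \<in> mod_hom R (P i) (T i)" and \<psi>: "\<psi> i \<in> mod_hom R (T i) (P i)"
    and T: "carrier (T i) = \<phi> i ` carrier (P i)" and T0: "\<zero>\<^bsub>T i\<^esub> = \<phi> i \<zero>\<^bsub>P i\<^esub>" for i
    unfolding \<Phi>_def \<psi>_def T_def by (rule transport_module_isos[OF L inj])+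
  have \<psi>\<phi>: "\<psi> i (\<phi> i x) = x" if "x \<in> carrier (P i)" for i x
    using that by (simp add: \<psi>_def T inv_into_f_f[OF inj])
  have dc: "d i x \<in> carrier (P i)" if "x \<in> carrier (P (Suc i))" for i x
    using d[of i] that unfolding mod_hom_def by blast
  define D where "D i = compose (carrier (T (Suc i))) (\<Phi> i) (compose (carrier (T (Suc i))) (d i) (\<psi> (Suc i)))" for i
  define E where "E = compose (carrier (T 0)) \<epsilon> (\<psi> 0)"
  have D: "D i \<in> mod_hom R (T (Suc i)) (T i)" for i
    unfolding D_def by (rule mod_hom_compose[OF LT mod_hom_compose[OF LT \<psi> d] \<Phi>])
  have E: "E \<in> mod_hom R (T 0) M" unfolding E_def by (rule mod_hom_compose[OF LT \<psi> \<epsilon>(1)])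
  have D\<phi>: "D i (\<phi> (Suc i) x) = \<phi> i (d i x)" if "x \<in> carrier (P (Suc i))" for i x
    using that dc[OF that] by (simp add: D_def compose_def T \<psi>\<phi> \<Phi>_def)
  have E\<phi>: "E (\<phi> 0 x) = \<epsilon> x" if "x \<in> carrier (P 0)" for x
    using that by (simp add: E_def compose_def T \<psi>\<phi>)
  have imD: "D i ` carrier (T (Suc i)) = \<phi> i ` d i ` carrier (P (Suc i))" for i
    unfolding T image_image using D\<phi> by (intro image_cong) auto
  have zero: "\<zero>\<^bsub>P i\<^esub> \<in> carrier (P i)" for i
    using L[of i] by (simp add: left_module_def abelian_group.axioms(1) abelian_monoid.zero_closed)
  have kerD: "a_kernel (T (Suc i)) (T i) (D i) = \<phi> (Suc i) ` a_kernel (P (Suc i)) (P i) (d i)" for i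
  proof -
    have "D i (\<phi> (Suc i) x) = \<zero>\<^bsub>T i\<^esub> \<longleftrightarrow> d i x = \<zero>\<^bsub>P i\<^esub>" if "x \<in> carrier (P (Suc i))" for x
      using inj_on_eq_iff[OF inj dc[OF that] zero] D\<phi>[OF that] by (simp add: T0)
    then show ?thesis unfolding a_kernel_def kernel_def by (auto simp: T)
  qed
  have kerE: "a_kernel (T 0) M E = \<phi> 0 ` a_kernel (P 0) M \<epsilon>"
    unfolding a_kernel_def kernel_def using E\<phi> by (auto simp: T)
  have "projective_resolution R M T D E" unfolding projective_resolution_def exact_at_def
  proof (intro conjI allI)
    show "projective R (T i)" for i unfolding T_def by (rule projective_transport_module[OF proj inj])
    show "D i \<in> mod_hom R (T (Suc i)) (T i)" for i by (rule D)
    show "E \<in> mod_hom R (T 0) M" by (rule E)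
    have "E ` carrier (T 0) = \<epsilon> ` carrier (P 0)"
      unfolding T image_image using E\<phi> by (intro image_cong) auto
    then show "E ` carrier (T 0) = carrier M" using \<epsilon>(2) by simp
    show "D 0 ` carrier (T 1) = a_kernel (T 0) M E" using imD[of 0] by (simp add: kerE ex0)
    show "D (Suc i) ` carrier (T (Suc (Suc i))) = a_kernel (T (Suc i)) (T i) (D i)" for i
      by (simp add: imD kerD ex)
  qed
  moreover have "finitely_generated R (T i)" for i
    unfolding T_def by (rule finitely_generated_transport_module[OF L inj assms(3)])
  ultimately show ?thesis unfolding has_fg_projective_resolution_def by blast
qed

end

theory Submission
  imports Defs
begin

text \<open>
  One step of either construction produces a kernel \<open>M\<close> in an exact sequence \<open>X\<close> with terms in the
  class. Dimension shifting along the short exact sequences of successive kernels carries the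
  vanishing of \<open>Tor\<^sub>i(C, X\<^sub>n)\<close> and of \<open>Ext\<^sup>i(C, C \<otimes> X\<^sub>n)\<close> over to all kernels; exactness of \<open>C \<otimes> X\<close>
  starts the first induction. The units identify \<open>X\<close> with \<open>Hom(C, C \<otimes> X)\<close>, so the latter is exact
  and starts the second induction; since \<open>C \<otimes> M\<close> is a kernel in \<open>C \<otimes> X\<close> and \<open>Hom\<close> is left exact,
  the unit of \<open>M\<close> is an isomorphism too. The argument for the Bass class is dual.
\<close>

section \<open>Additive and linear maps\<close>

text \<open>The sequences are unbounded on both sides, so there is no end at which a dimension shift
  could start; the inductions run over the degree, for the kernels at all positions at once. Ext of
  the kernel at \<open>n\<close> is reduced to one degree less at \<open>n + 1\<close>, Tor to one
  degree less at \<open>n - 1\<close>. Long exact sequences are replaced by chases along a fixed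
  projective resolution of \<open>C\<close>, which use elementwise forms of the vanishing
  conditions, lifting against projectives and flatness of projectives. Kernels are handled up to
  isomorphism, through embeddings, since \<open>M\<close>, C \<otimes> M and Hom(C, N) all have to
  count as kernels; auxiliary kernels are submodules of the terms, so the inductions stay within one
  carrier type. A module presented as a cokernel enters this setting as the image of the next
  differential.\<close>

text \<open>Unlike \<^const>\<open>mod_hom\<close>, these sets are not restricted to extensional functions.\<close>

definition add_homs :: "('a, 'x) ring_scheme \<Rightarrow> ('b, 'y) ring_scheme \<Rightarrow> ('a \<Rightarrow> 'b) set"
  where "add_homs A B = {f. (\<forall>x\<in>carrier A. f x \<in> carrier B) \<and>
    (\<forall>x\<in>carrier A. \<forall>y\<in>carrier A. f (x \<oplus>\<^bsub>A\<^esub> y) = f x \<oplus>\<^bsub>B\<^esub> f y)}"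

definition linear_maps ::
    "('r, 'x) ring_scheme \<Rightarrow> ('r, 'm, 'y) module_scheme \<Rightarrow> ('r, 'n, 'z) module_scheme \<Rightarrow> ('m \<Rightarrow> 'n) set"
  where "linear_maps R M N = {f \<in> add_homs M N.
    \<forall>r\<in>carrier R. \<forall>x\<in>carrier M. f (r \<odot>\<^bsub>M\<^esub> x) = r \<odot>\<^bsub>N\<^esub> f x}"

lemma (in abelian_group) minus_eq_zero_iff [simp]:
  assumes "x \<in> carrier G" "y \<in> carrier G"
  shows "x \<ominus> y = \<zero> \<longleftrightarrow> x = y"
proof
  assume "x \<ominus> y = \<zero>"
  then have "x = \<ominus> (\<ominus> y)" using assms by (intro minus_equality[symmetric]) (simp_all add: a_minus_def)
  with assms show "x = y" by simp
qed (simp add: a_minus_def r_neg assms)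

lemma add_homs_closed: "\<lbrakk>f \<in> add_homs A B; x \<in> carrier A\<rbrakk> \<Longrightarrow> f x \<in> carrier B"
  by (simp add: add_homs_def)

lemma add_homs_add:
  "\<lbrakk>f \<in> add_homs A B; x \<in> carrier A; y \<in> carrier A\<rbrakk> \<Longrightarrow> f (x \<oplus>\<^bsub>A\<^esub> y) = f x \<oplus>\<^bsub>B\<^esub> f y"
  by (simp add: add_homs_def)

lemma add_homs_group_hom:
  assumes "abelian_group A" "abelian_group B" "f \<in> add_homs A B"
  shows "group_hom (add_monoid A) (add_monoid B) f"
  using assms by (auto simp: group_hom_def group_hom_axioms_def hom_def add_homs_def abelian_group.a_group)

lemma add_homs_zero:
  assumes "abelian_group A" "abelian_group B" "f \<in> add_homs A B"
  shows "f \<zero>\<^bsub>A\<^esub> = \<zero>\<^bsub>B\<^esub>"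
  using group_hom.hom_one[OF add_homs_group_hom[OF assms]] by simp

lemma add_homs_uminus:
  assumes "abelian_group A" "abelian_group B" "f \<in> add_homs A B" "x \<in> carrier A"
  shows "f (\<ominus>\<^bsub>A\<^esub> x) = \<ominus>\<^bsub>B\<^esub> f x"
  using group_hom.hom_inv[OF add_homs_group_hom[OF assms(1-3)]] assms(4) by (simp add: a_inv_def)

lemma add_homs_minus:
  assumes "abelian_group A" "abelian_group B" "f \<in> add_homs A B" "x \<in> carrier A" "y \<in> carrier A"
  shows "f (x \<ominus>\<^bsub>A\<^esub> y) = f x \<ominus>\<^bsub>B\<^esub> f y"
  using assms by (simp add: a_minus_def add_homs_add add_homs_uminus abelian_group.a_inv_closed)

lemma a_kernel_iff: "x \<in> a_kernel A B f \<longleftrightarrow> x \<in> carrier A \<and> f x = \<zero>\<^bsub>B\<^esub>"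
  by (simp add: a_kernel_def kernel_def)

lemma add_homs_eq_iff:
  assumes "abelian_group A" "abelian_group B" "f \<in> add_homs A B" "x \<in> carrier A" "y \<in> carrier A"
  shows "f x = f y \<longleftrightarrow> f (x \<ominus>\<^bsub>A\<^esub> y) = \<zero>\<^bsub>B\<^esub>"
proof -
  interpret A: abelian_group A by fact
  interpret B: abelian_group B by fact
  show ?thesis using assms
    by (simp add: add_homs_minus add_homs_closed)
qed

lemma add_homs_inj_on:
  assumes "abelian_group A" "abelian_group B" "f \<in> add_homs A B"
    and "\<And>x. \<lbrakk>x \<in> carrier A; f x = \<zero>\<^bsub>B\<^esub>\<rbrakk> \<Longrightarrow> x = \<zero>\<^bsub>A\<^esub>"
  shows "inj_on f (carrier A)"
proof (rule inj_onI)
  interpret A: abelian_group A by fact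
  fix x y assume "x \<in> carrier A" "y \<in> carrier A" "f x = f y"
  with assms have "x \<ominus>\<^bsub>A\<^esub> y = \<zero>\<^bsub>A\<^esub>" by (simp add: add_homs_eq_iff)
  with \<open>x \<in> carrier A\<close> \<open>y \<in> carrier A\<close> show "x = y" by simp
qed

lemma linear_mapsD:
  assumes "f \<in> linear_maps R M N"
  shows "f \<in> add_homs M N" "\<And>r x. \<lbrakk>r \<in> carrier R; x \<in> carrier M\<rbrakk> \<Longrightarrow> f (r \<odot>\<^bsub>M\<^esub> x) = r \<odot>\<^bsub>N\<^esub> f x"
  using assms by (simp_all add: linear_maps_def)

lemma linear_maps_closed: "\<lbrakk>f \<in> linear_maps R M N; x \<in> carrier M\<rbrakk> \<Longrightarrow> f x \<in> carrier N"
  by (simp add: linear_maps_def add_homs_def)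

lemma linear_maps_id [simp]: "(\<lambda>x. x) \<in> linear_maps R M M"
  by (simp add: linear_maps_def add_homs_def)

lemma mod_hom_eq: "mod_hom R M N = linear_maps R M N \<inter> extensional (carrier M)"
  by (auto simp: mod_hom_def linear_maps_def add_homs_def PiE_def)

lemma mod_hom_linear: "f \<in> mod_hom R M N \<Longrightarrow> f \<in> linear_maps R M N"
  by (simp add: mod_hom_eq)

lemma linear_maps_comp:
  "\<lbrakk>f \<in> linear_maps R M N; g \<in> linear_maps R N L\<rbrakk> \<Longrightarrow> (\<lambda>x. g (f x)) \<in> linear_maps R M L"
  by (simp add: linear_maps_def add_homs_def)

lemma restrict_mod_hom:
  assumes "left_module R M" "f \<in> linear_maps R M N"
  shows "restrict f (carrier M) \<in> mod_hom R M N"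
proof -
  interpret left_module R M by fact
  show ?thesis using assms(2) by (auto simp: mod_hom_def linear_maps_def add_homs_def)
qed

lemma carrier_opp_ring [simp]: "carrier (opp_ring R) = carrier R"
  by (simp add: opp_ring_def)

lemma linear_maps_opp_ring [simp]: "linear_maps (opp_ring R) M N = linear_maps R M N"
  by (simp add: linear_maps_def)

lemma left_module_abelian_group: "left_module R M \<Longrightarrow> abelian_group M"
  by (simp add: left_module_def)

section \<open>Tensor products\<close>

text \<open>\<open>D\<close> is meant as a right module, written as a left module over
  \<open>opp_ring R\<close>, so the last clause reads \<beta>(d r, m) = \<beta>(d, r m).\<close>

definition balanced ::
    "('r, 'x) ring_scheme \<Rightarrow> ('r, 'd, 'y) module_scheme \<Rightarrow> ('r, 'm, 'z) module_scheme \<Rightarrow>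
      ('a, 'w) ring_scheme \<Rightarrow> ('d \<Rightarrow> 'm \<Rightarrow> 'a) \<Rightarrow> bool"
  where "balanced R D M A \<beta> \<longleftrightarrow>
    (\<forall>d\<in>carrier D. \<forall>m\<in>carrier M. \<beta> d m \<in> carrier A) \<and>
    (\<forall>d\<in>carrier D. \<forall>d'\<in>carrier D. \<forall>m\<in>carrier M. \<beta> (d \<oplus>\<^bsub>D\<^esub> d') m = \<beta> d m \<oplus>\<^bsub>A\<^esub> \<beta> d' m) \<and>
    (\<forall>d\<in>carrier D. \<forall>m\<in>carrier M. \<forall>m'\<in>carrier M. \<beta> d (m \<oplus>\<^bsub>M\<^esub> m') = \<beta> d m \<oplus>\<^bsub>A\<^esub> \<beta> d m') \<and>
    (\<forall>r\<in>carrier R. \<forall>d\<in>carrier D. \<forall>m\<in>carrier M. \<beta> (r \<odot>\<^bsub>D\<^esub> d) m = \<beta> d (r \<odot>\<^bsub>M\<^esub> m))"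

text \<open>The sum inside \<open>tensor_lift\<close>, isolated so that its additivity can be proved
  on the free abelian group before passing to cosets.\<close>

definition frag_eval :: "('a, 'w) ring_scheme \<Rightarrow> ('p \<Rightarrow> 'a) \<Rightarrow> ('p \<Rightarrow>\<^sub>0 int) \<Rightarrow> 'a"
  where "frag_eval A b x = (\<Oplus>\<^bsub>A\<^esub>p\<in>Poly_Mapping.keys x. [Poly_Mapping.lookup x p] \<cdot>\<^bsub>A\<^esub> b p)"

text \<open>Terms outside the support have coefficient 0, so two formal sums can be evaluated over
  the union of their supports; additivity rests on this.\<close>

lemma frag_eval_superset:
  assumes "abelian_group A" "b \<in> S \<rightarrow> carrier A" "Poly_Mapping.keys x \<subseteq> K" "finite K" "K \<subseteq> S"
  shows "frag_eval A b x = (\<Oplus>\<^bsub>A\<^esub>p\<in>K. [Poly_Mapping.lookup x p] \<cdot>\<^bsub>A\<^esub> b p)"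
proof -
  interpret abelian_group A by fact
  have "b p \<in> carrier A" if "p \<in> K" for p using that assms by auto
  then show ?thesis unfolding frag_eval_def using assms(3,4)
    by (intro add.finprod_mono_neutral_cong_left) (auto simp: in_keys_iff add_pow_int_ge)
qed

lemma frag_eval_hom:
  assumes "abelian_group A" "b \<in> S \<rightarrow> carrier A"
  shows "frag_eval A b \<in> hom (free_Abelian_group S) (add_monoid A)"
proof (rule homI)
  interpret abelian_group A by fact
  fix x assume "x \<in> carrier (free_Abelian_group S)"
  then have "\<And>p. p \<in> Poly_Mapping.keys x \<Longrightarrow> b p \<in> carrier A" using assms by auto
  then show "frag_eval A b x \<in> carrier (add_monoid A)"
    by (auto simp: frag_eval_def intro!: finsum_closed)
next
  interpret abelian_group A by fact
  fix x y assume "x \<in> carrier (free_Abelian_group S)" "y \<in> carrier (free_Abelian_group S)"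
  then have xy: "Poly_Mapping.keys x \<subseteq> S" "Poly_Mapping.keys y \<subseteq> S" by simp_all
  let ?K = "Poly_Mapping.keys x \<union> Poly_Mapping.keys y"
  have b: "b p \<in> carrier A" if "p \<in> ?K" for p using that assms xy by auto
  have "frag_eval A b (x + y) = (\<Oplus>\<^bsub>A\<^esub>p\<in>?K. [Poly_Mapping.lookup (x + y) p] \<cdot>\<^bsub>A\<^esub> b p)"
    using keys_add[of x y] xy by (intro frag_eval_superset[OF assms]) auto
  also have "\<dots> = (\<Oplus>\<^bsub>A\<^esub>p\<in>?K. [Poly_Mapping.lookup x p] \<cdot>\<^bsub>A\<^esub> b p \<oplus>\<^bsub>A\<^esub> [Poly_Mapping.lookup y p] \<cdot>\<^bsub>A\<^esub> b p)"
    using b by (intro finsum_cong') (auto simp: lookup_add add.int_pow_mult)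
  also have "\<dots> = (\<Oplus>\<^bsub>A\<^esub>p\<in>?K. [Poly_Mapping.lookup x p] \<cdot>\<^bsub>A\<^esub> b p) \<oplus>\<^bsub>A\<^esub>
      (\<Oplus>\<^bsub>A\<^esub>p\<in>?K. [Poly_Mapping.lookup y p] \<cdot>\<^bsub>A\<^esub> b p)"
    using b by (intro finsum_addf) auto
  also have "\<dots> = frag_eval A b x \<oplus>\<^bsub>A\<^esub> frag_eval A b y"
    using xy by (simp add: frag_eval_superset[OF assms, of _ ?K])
  finally show "frag_eval A b (x \<otimes>\<^bsub>free_Abelian_group S\<^esub> y) = frag_eval A b x \<otimes>\<^bsub>add_monoid A\<^esub> frag_eval A b y"
    by simp
qed

lemma frag_eval_frag_of:
  assumes "abelian_group A" "b p \<in> carrier A"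
  shows "frag_eval A b (frag_of p) = b p"
proof -
  interpret abelian_group A by fact
  show ?thesis using assms(2) by (simp add: frag_eval_def keys_frag_of add.int_pow_1)
qed

section \<open>Construction and universal property of the tensor product\<close>

locale tensor_pair = D: left_module "opp_ring R" D + M: left_module R M
  for R :: "('r, 'x) ring_scheme" and D :: "('r, 'd, 'y) module_scheme"
    and M :: "('r, 'm, 'z) module_scheme"
begin

abbreviation "F \<equiv> tensor_free D M"
abbreviation "H \<equiv> tensor_relations R D M"
abbreviation "T \<equiv> tensor R D M"
abbreviation tens (infixl "\<oslash>" 70) where "d \<oslash> m \<equiv> pure_tensor R D M d m"

lemma F_group: "comm_group F" unfolding tensor_free_def by (rule abelian_free_Abelian_group)

interpretation F: comm_group F by (rule F_group)

lemma F_simps [simp]: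
  "x \<in> carrier F \<longleftrightarrow> Poly_Mapping.keys x \<subseteq> carrier D \<times> carrier M"
  "x \<otimes>\<^bsub>F\<^esub> y = x + y" "\<one>\<^bsub>F\<^esub> = 0"
  by (simp_all add: tensor_free_def)

lemma F_diff: "x \<in> carrier F \<Longrightarrow> y \<in> carrier F \<Longrightarrow> x - y \<in> carrier F"
  using keys_diff[of x y] by auto

lemma relations_subgroup: "subgroup H F"
  unfolding tensor_relations_def
  by (rule F.generate_is_subgroup, safe; intro F_diff)
    (auto simp: keys_frag_of intro: D.smult_closed[simplified])

lemma relations_mem:
  "\<lbrakk>d \<in> carrier D; d' \<in> carrier D; m \<in> carrier M\<rbrakk> \<Longrightarrow>
    frag_of (d \<oplus>\<^bsub>D\<^esub> d', m) - frag_of (d, m) - frag_of (d', m) \<in> H"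
  "\<lbrakk>d \<in> carrier D; m \<in> carrier M; m' \<in> carrier M\<rbrakk> \<Longrightarrow>
    frag_of (d, m \<oplus>\<^bsub>M\<^esub> m') - frag_of (d, m) - frag_of (d, m') \<in> H"
  "\<lbrakk>r \<in> carrier R; d \<in> carrier D; m \<in> carrier M\<rbrakk> \<Longrightarrow>
    frag_of (r \<odot>\<^bsub>D\<^esub> d, m) - frag_of (d, r \<odot>\<^bsub>M\<^esub> m) \<in> H"
  unfolding tensor_relations_def by (rule generate.incl; blast)+

interpretation N: normal H F
  by (rule F.subgroup_imp_normal[OF relations_subgroup])

lemma tensor_add_monoid: "add_monoid T = F Mod H"
  by (simp add: tensor_def Let_def FactGroup_def)

lemma tensor_abelian_group: "abelian_group T"
proof -
  have "comm_group (add_monoid T)"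
    unfolding tensor_add_monoid by (rule F.abelian_FactGroup[OF relations_subgroup])
  then show ?thesis
    by (intro abelian_group.intro abelian_monoid.intro abelian_group_axioms.intro)
      (simp_all add: comm_group_def)
qed

sublocale T: abelian_group T by (rule tensor_abelian_group)

definition cls where "cls x = H #>\<^bsub>F\<^esub> x"

lemma carrier_tensor: "carrier T = cls ` carrier F"
  by (auto simp: tensor_def Let_def FactGroup_def RCOSETS_def cls_def)

lemma cls_closed: "x \<in> carrier F \<Longrightarrow> cls x \<in> carrier T"
  unfolding carrier_tensor by blast

lemma cls_add: "\<lbrakk>x \<in> carrier F; y \<in> carrier F\<rbrakk> \<Longrightarrow> cls (x + y) = cls x \<oplus>\<^bsub>T\<^esub> cls y"
  using N.rcos_sum[of x y] by (simp add: tensor_def Let_def FactGroup_def cls_def del: F_simps(1))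

lemma cls_eqI:
  assumes "x \<in> carrier F" "y \<in> carrier F" "x - y \<in> H" shows "cls x = cls y"
proof -
  have "x \<in> cls y" using assms(3) by (force simp: cls_def r_coset_def)
  then show ?thesis
    using F.repr_independence[OF _ assms(2) relations_subgroup] by (simp add: cls_def)
qed

lemma frag_of_F: "\<lbrakk>d \<in> carrier D; m \<in> carrier M\<rbrakk> \<Longrightarrow> frag_of (d, m) \<in> carrier F"
  by (simp add: tensor_free_def)

lemma pure_cls: "d \<oslash> m = cls (frag_of (d, m))"
  by (simp add: pure_tensor_def cls_def)

lemma pure_closed: "\<lbrakk>d \<in> carrier D; m \<in> carrier M\<rbrakk> \<Longrightarrow> d \<oslash> m \<in> carrier T"
  unfolding pure_cls by (intro cls_closed frag_of_F)

lemma F_add: "x \<in> carrier F \<Longrightarrow> y \<in> carrier F \<Longrightarrow> x + y \<in> carrier F"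
  using F.m_closed[of x y] by (simp del: F_simps(1))

lemma pure_balanced: "balanced R D M T (pure_tensor R D M)"
proof -
  have 1: "(d \<oplus>\<^bsub>D\<^esub> d') \<oslash> m = d \<oslash> m \<oplus>\<^bsub>T\<^esub> d' \<oslash> m"
    if "d \<in> carrier D" "d' \<in> carrier D" "m \<in> carrier M" for d d' m
  proof -
    have "cls (frag_of (d \<oplus>\<^bsub>D\<^esub> d', m)) = cls (frag_of (d, m) + frag_of (d', m))"
      using that relations_mem(1)[OF that, unfolded diff_diff_eq] by (intro cls_eqI F_add frag_of_F) simp_all
    also have "\<dots> = cls (frag_of (d, m)) \<oplus>\<^bsub>T\<^esub> cls (frag_of (d', m))"
      using that by (intro cls_add frag_of_F)
    finally show ?thesis by (simp only: pure_cls)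
  qed
  have 2: "d \<oslash> (m \<oplus>\<^bsub>M\<^esub> m') = d \<oslash> m \<oplus>\<^bsub>T\<^esub> d \<oslash> m'"
    if "d \<in> carrier D" "m \<in> carrier M" "m' \<in> carrier M" for d m m'
  proof -
    have "cls (frag_of (d, m \<oplus>\<^bsub>M\<^esub> m')) = cls (frag_of (d, m) + frag_of (d, m'))"
      using that relations_mem(2)[OF that, unfolded diff_diff_eq] by (intro cls_eqI F_add frag_of_F) simp_all
    also have "\<dots> = cls (frag_of (d, m)) \<oplus>\<^bsub>T\<^esub> cls (frag_of (d, m'))"
      using that by (intro cls_add frag_of_F)
    finally show ?thesis by (simp only: pure_cls)
  qed
  have 3: "(r \<odot>\<^bsub>D\<^esub> d) \<oslash> m = d \<oslash> (r \<odot>\<^bsub>M\<^esub> m)"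
    if "r \<in> carrier R" "d \<in> carrier D" "m \<in> carrier M" for r d m
    using that relations_mem(3)[OF that] D.smult_closed[of r d] unfolding pure_cls
    by (intro cls_eqI frag_of_F) (auto simp del: F_simps(1))
  show ?thesis unfolding balanced_def by (simp add: 1 2 3 pure_closed)
qed

lemma pure_add_left: "\<lbrakk>d \<in> carrier D; d' \<in> carrier D; m \<in> carrier M\<rbrakk> \<Longrightarrow> (d \<oplus>\<^bsub>D\<^esub> d') \<oslash> m = d \<oslash> m \<oplus>\<^bsub>T\<^esub> d' \<oslash> m"
  using pure_balanced by (auto simp: balanced_def)

lemma pure_add_right: "\<lbrakk>d \<in> carrier D; m \<in> carrier M; m' \<in> carrier M\<rbrakk> \<Longrightarrow> d \<oslash> (m \<oplus>\<^bsub>M\<^esub> m') = d \<oslash> m \<oplus>\<^bsub>T\<^esub> d \<oslash> m'"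
  using pure_balanced by (auto simp: balanced_def)

lemma pure_smult: "\<lbrakk>r \<in> carrier R; d \<in> carrier D; m \<in> carrier M\<rbrakk> \<Longrightarrow> (r \<odot>\<^bsub>D\<^esub> d) \<oslash> m = d \<oslash> (r \<odot>\<^bsub>M\<^esub> m)"
  using pure_balanced by (auto simp: balanced_def)

lemma pure_zero_left: "m \<in> carrier M \<Longrightarrow> \<zero>\<^bsub>D\<^esub> \<oslash> m = \<zero>\<^bsub>T\<^esub>"
  using add_homs_zero[OF D.M.abelian_group_axioms tensor_abelian_group, of "\<lambda>d. d \<oslash> m"]
  by (simp add: add_homs_def pure_closed pure_add_left)

lemma pure_zero_right: "d \<in> carrier D \<Longrightarrow> d \<oslash> \<zero>\<^bsub>M\<^esub> = \<zero>\<^bsub>T\<^esub>"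
  using add_homs_zero[OF M.M.abelian_group_axioms tensor_abelian_group, of "\<lambda>m. d \<oslash> m"]
  by (simp add: add_homs_def pure_closed pure_add_right)

lemma pure_uminus_left: "\<lbrakk>d \<in> carrier D; m \<in> carrier M\<rbrakk> \<Longrightarrow> (\<ominus>\<^bsub>D\<^esub> d) \<oslash> m = \<ominus>\<^bsub>T\<^esub> (d \<oslash> m)"
  using add_homs_uminus[OF D.M.abelian_group_axioms tensor_abelian_group, of "\<lambda>d. d \<oslash> m"]
  by (simp add: add_homs_def pure_closed pure_add_left)

text \<open>Zero and negatives are covered by the case of pure tensors: 0 = 0 \<otimes> 0 and - (d
  \<otimes> m) = (- d) \<otimes> m.\<close>

lemma tensor_induct [consumes 1, case_names pure add]:
  assumes "t \<in> carrier T"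
    and pure: "\<And>d m. \<lbrakk>d \<in> carrier D; m \<in> carrier M\<rbrakk> \<Longrightarrow> P (d \<oslash> m)"
    and add: "\<And>t u. \<lbrakk>t \<in> carrier T; u \<in> carrier T; P t; P u\<rbrakk> \<Longrightarrow> P (t \<oplus>\<^bsub>T\<^esub> u)"
  shows "P t"
proof -
  obtain x where x: "x \<in> carrier F" "t = cls x" using assms(1) unfolding carrier_tensor by blast
  have cls0: "cls 0 = \<zero>\<^bsub>T\<^esub>"
  proof -
    have "cls 0 \<oplus>\<^bsub>T\<^esub> cls 0 = cls 0" using cls_add[of 0 0] by simp
    then show ?thesis using cls_closed[of 0] by (simp add: T.add.l_cancel_one)
  qed
  have neg: "cls (- y) = \<ominus>\<^bsub>T\<^esub> cls y" if "y \<in> carrier F" for y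
  proof -
    have "cls (- y) \<oplus>\<^bsub>T\<^esub> cls y = \<zero>\<^bsub>T\<^esub>" using cls_add[of "- y" y] cls0 that by simp
    then show ?thesis using cls_closed[of y] cls_closed[of "- y"] that by (simp add: T.minus_equality)
  qed
  have P0: "P \<zero>\<^bsub>T\<^esub>" using pure[of "\<zero>\<^bsub>D\<^esub>" "\<zero>\<^bsub>M\<^esub>"] by (simp add: pure_zero_left)
  have "Poly_Mapping.keys x \<subseteq> carrier D \<times> carrier M" using x by simp
  \<comment> \<open>The induction rule of the free abelian group builds elements by differences, so
    the claim is proved for x and - x together.\<close>
  then have "P (cls x) \<and> P (cls (- x))"
  proof (rule free_Abelian_group_induct)
    show "P (cls 0) \<and> P (cls (- 0))" using P0 cls0 by simp
  next
    fix x y assume *: "Poly_Mapping.keys x \<subseteq> carrier D \<times> carrier M" "Poly_Mapping.keys y \<subseteq> carrier D \<times> carrier M"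
      "P (cls x) \<and> P (cls (- x))" "P (cls y) \<and> P (cls (- y))"
    then have c: "x \<in> carrier F" "y \<in> carrier F" "- x \<in> carrier F" "- y \<in> carrier F" by simp_all
    have "cls (x - y) = cls x \<oplus>\<^bsub>T\<^esub> cls (- y)" "cls (- (x - y)) = cls (- x) \<oplus>\<^bsub>T\<^esub> cls y"
      using cls_add[OF c(1,4)] cls_add[OF c(3,2)] by simp_all
    then show "P (cls (x - y)) \<and> P (cls (- (x - y)))"
      using *(3,4) add[OF cls_closed[OF c(1)] cls_closed[OF c(4)]] add[OF cls_closed[OF c(3)] cls_closed[OF c(2)]]
      by metis
  next
    fix p assume "p \<in> carrier D \<times> carrier M"
    then obtain d m where p: "p = (d, m)" "d \<in> carrier D" "m \<in> carrier M" by auto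
    have "cls (- frag_of p) = \<ominus>\<^bsub>T\<^esub> (d \<oslash> m)"
      using neg[OF frag_of_F[OF p(2,3)]] unfolding p(1) pure_cls .
    then have "cls (- frag_of p) = (\<ominus>\<^bsub>D\<^esub> d) \<oslash> m"
      by (simp only: pure_uminus_left[OF p(2,3)])
    moreover have "cls (frag_of p) = d \<oslash> m" by (simp add: p pure_cls)
    ultimately show "P (cls (frag_of p)) \<and> P (cls (- frag_of p))"
      using pure[OF p(2,3)] pure[OF D.M.a_inv_closed[OF p(2)] p(3)] by simp
  qed
  then show ?thesis by (simp add: x)
qed

context
  fixes A :: "('a, 'w) ring_scheme" and \<beta>
  assumes A: "abelian_group A" and bal: "balanced R D M A \<beta>"
begin

interpretation A: abelian_group A by (rule A)

abbreviation "E \<equiv> frag_eval A (\<lambda>p. \<beta> (fst p) (snd p))"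

lemma E_hom: "E \<in> hom F (add_monoid A)"
  unfolding tensor_free_def by (rule frag_eval_hom[OF A]) (use bal in \<open>auto simp: balanced_def\<close>)

interpretation E: group_hom F "add_monoid A" E
  by (intro group_hom.intro group_hom_axioms.intro E_hom F.group_axioms A.a_group)

lemma E_frag_of: "\<lbrakk>d \<in> carrier D; m \<in> carrier M\<rbrakk> \<Longrightarrow> E (frag_of (d, m)) = \<beta> d m"
  using bal by (subst frag_eval_frag_of[OF A]) (auto simp: balanced_def)

lemma E_closed: "x \<in> carrier F \<Longrightarrow> E x \<in> carrier A"
  using E.hom_closed by simp

lemma E_add: "x \<in> carrier F \<Longrightarrow> y \<in> carrier F \<Longrightarrow> E (x + y) = E x \<oplus>\<^bsub>A\<^esub> E y"
  using E.hom_mult[of x y] by simp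

lemma E_diff: "x \<in> carrier F \<Longrightarrow> y \<in> carrier F \<Longrightarrow> E (x - y) = E x \<ominus>\<^bsub>A\<^esub> E y"
  using E_add[of "x - y" y] F_diff[of x y] E_closed[of x] E_closed[of y] E_closed[of "x - y"]
  by (simp add: a_minus_def A.a_assoc A.r_neg del: F_simps(1))

text \<open>The kernel of a homomorphism is a subgroup and \<open>H\<close> is generated by the
  relations, so it suffices to check the three kinds of generators.\<close>

lemma E_relations: "x \<in> H \<Longrightarrow> E x = \<zero>\<^bsub>A\<^esub>"
proof -
  have b: "\<beta> d m \<in> carrier A" if "d \<in> carrier D" "m \<in> carrier M" for d m
    using bal that by (simp add: balanced_def)
  have "H \<subseteq> kernel F (add_monoid A) E" unfolding tensor_relations_def
  proof (rule F.generate_subgroup_incl[OF _ E.subgroup_kernel], safe)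
    fix d d' m assume *: "d \<in> carrier D" "d' \<in> carrier D" "m \<in> carrier M"
    then show "frag_of (d \<oplus>\<^bsub>D\<^esub> d', m) - frag_of (d, m) - frag_of (d', m) \<in> kernel F (add_monoid A) E"
      using bal b by (simp add: kernel_def F_diff frag_of_F E_diff E_frag_of del: F_simps(1))
        (simp add: balanced_def a_minus_def A.a_ac A.r_neg A.r_neg1)
  next
    fix d m m' assume *: "d \<in> carrier D" "m \<in> carrier M" "m' \<in> carrier M"
    then show "frag_of (d, m \<oplus>\<^bsub>M\<^esub> m') - frag_of (d, m) - frag_of (d, m') \<in> kernel F (add_monoid A) E"
      using bal b by (simp add: kernel_def F_diff frag_of_F E_diff E_frag_of del: F_simps(1))
        (simp add: balanced_def a_minus_def A.a_ac A.r_neg A.r_neg1)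
  next
    fix r d m assume *: "r \<in> carrier R" "d \<in> carrier D" "m \<in> carrier M"
    then show "frag_of (r \<odot>\<^bsub>D\<^esub> d, m) - frag_of (d, r \<odot>\<^bsub>M\<^esub> m) \<in> kernel F (add_monoid A) E"
      using bal b D.smult_closed[of r d]
      by (simp add: kernel_def F_diff frag_of_F E_diff E_frag_of del: F_simps(1))
        (simp add: balanced_def M.smult_closed)
  qed
  then show "x \<in> H \<Longrightarrow> E x = \<zero>\<^bsub>A\<^esub>" by (auto simp: kernel_def)
qed

text \<open>\<open>E\<close> vanishes on the relations, hence is constant on each coset; the image
  of a coset is a singleton and \<open>the_elem\<close> returns the value at any
  representative.\<close>

lemma tensor_lift_cls:
  assumes "x \<in> carrier F" shows "tensor_lift R D M A \<beta> (cls x) = E x"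
proof -
  have HF: "h \<in> carrier F" if "h \<in> H" for h using subgroup.mem_carrier[OF relations_subgroup that] .
  have "E (h + x) = E x" if "h \<in> H" for h
    using that assms HF[OF that] by (simp add: E_add E_relations E_closed del: F_simps(1))
  moreover have "0 \<in> H" using subgroup.one_closed[OF relations_subgroup] by simp
  ultimately have "E ` cls x = {E x}" by (force simp: cls_def r_coset_def)
  moreover have "cls x \<in> carrier T" using assms by (rule cls_closed)
  ultimately show ?thesis by (simp add: tensor_lift_def frag_eval_def[symmetric] cong: image_cong)
qed

lemma tensor_lift_pure: "\<lbrakk>d \<in> carrier D; m \<in> carrier M\<rbrakk> \<Longrightarrow> tensor_lift R D M A \<beta> (d \<oslash> m) = \<beta> d m"
  by (simp add: pure_cls tensor_lift_cls frag_of_F E_frag_of del: F_simps(1))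

lemma tensor_lift_add_homs: "tensor_lift R D M A \<beta> \<in> add_homs T A"
proof -
  have "tensor_lift R D M A \<beta> (cls x \<oplus>\<^bsub>T\<^esub> cls y) = tensor_lift R D M A \<beta> (cls x) \<oplus>\<^bsub>A\<^esub> tensor_lift R D M A \<beta> (cls y)"
    if "x \<in> carrier F" "y \<in> carrier F" for x y
    using that by (simp add: tensor_lift_cls cls_add[symmetric] F_add E_add del: F_simps(1))
  moreover have "tensor_lift R D M A \<beta> (cls x) \<in> carrier A" if "x \<in> carrier F" for x
    using that by (simp add: tensor_lift_cls E_closed del: F_simps(1))
  ultimately show ?thesis unfolding add_homs_def carrier_tensor by auto
qed

end

end

lemma tensor_pairI: "\<lbrakk>left_module (opp_ring R) D; left_module R M\<rbrakk> \<Longrightarrow> tensor_pair R D M"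
  by (simp add: tensor_pair_def)

section \<open>Functoriality of the tensor product\<close>

locale tensor_map_pair = src: tensor_pair R D M + tgt: tensor_pair R E N
  for R :: "('r, 'x) ring_scheme" and D :: "('r, 'd, 'y) module_scheme"
    and M :: "('r, 'm, 'z) module_scheme" and E :: "('r, 'e, 'v) module_scheme"
    and N :: "('r, 'n, 'w) module_scheme" +
  fixes f g
  assumes f: "f \<in> linear_maps R D E" and g: "g \<in> linear_maps R M N"
begin

abbreviation "tm \<equiv> tensor_map R D M E N f g"

lemma fg_closed: "d \<in> carrier D \<Longrightarrow> f d \<in> carrier E" "m \<in> carrier M \<Longrightarrow> g m \<in> carrier N"
  using f g by (simp_all add: linear_maps_closed)

lemma map_balanced: "balanced R D M (tensor R E N) (\<lambda>d m. pure_tensor R E N (f d) (g m))"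
  using f g unfolding balanced_def
  by (simp add: linear_maps_def add_homs_def tgt.pure_closed tgt.pure_add_left tgt.pure_add_right tgt.pure_smult)

lemma map_pure:
  "\<lbrakk>d \<in> carrier D; m \<in> carrier M\<rbrakk> \<Longrightarrow> tm (pure_tensor R D M d m) = pure_tensor R E N (f d) (g m)"
  unfolding tensor_map_def by (rule src.tensor_lift_pure[OF tgt.tensor_abelian_group map_balanced])

lemma map_add_homs: "tm \<in> add_homs (tensor R D M) (tensor R E N)"
  unfolding tensor_map_def by (rule src.tensor_lift_add_homs[OF tgt.tensor_abelian_group map_balanced])

lemma map_closed: "t \<in> carrier (tensor R D M) \<Longrightarrow> tm t \<in> carrier (tensor R E N)"
  by (rule add_homs_closed[OF map_add_homs])

lemma map_zero: "tm \<zero>\<^bsub>tensor R D M\<^esub> = \<zero>\<^bsub>tensor R E N\<^esub>"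
  by (rule add_homs_zero[OF src.tensor_abelian_group tgt.tensor_abelian_group map_add_homs])

lemma map_trivial:
  assumes "\<And>m. m \<in> carrier M \<Longrightarrow> g m = \<zero>\<^bsub>N\<^esub>" "t \<in> carrier (tensor R D M)"
  shows "tm t = \<zero>\<^bsub>tensor R E N\<^esub>"
  using assms(2)
proof (induction rule: src.tensor_induct)
  case (pure d m) then show ?case by (simp add: map_pure assms(1) tgt.pure_zero_right fg_closed)
next
  case (add t u) then show ?case by (simp add: add_homs_add[OF map_add_homs])
qed

lemma map_surj:
  assumes "f ` carrier D = carrier E" "g ` carrier M = carrier N"
  shows "tm ` carrier (tensor R D M) = carrier (tensor R E N)"
proof
  show "tm ` carrier (tensor R D M) \<subseteq> carrier (tensor R E N)" using map_closed by blast
  show "carrier (tensor R E N) \<subseteq> tm ` carrier (tensor R D M)"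
  proof
    fix t assume "t \<in> carrier (tensor R E N)"
    then show "t \<in> tm ` carrier (tensor R D M)"
    proof (induction rule: tgt.tensor_induct)
      case (pure e n)
      then obtain d m where "d \<in> carrier D" "m \<in> carrier M" "e = f d" "n = g m" using assms by blast
      then show ?case using map_pure src.pure_closed by (metis imageI)
    next
      case (add t u)
      then show ?case using add_homs_add[OF map_add_homs] src.T.add.m_closed by (smt (verit) image_iff)
    qed
  qed
qed

text \<open>Right exactness in both variables at once: a homomorphism that kills \<open>ker f \<otimes> M\<close> and
  \<open>D \<otimes> ker g\<close> factors through \<open>f \<otimes> g\<close>.\<close>

lemma kernel_universal:
  assumes surj: "f ` carrier D = carrier E" "g ` carrier M = carrier N"
    and A: "abelian_group A" and p: "p \<in> add_homs (tensor R D M) A"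
    and kf: "\<And>d m. \<lbrakk>d \<in> carrier D; m \<in> carrier M; f d = \<zero>\<^bsub>E\<^esub>\<rbrakk> \<Longrightarrow> p (pure_tensor R D M d m) = \<zero>\<^bsub>A\<^esub>"
    and kg: "\<And>d m. \<lbrakk>d \<in> carrier D; m \<in> carrier M; g m = \<zero>\<^bsub>N\<^esub>\<rbrakk> \<Longrightarrow> p (pure_tensor R D M d m) = \<zero>\<^bsub>A\<^esub>"
    and t: "t \<in> carrier (tensor R D M)" "tm t = \<zero>\<^bsub>tensor R E N\<^esub>"
  shows "p t = \<zero>\<^bsub>A\<^esub>"
proof -
  interpret A: abelian_group A by (rule A)
  note fh = linear_mapsD[OF f] and gh = linear_mapsD[OF g]
  have pc: "p (pure_tensor R D M d m) \<in> carrier A" if "d \<in> carrier D" "m \<in> carrier M" for d m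
    using that by (intro add_homs_closed[OF p] src.pure_closed)
  have left: "p (pure_tensor R D M d m) = p (pure_tensor R D M d' m)"
    if *: "d \<in> carrier D" "d' \<in> carrier D" "m \<in> carrier M" "f d = f d'" for d d' m
  proof -
    have "f (d \<ominus>\<^bsub>D\<^esub> d') = \<zero>\<^bsub>E\<^esub>"
      using * add_homs_eq_iff[OF src.D.M.abelian_group_axioms tgt.D.M.abelian_group_axioms fh(1)] by simp
    then have "p (pure_tensor R D M (d \<ominus>\<^bsub>D\<^esub> d') m) = \<zero>\<^bsub>A\<^esub>" using * by (intro kf) auto
    moreover have "pure_tensor R D M ((d \<ominus>\<^bsub>D\<^esub> d') \<oplus>\<^bsub>D\<^esub> d') m =
        pure_tensor R D M (d \<ominus>\<^bsub>D\<^esub> d') m \<oplus>\<^bsub>tensor R D M\<^esub> pure_tensor R D M d' m"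
      using * by (intro src.pure_add_left) auto
    moreover have "(d \<ominus>\<^bsub>D\<^esub> d') \<oplus>\<^bsub>D\<^esub> d' = d" using * by (simp add: src.D.M.minus_eq src.D.M.a_assoc src.D.M.l_neg)
    ultimately show ?thesis using * pc[of d' m]
      by (simp add: add_homs_add[OF p] src.pure_closed)
  qed
  have right: "p (pure_tensor R D M d m) = p (pure_tensor R D M d m')"
    if *: "d \<in> carrier D" "m \<in> carrier M" "m' \<in> carrier M" "g m = g m'" for d m m'
  proof -
    have "g (m \<ominus>\<^bsub>M\<^esub> m') = \<zero>\<^bsub>N\<^esub>"
      using * add_homs_eq_iff[OF src.M.M.abelian_group_axioms tgt.M.M.abelian_group_axioms gh(1)] by simp
    then have "p (pure_tensor R D M d (m \<ominus>\<^bsub>M\<^esub> m')) = \<zero>\<^bsub>A\<^esub>" using * by (intro kg) auto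
    moreover have "pure_tensor R D M d ((m \<ominus>\<^bsub>M\<^esub> m') \<oplus>\<^bsub>M\<^esub> m') =
        pure_tensor R D M d (m \<ominus>\<^bsub>M\<^esub> m') \<oplus>\<^bsub>tensor R D M\<^esub> pure_tensor R D M d m'"
      using * by (intro src.pure_add_right) auto
    moreover have "(m \<ominus>\<^bsub>M\<^esub> m') \<oplus>\<^bsub>M\<^esub> m' = m" using * by (simp add: src.M.M.minus_eq src.M.M.a_assoc src.M.M.l_neg)
    ultimately show ?thesis using * pc[of d m']
      by (simp add: add_homs_add[OF p] src.pure_closed)
  qed
  \<comment> \<open>At (f d, g m) the value should be p (d \<otimes> m). By \<open>left\<close> and
    \<open>right\<close> this does not depend on the preimages, so any choice will do.\<close>
  define b where "b e n = p (pure_tensor R D M (inv_into (carrier D) f e) (inv_into (carrier M) g n))" for e n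
  have b: "b (f d) (g m) = p (pure_tensor R D M d m)" if "d \<in> carrier D" "m \<in> carrier M" for d m
  proof -
    let ?d = "inv_into (carrier D) f (f d)" and ?m = "inv_into (carrier M) g (g m)"
    have "?d \<in> carrier D" "f ?d = f d" "?m \<in> carrier M" "g ?m = g m"
      using that by (simp_all add: inv_into_into f_inv_into_f)
    then show ?thesis unfolding b_def using left[of ?d d ?m] right[of d ?m m] that by simp
  qed
  have "balanced R E N A b"
    unfolding balanced_def surj[symmetric]
  proof (intro conjI ballI; elim imageE; hypsubst_thin)
    fix d m assume "d \<in> carrier D" "m \<in> carrier M"
    then show "b (f d) (g m) \<in> carrier A" by (simp add: b pc)
  next
    fix d d' m assume *: "d \<in> carrier D" "d' \<in> carrier D" "m \<in> carrier M"
    then show "b (f d \<oplus>\<^bsub>E\<^esub> f d') (g m) = b (f d) (g m) \<oplus>\<^bsub>A\<^esub> b (f d') (g m)"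
      by (simp add: add_homs_add[OF fh(1), symmetric] b src.pure_add_left add_homs_add[OF p] src.pure_closed)
  next
    fix d m m' assume *: "d \<in> carrier D" "m \<in> carrier M" "m' \<in> carrier M"
    then show "b (f d) (g m \<oplus>\<^bsub>N\<^esub> g m') = b (f d) (g m) \<oplus>\<^bsub>A\<^esub> b (f d) (g m')"
      by (simp add: add_homs_add[OF gh(1), symmetric] b src.pure_add_right add_homs_add[OF p] src.pure_closed)
  next
    fix r d m assume *: "r \<in> carrier R" "d \<in> carrier D" "m \<in> carrier M"
    then have "r \<odot>\<^bsub>D\<^esub> d \<in> carrier D" by (simp add: src.D.smult_closed)
    with * show "b (r \<odot>\<^bsub>E\<^esub> f d) (g m) = b (f d) (r \<odot>\<^bsub>N\<^esub> g m)"
      by (simp add: fh(2)[symmetric] gh(2)[symmetric] b src.pure_smult)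
  qed
  note lift = tgt.tensor_lift_add_homs[OF A this] tgt.tensor_lift_pure[OF A this]
  \<comment> \<open>The factorization of \<open>p\<close> through \<open>tm\<close>, checked on pure
    tensors; with \<open>tm t\<close> = 0 it forces \<open>p t\<close> = 0.\<close>
  have "tensor_lift R E N A b (tm t) = p t" using t(1)
  proof (induction rule: src.tensor_induct)
    case (pure d m) then show ?case by (simp add: map_pure lift(2) b fg_closed)
  next
    case (add t u)
    then show ?case by (simp add: add_homs_add[OF map_add_homs] add_homs_add[OF lift(1)] add_homs_add[OF p] map_closed)
  qed
  then show ?thesis using t(2) add_homs_zero[OF tgt.tensor_abelian_group A lift(1)] by simp
qed

end

lemma tensor_map_pairI:
  "\<lbrakk>left_module (opp_ring R) D; left_module R M; left_module (opp_ring R) E; left_module R N;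
    f \<in> linear_maps R D E; g \<in> linear_maps R M N\<rbrakk> \<Longrightarrow> tensor_map_pair R D M E N f g"
  by (simp add: tensor_map_pair_def tensor_map_pair_axioms_def tensor_pairI)

text \<open>The composites are compared with \<open>h\<close> and \<open>k\<close> on the carriers
  only, because factorizations of a differential through a kernel hold only there. Commuting squares
  follow by comparing both sides with one common diagonal.\<close>

lemma tensor_map_comp:
  assumes fg: "tensor_map_pair R D M E N f g" and fg': "tensor_map_pair R E N E' N' f' g'"
    and h: "tensor_map_pair R D M E' N' h k" and t: "t \<in> carrier (tensor R D M)"
    and eq: "\<And>d. d \<in> carrier D \<Longrightarrow> f' (f d) = h d" "\<And>m. m \<in> carrier M \<Longrightarrow> g' (g m) = k m"
  shows "tensor_map R E N E' N' f' g' (tensor_map R D M E N f g t) = tensor_map R D M E' N' h k t"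
proof -
  interpret fg: tensor_map_pair R D M E N f g by (rule fg)
  interpret fg': tensor_map_pair R E N E' N' f' g' by (rule fg')
  interpret h: tensor_map_pair R D M E' N' h k by (rule h)
  show ?thesis using t
  proof (induction rule: fg.src.tensor_induct)
    case (pure d m) then show ?case by (simp add: fg.map_pure fg'.map_pure h.map_pure fg.fg_closed eq)
  next
    case (add t u) then show ?case
      by (simp add: add_homs_add[OF fg.map_add_homs] add_homs_add[OF fg'.map_add_homs]
          add_homs_add[OF h.map_add_homs] fg.map_closed)
  qed
qed

lemma tensor_map_id:
  assumes "tensor_map_pair R D M D M f g" "t \<in> carrier (tensor R D M)"
    and eq: "\<And>d. d \<in> carrier D \<Longrightarrow> f d = d" "\<And>m. m \<in> carrier M \<Longrightarrow> g m = m"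
  shows "tensor_map R D M D M f g t = t"
proof -
  interpret fg: tensor_map_pair R D M D M f g by fact
  show ?thesis using assms(2)
    by (induction rule: fg.src.tensor_induct) (simp_all add: fg.map_pure eq add_homs_add[OF fg.map_add_homs])
qed

section \<open>Right exactness in each variable\<close>

lemma ex_quotient_group:
  fixes T :: "('a, 'x) ring_scheme"
  assumes "abelian_group T" "subgroup I (add_monoid T)"
  obtains A :: "'a set ring" and p where "abelian_group A" "p \<in> add_homs T A"
    "\<And>x. x \<in> carrier T \<Longrightarrow> p x = \<zero>\<^bsub>A\<^esub> \<longleftrightarrow> x \<in> I"
proof -
  interpret T: abelian_group T by fact
  interpret N: normal I "add_monoid T" by (rule T.add.subgroup_imp_normal[OF assms(2)])
  define Q where "Q = add_monoid T Mod I"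
  define A :: "'a set ring"
    where "A = \<lparr>carrier = carrier Q, mult = undefined, one = undefined, zero = \<one>\<^bsub>Q\<^esub>, add = mult Q\<rparr>"
  have "comm_group Q" unfolding Q_def by (rule T.add.abelian_FactGroup[OF assms(2)])
  moreover have "add_monoid A = Q" by (simp add: A_def Q_def FactGroup_def)
  ultimately have "abelian_group A"
    by (intro abelian_group.intro abelian_monoid.intro abelian_group_axioms.intro)
      (simp_all add: comm_group_def)
  moreover have "(\<lambda>x. I #>\<^bsub>add_monoid T\<^esub> x) \<in> add_homs T A"
    using N.rcos_sum T.add.rcosetsI[OF N.subset[simplified]]
    by (auto simp: add_homs_def A_def Q_def FactGroup_def)
  moreover have "I #>\<^bsub>add_monoid T\<^esub> x = \<zero>\<^bsub>A\<^esub> \<longleftrightarrow> x \<in> I" if "x \<in> carrier T" for x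
    using T.add.coset_join1[OF _ _ assms(2)] T.add.coset_join2[OF _ assms(2)] N.subset that
    by (auto simp: A_def Q_def FactGroup_def)
  ultimately show ?thesis by (rule that)
qed

lemma add_homs_image_subgroup:
  assumes "abelian_group A" "abelian_group B" "f \<in> add_homs A B"
  shows "subgroup (f ` carrier A) (add_monoid B)"
  using group_hom.img_is_subgroup[OF add_homs_group_hom[OF assms]] by simp

text \<open>The quotient of D \<otimes> X by the image of D \<otimes> K serves as test group: the
  projection kills D \<otimes> ker p, hence, by \<open>kernel_universal\<close>, the whole kernel of
  D \<otimes> p, which therefore lies in that image.\<close>

lemma tensor_right_exact_right:
  fixes D :: "('r, 'd, 'y) module_scheme" and X :: "('r, 'n, 'z) module_scheme"
  assumes D: "left_module (opp_ring R) D" and "left_module R K" "left_module R X" "left_module R L"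
    and j: "j \<in> linear_maps R K X" and p: "p \<in> linear_maps R X L" "p ` carrier X = carrier L"
    and ex: "\<And>x. \<lbrakk>x \<in> carrier X; p x = \<zero>\<^bsub>L\<^esub>\<rbrakk> \<Longrightarrow> x \<in> j ` carrier K"
    and t: "t \<in> carrier (tensor R D X)" "tensor_map R D X D L (\<lambda>d. d) p t = \<zero>\<^bsub>tensor R D L\<^esub>"
  shows "t \<in> tensor_map R D K D X (\<lambda>d. d) j ` carrier (tensor R D K)"
proof -
  interpret j: tensor_map_pair R D K D X "\<lambda>d. d" j using assms by (intro tensor_map_pairI) simp_all
  interpret p: tensor_map_pair R D X D L "\<lambda>d. d" p using assms by (intro tensor_map_pairI) simp_all
  let ?I = "j.tm ` carrier (tensor R D K)"
  have I: "subgroup ?I (add_monoid (tensor R D X))"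
    by (rule add_homs_image_subgroup[OF j.src.tensor_abelian_group j.tgt.tensor_abelian_group j.map_add_homs])
  obtain A :: "('d, 'n) tensors set ring" and q where A: "abelian_group A" "q \<in> add_homs (tensor R D X) A"
    "\<And>x. x \<in> carrier (tensor R D X) \<Longrightarrow> q x = \<zero>\<^bsub>A\<^esub> \<longleftrightarrow> x \<in> ?I"
    by (rule ex_quotient_group[OF j.tgt.tensor_abelian_group I]) (rule that)
  have "q t = \<zero>\<^bsub>A\<^esub>"
  proof (rule p.kernel_universal[OF _ p(2) A(1,2) _ _ t])
    fix d m assume *: "d \<in> carrier D" "m \<in> carrier X" "d = \<zero>\<^bsub>D\<^esub>"
    then show "q (pure_tensor R D X d m) = \<zero>\<^bsub>A\<^esub>"
      using add_homs_zero[OF j.tgt.tensor_abelian_group A(1,2)] by (simp add: j.tgt.pure_zero_left)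
  next
    fix d m assume *: "d \<in> carrier D" "m \<in> carrier X" "p m = \<zero>\<^bsub>L\<^esub>"
    then obtain k where k: "k \<in> carrier K" "m = j k" using ex by blast
    then have "pure_tensor R D X d m = j.tm (pure_tensor R D K d k)" using * by (simp add: j.map_pure)
    then show "q (pure_tensor R D X d m) = \<zero>\<^bsub>A\<^esub>" using k *
      by (subst A(3)) (auto simp: j.map_closed j.src.pure_closed)
  qed simp
  then show ?thesis using A(3) t by blast
qed

text \<open>Mirror image, with the exact sequence in the right-module variable; it is applied to the
  beginning of a resolution of the right module.\<close>

lemma tensor_right_exact_left:
  fixes M :: "('r, 'm, 'y) module_scheme" and X :: "('r, 'd, 'z) module_scheme"
  assumes M: "left_module R M" and "left_module (opp_ring R) K" "left_module (opp_ring R) X" "left_module (opp_ring R) L"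
    and j: "j \<in> linear_maps R K X" and p: "p \<in> linear_maps R X L" "p ` carrier X = carrier L"
    and ex: "\<And>x. \<lbrakk>x \<in> carrier X; p x = \<zero>\<^bsub>L\<^esub>\<rbrakk> \<Longrightarrow> x \<in> j ` carrier K"
    and t: "t \<in> carrier (tensor R X M)" "tensor_map R X M L M p (\<lambda>m. m) t = \<zero>\<^bsub>tensor R L M\<^esub>"
  shows "t \<in> tensor_map R K M X M j (\<lambda>m. m) ` carrier (tensor R K M)"
proof -
  interpret j: tensor_map_pair R K M X M j "\<lambda>m. m" using assms by (intro tensor_map_pairI) simp_all
  interpret p: tensor_map_pair R X M L M p "\<lambda>m. m" using assms by (intro tensor_map_pairI) simp_all
  let ?I = "j.tm ` carrier (tensor R K M)"
  have I: "subgroup ?I (add_monoid (tensor R X M))"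
    by (rule add_homs_image_subgroup[OF j.src.tensor_abelian_group j.tgt.tensor_abelian_group j.map_add_homs])
  obtain A :: "('d, 'm) tensors set ring" and q where A: "abelian_group A" "q \<in> add_homs (tensor R X M) A"
    "\<And>x. x \<in> carrier (tensor R X M) \<Longrightarrow> q x = \<zero>\<^bsub>A\<^esub> \<longleftrightarrow> x \<in> ?I"
    by (rule ex_quotient_group[OF j.tgt.tensor_abelian_group I]) (rule that)
  have "q t = \<zero>\<^bsub>A\<^esub>"
  proof (rule p.kernel_universal[OF p(2) _ A(1,2) _ _ t])
    fix d m assume *: "d \<in> carrier X" "m \<in> carrier M" "m = \<zero>\<^bsub>M\<^esub>"
    then show "q (pure_tensor R X M d m) = \<zero>\<^bsub>A\<^esub>"
      using add_homs_zero[OF j.tgt.tensor_abelian_group A(1,2)] by (simp add: j.tgt.pure_zero_right)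
  next
    fix d m assume *: "d \<in> carrier X" "m \<in> carrier M" "p d = \<zero>\<^bsub>L\<^esub>"
    then obtain k where k: "k \<in> carrier K" "d = j k" using ex by blast
    then have "pure_tensor R X M d m = j.tm (pure_tensor R K M k m)" using * by (simp add: j.map_pure)
    then show "q (pure_tensor R X M d m) = \<zero>\<^bsub>A\<^esub>" using k *
      by (subst A(3)) (auto simp: j.map_closed j.src.pure_closed)
  qed simp
  then show ?thesis using A(3) t by blast
qed

section \<open>Dual bases and flatness of projective modules\<close>

lemma add_homs_finsum:
  assumes "abelian_group A" "abelian_group B" "f \<in> add_homs A B" "finite I" "g \<in> I \<rightarrow> carrier A"
  shows "f (\<Oplus>\<^bsub>A\<^esub>i\<in>I. g i) = (\<Oplus>\<^bsub>B\<^esub>i\<in>I. f (g i))"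
proof -
  interpret A: abelian_group A by fact
  interpret B: abelian_group B by fact
  show ?thesis using assms(4,5)
  proof (induction I)
    case empty then show ?case using add_homs_zero[OF assms(1-3)] by simp
  next
    case (insert i I)
    then have g: "g i \<in> carrier A" "g \<in> I \<rightarrow> carrier A" by auto
    then have "(\<lambda>i. f (g i)) \<in> I \<rightarrow> carrier B" using add_homs_closed[OF assms(3)] by auto
    with insert g show ?case by (simp add: add_homs_add[OF assms(3)] add_homs_closed[OF assms(3)] A.finsum_closed)
  qed
qed

text \<open>The expansion is demanded over every finite set containing the support, so that
  different elements can be expanded over one common index set.\<close>

definition dual_basis ::
    "('r, 'x) ring_scheme \<Rightarrow> ('r, 'p, 'z) module_scheme \<Rightarrow> 'b set \<Rightarrow> ('b \<Rightarrow> 'p) \<Rightarrow> ('b \<Rightarrow> 'p \<Rightarrow> 'r) \<Rightarrow> bool"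
  where "dual_basis R P B e c \<longleftrightarrow> e \<in> B \<rightarrow> carrier P \<and>
    (\<forall>b. \<forall>p\<in>carrier P. c b p \<in> carrier R) \<and>
    (\<forall>b. \<forall>p\<in>carrier P. \<forall>p'\<in>carrier P. c b (p \<oplus>\<^bsub>P\<^esub> p') = c b p \<oplus>\<^bsub>R\<^esub> c b p') \<and>
    (\<forall>b. \<forall>r\<in>carrier R. \<forall>p\<in>carrier P. c b (r \<odot>\<^bsub>P\<^esub> p) = r \<otimes>\<^bsub>R\<^esub> c b p) \<and>
    (\<forall>p\<in>carrier P. finite {b. c b p \<noteq> \<zero>\<^bsub>R\<^esub>} \<and> {b. c b p \<noteq> \<zero>\<^bsub>R\<^esub>} \<subseteq> B) \<and>
    (\<forall>p\<in>carrier P. \<forall>A. finite A \<longrightarrow> {b. c b p \<noteq> \<zero>\<^bsub>R\<^esub>} \<subseteq> A \<longrightarrow> A \<subseteq> B \<longrightarrow>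
      p = (\<Oplus>\<^bsub>P\<^esub>b\<in>A. c b p \<odot>\<^bsub>P\<^esub> e b))"

text \<open>\<open>e\<close> consists of the images under \<open>q\<close> of the unit vectors, and
  \<open>c b p\<close> is the coordinate of \<open>i p\<close> at \<open>b\<close>; the equation q
  (i p) = p is the expansion.\<close>

lemma projective_dual_basis:
  fixes P :: "('r, 'p, 'z) module_scheme"
  assumes "projective R P"
  shows "\<exists>(B :: 'p set) e c. dual_basis R P B e c"
proof -
  obtain B :: "'p set" and i q where P: "left_module R P" and i: "i \<in> mod_hom R P (free_module R B)"
    and q: "q \<in> mod_hom R (free_module R B) P" and qi: "\<And>x. x \<in> carrier P \<Longrightarrow> q (i x) = x"
    using assms unfolding projective_def by blast
  interpret left_module R P by (rule P)
  let ?F = "free_module R B"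
  define e where "e b = q (unit_vector R b)" for b
  have e: "e \<in> B \<rightarrow> carrier P"
    unfolding e_def
    by (intro Pi_I linear_maps_closed[OF mod_hom_linear[OF q]] unit_vector_closed[OF R.ring_axioms])
  have "q = free_lift R B P e"
    by (rule free_hom_eq[OF P q free_lift_hom[OF P e]]) (simp add: free_lift_unit_vector[OF P e] e_def)
  then have sum: "q f = (\<Oplus>\<^bsub>P\<^esub>b\<in>A. f b \<odot>\<^bsub>P\<^esub> e b)"
    if "f \<in> carrier ?F" "finite A" "{b. f b \<noteq> \<zero>\<^bsub>R\<^esub>} \<subseteq> A" "A \<subseteq> B" for f A
    using free_lift_superset[OF P e that] by simp
  have ic: "i p \<in> carrier ?F" if "p \<in> carrier P" for p
    using linear_maps_closed[OF mod_hom_linear[OF i]] that .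
  note il = linear_mapsD[OF mod_hom_linear[OF i]]
  have "dual_basis R P B e (\<lambda>b p. i p b)" unfolding dual_basis_def
  proof (intro conjI ballI allI impI)
    show "i p b \<in> carrier R" if "p \<in> carrier P" for b p using ic[OF that] by (simp add: free_module_def)
    show "i (p \<oplus>\<^bsub>P\<^esub> p') b = i p b \<oplus>\<^bsub>R\<^esub> i p' b" if "p \<in> carrier P" "p' \<in> carrier P" for b p p'
      using add_homs_add[OF il(1) that] by (simp add: free_module_def)
    show "i (r \<odot>\<^bsub>P\<^esub> p) b = r \<otimes>\<^bsub>R\<^esub> i p b" if "r \<in> carrier R" "p \<in> carrier P" for b r p
      using il(2)[OF that] by (simp add: free_module_def)
    show "finite {b. i p b \<noteq> \<zero>\<^bsub>R\<^esub>}" "{b. i p b \<noteq> \<zero>\<^bsub>R\<^esub>} \<subseteq> B" if "p \<in> carrier P" for p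
      using ic[OF that] by (simp_all add: free_module_def)
    show "p = (\<Oplus>\<^bsub>P\<^esub>b\<in>A. i p b \<odot>\<^bsub>P\<^esub> e b)"
      if "p \<in> carrier P" "finite A" "{b. i p b \<noteq> \<zero>\<^bsub>R\<^esub>} \<subseteq> A" "A \<subseteq> B" for p A
      using sum[OF ic[OF that(1)] that(2-4)] qi[OF that(1)] by simp
  qed (rule e)
  then show ?thesis by blast
qed

text \<open>Projective modules are flat: a dual basis \<open>(e\<^sub>b, c\<^sub>b)\<close> of \<open>P\<close> gives coordinates
  \<open>p \<otimes> k \<mapsto> c\<^sub>b(p) k\<close> on \<open>P \<otimes> K\<close> that determine a tensor and are natural in \<open>K\<close>.\<close>

lemma projective_flat:
  fixes R :: "('a, 'x) ring_scheme" and X :: "('a, 'q, 'w) module_scheme" and K :: "('a, 'i, 'v) module_scheme"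
    and P :: "('a, 'p, 'u) module_scheme"
  assumes P: "projective (opp_ring R) P" and K: "left_module R K" and X: "left_module R X"
    and j: "j \<in> linear_maps R K X" "inj_on j (carrier K)"
    and t: "t \<in> carrier (tensor R P K)" "tensor_map R P K P X (\<lambda>p. p) j t = \<zero>\<^bsub>tensor R P X\<^esub>"
  shows "t = \<zero>\<^bsub>tensor R P K\<^esub>"
proof -
  have LP: "left_module (opp_ring R) P" using P by (simp add: projective_def)
  obtain B :: "'p set" and e c where basis: "dual_basis (opp_ring R) P B e c"
    using projective_dual_basis[OF P] by blast
  have e: "e \<in> B \<rightarrow> carrier P"
    and c: "\<And>b p. p \<in> carrier P \<Longrightarrow> c b p \<in> carrier R"
    and c_add: "\<And>b p p'. \<lbrakk>p \<in> carrier P; p' \<in> carrier P\<rbrakk> \<Longrightarrow> c b (p \<oplus>\<^bsub>P\<^esub> p') = c b p \<oplus>\<^bsub>R\<^esub> c b p'"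
    and c_smult: "\<And>b r p. \<lbrakk>r \<in> carrier R; p \<in> carrier P\<rbrakk> \<Longrightarrow> c b (r \<odot>\<^bsub>P\<^esub> p) = c b p \<otimes>\<^bsub>R\<^esub> r"
    and fin: "\<And>p. p \<in> carrier P \<Longrightarrow> finite {b. c b p \<noteq> \<zero>\<^bsub>R\<^esub>} \<and> {b. c b p \<noteq> \<zero>\<^bsub>R\<^esub>} \<subseteq> B"
    and sum: "\<And>p A. \<lbrakk>p \<in> carrier P; finite A; {b. c b p \<noteq> \<zero>\<^bsub>R\<^esub>} \<subseteq> A; A \<subseteq> B\<rbrakk> \<Longrightarrow>
      p = (\<Oplus>\<^bsub>P\<^esub>b\<in>A. c b p \<odot>\<^bsub>P\<^esub> e b)"
    using basis unfolding dual_basis_def by (simp_all add: opp_ring_def)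
  \<comment> \<open>Unfolding the opposite multiplication turned linearity of \<open>c b\<close>
    into c(p r) = c(p) r, which makes (p, k) \<mapsto> c(p) k balanced. The module \<open>N\<close>
    stays arbitrary, since both \<open>K\<close> and \<open>X\<close> are substituted for
    it.\<close>
  have bal: "balanced R P N N (\<lambda>p k. c b p \<odot>\<^bsub>N\<^esub> k)" if "left_module R N"
    for N :: "('a, 'k, 'l) module_scheme" and b
  proof -
    interpret N: left_module R N by fact
    show ?thesis unfolding balanced_def using c
      by (simp add: c_add c_smult N.smult_closed N.smult_l_distr N.smult_r_distr N.smult_assoc1)
  qed
  interpret j: tensor_map_pair R P K P X "\<lambda>p. p" j by (intro tensor_map_pairI LP K X j linear_maps_id)
  note KA = left_module_abelian_group[OF K] and XA = left_module_abelian_group[OF X]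
  interpret K: abelian_group K by (rule KA)
  define \<phi> where "\<phi> b = tensor_lift R P K K (\<lambda>p k. c b p \<odot>\<^bsub>K\<^esub> k)" for b
  define \<psi> where "\<psi> b = tensor_lift R P X X (\<lambda>p k. c b p \<odot>\<^bsub>X\<^esub> k)" for b
  note \<phi> = j.src.tensor_lift_add_homs[OF KA bal[OF K], folded \<phi>_def]
    j.src.tensor_lift_pure[OF KA bal[OF K], folded \<phi>_def]
  note \<psi> = j.tgt.tensor_lift_add_homs[OF XA bal[OF X], folded \<psi>_def]
    j.tgt.tensor_lift_pure[OF XA bal[OF X], folded \<psi>_def]
  have nat: "\<psi> b (j.tm u) = j (\<phi> b u)" if "u \<in> carrier (tensor R P K)" for b u
    using that
  proof (induction rule: j.src.tensor_induct)
    case (pure p k) then show ?case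
      using c linear_maps_closed[OF j(1)] by (simp add: j.map_pure \<psi>(2) \<phi>(2) linear_mapsD(2)[OF j(1)])
  next
    case (add u v) then show ?case
      by (simp add: add_homs_add[OF j.map_add_homs] add_homs_add[OF \<psi>(1)] add_homs_add[OF \<phi>(1)]
          add_homs_add[OF linear_mapsD(1)[OF j(1)]] j.map_closed add_homs_closed[OF \<phi>(1)])
  qed
  \<comment> \<open>The expansion is stated stably under enlarging the index set: for the sum of two
    tensors both expansions have to be taken over a common finite set.\<close>
  have coord: "\<exists>A\<subseteq>B. finite A \<and> (\<forall>A'. A \<subseteq> A' \<longrightarrow> A' \<subseteq> B \<longrightarrow> finite A' \<longrightarrow>
      u = (\<Oplus>\<^bsub>tensor R P K\<^esub>b\<in>A'. pure_tensor R P K (e b) (\<phi> b u)))" if "u \<in> carrier (tensor R P K)" for u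
    using that
  proof (induction rule: j.src.tensor_induct)
    case (pure p k)
    have "pure_tensor R P K p k = (\<Oplus>\<^bsub>tensor R P K\<^esub>b\<in>A. pure_tensor R P K (e b) (\<phi> b (pure_tensor R P K p k)))"
      if A: "{b. c b p \<noteq> \<zero>\<^bsub>R\<^esub>} \<subseteq> A" "A \<subseteq> B" "finite A" for A
    proof -
      have eb: "e b \<in> carrier P" if "b \<in> A" for b using e A that by auto
      have ceb: "c b p \<odot>\<^bsub>P\<^esub> e b \<in> carrier P" if "b \<in> A" for b
        using eb[OF that] c[OF pure(1)] by (intro j.src.D.smult_closed) simp_all
      have "pure_tensor R P K p k = pure_tensor R P K (\<Oplus>\<^bsub>P\<^esub>b\<in>A. c b p \<odot>\<^bsub>P\<^esub> e b) k"
        using sum[OF pure(1) A(3) _ A(2)] A(1) by simp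
      also have "\<dots> = (\<Oplus>\<^bsub>tensor R P K\<^esub>b\<in>A. pure_tensor R P K (c b p \<odot>\<^bsub>P\<^esub> e b) k)"
        using ceb pure A(3)
        by (intro add_homs_finsum[OF j.src.D.M.abelian_group_axioms j.src.tensor_abelian_group])
          (auto simp: add_homs_def j.src.pure_add_left j.src.pure_closed)
      also have "\<dots> = (\<Oplus>\<^bsub>tensor R P K\<^esub>b\<in>A. pure_tensor R P K (e b) (\<phi> b (pure_tensor R P K p k)))"
        using pure eb c by (intro j.src.T.finsum_cong') (auto simp: \<phi>(2) j.src.pure_smult j.src.pure_closed)
      finally show ?thesis .
    qed
    then show ?case using fin[OF pure(1)] by (intro exI[of _ "{b. c b p \<noteq> \<zero>\<^bsub>R\<^esub>}"]) simp
  next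
    case (add u v)
    obtain A where A: "A \<subseteq> B" "finite A"
      and u: "\<forall>D. A \<subseteq> D \<longrightarrow> D \<subseteq> B \<longrightarrow> finite D \<longrightarrow> u = (\<Oplus>\<^bsub>tensor R P K\<^esub>b\<in>D. pure_tensor R P K (e b) (\<phi> b u))"
      using add(3) by (elim exE conjE)
    obtain A' where A': "A' \<subseteq> B" "finite A'"
      and v: "\<forall>D. A' \<subseteq> D \<longrightarrow> D \<subseteq> B \<longrightarrow> finite D \<longrightarrow> v = (\<Oplus>\<^bsub>tensor R P K\<^esub>b\<in>D. pure_tensor R P K (e b) (\<phi> b v))"
      using add(4) by (elim exE conjE)
    have "u \<oplus>\<^bsub>tensor R P K\<^esub> v = (\<Oplus>\<^bsub>tensor R P K\<^esub>b\<in>D. pure_tensor R P K (e b) (\<phi> b (u \<oplus>\<^bsub>tensor R P K\<^esub> v)))"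
      if D: "A \<union> A' \<subseteq> D" "D \<subseteq> B" "finite D" for D
    proof -
      have eb: "e b \<in> carrier P" if "b \<in> D" for b using e D that by auto
      have "(\<Oplus>\<^bsub>tensor R P K\<^esub>b\<in>D. pure_tensor R P K (e b) (\<phi> b (u \<oplus>\<^bsub>tensor R P K\<^esub> v))) =
          (\<Oplus>\<^bsub>tensor R P K\<^esub>b\<in>D. pure_tensor R P K (e b) (\<phi> b u) \<oplus>\<^bsub>tensor R P K\<^esub> pure_tensor R P K (e b) (\<phi> b v))"
        using add(1,2) eb add_homs_closed[OF \<phi>(1)]
        by (intro j.src.T.finsum_cong') (auto simp: add_homs_add[OF \<phi>(1)] j.src.pure_add_right j.src.pure_closed)
      also have "\<dots> = (\<Oplus>\<^bsub>tensor R P K\<^esub>b\<in>D. pure_tensor R P K (e b) (\<phi> b u)) \<oplus>\<^bsub>tensor R P K\<^esub>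
          (\<Oplus>\<^bsub>tensor R P K\<^esub>b\<in>D. pure_tensor R P K (e b) (\<phi> b v))"
        using add(1,2) eb add_homs_closed[OF \<phi>(1)]
        by (intro j.src.T.finsum_addf) (auto simp: j.src.pure_closed)
      also have "\<dots> = u \<oplus>\<^bsub>tensor R P K\<^esub> v" using u[rule_format, of D] v[rule_format, of D] D by simp
      finally show ?thesis by (rule sym)
    qed
    then show ?case using A A' by (intro exI[of _ "A \<union> A'"]) simp
  qed
  \<comment> \<open>Naturality and injectivity of \<open>j\<close> force every coordinate of
    \<open>t\<close> to vanish; its expansion is then zero.\<close>
  have \<phi>0: "\<phi> b t = \<zero>\<^bsub>K\<^esub>" for b
  proof -
    have "j (\<phi> b t) = \<zero>\<^bsub>X\<^esub>"
      using nat[OF t(1), of b] t(2) add_homs_zero[OF j.tgt.tensor_abelian_group XA \<psi>(1)] by simp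
    also have "\<dots> = j \<zero>\<^bsub>K\<^esub>"
      using add_homs_zero[OF KA XA linear_mapsD(1)[OF j(1)]] by simp
    finally show ?thesis using inj_onD[OF j(2)] add_homs_closed[OF \<phi>(1) t(1)] by simp
  qed
  obtain A where A: "A \<subseteq> B" "finite A"
    and sumA: "\<forall>A'. A \<subseteq> A' \<longrightarrow> A' \<subseteq> B \<longrightarrow> finite A' \<longrightarrow> t = (\<Oplus>\<^bsub>tensor R P K\<^esub>b\<in>A'. pure_tensor R P K (e b) (\<phi> b t))"
    using coord[OF t(1)] by (elim exE conjE)
  have tA: "t = (\<Oplus>\<^bsub>tensor R P K\<^esub>b\<in>A. pure_tensor R P K (e b) (\<phi> b t))"
    by (rule sumA[rule_format, OF order_refl A])
  have "pure_tensor R P K (e b) (\<phi> b t) = \<zero>\<^bsub>tensor R P K\<^esub>" if "b \<in> A" for b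
    using that A(1) e by (auto simp: \<phi>0 intro!: j.src.pure_zero_right)
  then have "(\<Oplus>\<^bsub>tensor R P K\<^esub>b\<in>A. pure_tensor R P K (e b) (\<phi> b t)) = (\<Oplus>\<^bsub>tensor R P K\<^esub>b\<in>A. \<zero>\<^bsub>tensor R P K\<^esub>)"
    by (intro j.src.T.finsum_cong') auto
  with tA show ?thesis by (metis j.src.T.finsum_zero)
qed

section \<open>Homomorphism modules and tensor modules\<close>

lemma mod_hom_extensionality:
  assumes "f \<in> mod_hom R M N" "g \<in> mod_hom R M N" "\<And>x. x \<in> carrier M \<Longrightarrow> f x = g x"
  shows "f = g"
  using assms by (auto simp: mod_hom_eq intro: extensionalityI)

lemma left_moduleI:
  assumes "ring R" "abelian_group M"
    and "\<And>a x. \<lbrakk>a \<in> carrier R; x \<in> carrier M\<rbrakk> \<Longrightarrow> a \<odot>\<^bsub>M\<^esub> x \<in> carrier M"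
    and "\<And>a b x. \<lbrakk>a \<in> carrier R; b \<in> carrier R; x \<in> carrier M\<rbrakk> \<Longrightarrow>
      (a \<oplus>\<^bsub>R\<^esub> b) \<odot>\<^bsub>M\<^esub> x = a \<odot>\<^bsub>M\<^esub> x \<oplus>\<^bsub>M\<^esub> b \<odot>\<^bsub>M\<^esub> x"
    and "\<And>a x y. \<lbrakk>a \<in> carrier R; x \<in> carrier M; y \<in> carrier M\<rbrakk> \<Longrightarrow>
      a \<odot>\<^bsub>M\<^esub> (x \<oplus>\<^bsub>M\<^esub> y) = a \<odot>\<^bsub>M\<^esub> x \<oplus>\<^bsub>M\<^esub> a \<odot>\<^bsub>M\<^esub> y"
    and "\<And>a b x. \<lbrakk>a \<in> carrier R; b \<in> carrier R; x \<in> carrier M\<rbrakk> \<Longrightarrow>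
      (a \<otimes>\<^bsub>R\<^esub> b) \<odot>\<^bsub>M\<^esub> x = a \<odot>\<^bsub>M\<^esub> (b \<odot>\<^bsub>M\<^esub> x)"
    and "\<And>x. x \<in> carrier M \<Longrightarrow> \<one>\<^bsub>R\<^esub> \<odot>\<^bsub>M\<^esub> x = x"
  shows "left_module R M"
  using assms by (intro left_module.intro left_module_axioms.intro) auto

lemma hom_group_simps [simp]:
  "carrier (hom_group R M N) = mod_hom R M N"
  "\<zero>\<^bsub>hom_group R M N\<^esub> = (\<lambda>x\<in>carrier M. \<zero>\<^bsub>N\<^esub>)"
  "f \<oplus>\<^bsub>hom_group R M N\<^esub> g = (\<lambda>x\<in>carrier M. f x \<oplus>\<^bsub>N\<^esub> g x)"
  by (simp_all add: hom_group_def)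

lemma hom_module_simps [simp]:
  "carrier (hom_module S C N) = mod_hom S C N"
  "\<zero>\<^bsub>hom_module S C N\<^esub> = (\<lambda>x\<in>carrier C. \<zero>\<^bsub>N\<^esub>)"
  "f \<oplus>\<^bsub>hom_module S C N\<^esub> g = (\<lambda>x\<in>carrier C. f x \<oplus>\<^bsub>N\<^esub> g x)"
  "r \<odot>\<^bsub>hom_module S C N\<^esub> f = (\<lambda>x\<in>carrier C. f (rsmult C x r))"
  by (simp_all add: hom_module_def)

lemma right_module_simps [simp]:
  "carrier (right_module C) = carrier C" "\<zero>\<^bsub>right_module C\<^esub> = \<zero>\<^bsub>C\<^esub>"
  "x \<oplus>\<^bsub>right_module C\<^esub> y = x \<oplus>\<^bsub>C\<^esub> y" "r \<odot>\<^bsub>right_module C\<^esub> x = rsmult C x r"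
  by (simp_all add: right_module_def)

lemma tensor_module_simps [simp]:
  "carrier (tensor_module R C M) = carrier (tensor R (right_module C) M)"
  "\<zero>\<^bsub>tensor_module R C M\<^esub> = \<zero>\<^bsub>tensor R (right_module C) M\<^esub>"
  "x \<oplus>\<^bsub>tensor_module R C M\<^esub> y = x \<oplus>\<^bsub>tensor R (right_module C) M\<^esub> y"
  "s \<odot>\<^bsub>tensor_module R C M\<^esub> x =
    tensor_map R (right_module C) M (right_module C) M (\<lambda>c. s \<odot>\<^bsub>C\<^esub> c) (\<lambda>m. m) x"
  by (simp_all add: tensor_module_def Let_def)

lemma linear_maps_plus:
  assumes "left_module R N" "f \<in> linear_maps R M N" "g \<in> linear_maps R M N"
  shows "(\<lambda>x. f x \<oplus>\<^bsub>N\<^esub> g x) \<in> linear_maps R M N"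
proof -
  interpret left_module R N by fact
  show ?thesis using assms(2,3)
    by (simp add: linear_maps_def add_homs_def smult_r_distr M.a_ac)
qed

lemma linear_maps_uminus:
  assumes "left_module R N" "f \<in> linear_maps R M N"
  shows "(\<lambda>x. \<ominus>\<^bsub>N\<^esub> f x) \<in> linear_maps R M N"
proof -
  interpret left_module R N by fact
  have "r \<odot>\<^bsub>N\<^esub> (\<ominus>\<^bsub>N\<^esub> x) = \<ominus>\<^bsub>N\<^esub> (r \<odot>\<^bsub>N\<^esub> x)" if "r \<in> carrier R" "x \<in> carrier N" for r x
    using that add_homs_uminus[OF M.abelian_group_axioms M.abelian_group_axioms, of "\<lambda>x. r \<odot>\<^bsub>N\<^esub> x"]
    by (simp add: add_homs_def smult_r_distr)
  then show ?thesis using assms(2)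
    by (simp add: linear_maps_def add_homs_def M.minus_add)
qed

lemma linear_maps_minus:
  assumes "left_module R N" "f \<in> linear_maps R M N" "g \<in> linear_maps R M N"
  shows "(\<lambda>x. f x \<ominus>\<^bsub>N\<^esub> g x) \<in> linear_maps R M N"
  using linear_maps_plus[OF assms(1,2) linear_maps_uminus[OF assms(1,3)]] by (simp add: a_minus_def)

lemma linear_maps_zero:
  assumes "left_module R N" shows "(\<lambda>x. \<zero>\<^bsub>N\<^esub>) \<in> linear_maps R M N"
proof -
  interpret left_module R N by fact
  show ?thesis by (simp add: linear_maps_def add_homs_def smult_r_null)
qed

lemma abelian_group_hom_group:
  assumes "left_module R M" "left_module R N"
  shows "abelian_group (hom_group R M N)"
proof -
  interpret M: left_module R M by fact
  interpret N: left_module R N by fact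
  have cl: "f x \<in> carrier N" if "f \<in> mod_hom R M N" "x \<in> carrier M" for f x
    using that by (auto simp: mod_hom_def)
  have add: "(\<lambda>x\<in>carrier M. f x \<oplus>\<^bsub>N\<^esub> g x) \<in> mod_hom R M N"
    if "f \<in> mod_hom R M N" "g \<in> mod_hom R M N" for f g
    by (intro restrict_mod_hom assms linear_maps_plus mod_hom_linear that)
  have zero: "(\<lambda>x\<in>carrier M. \<zero>\<^bsub>N\<^esub>) \<in> mod_hom R M N"
    by (intro restrict_mod_hom assms linear_maps_zero)
  have neg: "(\<lambda>x\<in>carrier M. \<ominus>\<^bsub>N\<^esub> f x) \<in> mod_hom R M N" if "f \<in> mod_hom R M N" for f
    by (intro restrict_mod_hom assms linear_maps_uminus mod_hom_linear that)
  let ?H = "hom_group R M N"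
  show ?thesis
  proof (rule abelian_groupI)
    fix f g h assume "f \<in> carrier ?H" "g \<in> carrier ?H" "h \<in> carrier ?H"
    then show "f \<oplus>\<^bsub>?H\<^esub> g \<oplus>\<^bsub>?H\<^esub> h = f \<oplus>\<^bsub>?H\<^esub> (g \<oplus>\<^bsub>?H\<^esub> h)"
      by (auto simp: cl N.M.a_assoc intro!: restrict_ext)
  next
    fix f g assume "f \<in> carrier ?H" "g \<in> carrier ?H"
    then show "f \<oplus>\<^bsub>?H\<^esub> g = g \<oplus>\<^bsub>?H\<^esub> f"
      by (auto simp: cl N.M.a_comm intro!: restrict_ext)
  next
    fix f assume "f \<in> carrier ?H"
    then have f: "f \<in> mod_hom R M N" by simp
    show "\<zero>\<^bsub>?H\<^esub> \<oplus>\<^bsub>?H\<^esub> f = f"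
      using f mod_hom_extensionality[OF add[OF zero f] f] by (simp add: cl)
    show "\<exists>g\<in>carrier ?H. g \<oplus>\<^bsub>?H\<^esub> f = \<zero>\<^bsub>?H\<^esub>"
      using f neg[OF f] by (intro bexI[of _ "\<lambda>x\<in>carrier M. \<ominus>\<^bsub>N\<^esub> f x"]) (auto simp: cl N.M.l_neg intro!: restrict_ext)
  qed (use add zero in simp_all)
qed

text \<open>Moves the group axioms between record types with the same additive part, from
  \<open>hom_group\<close> to \<open>hom_module\<close> and from \<open>tensor\<close> to
  \<open>tensor_module\<close>.\<close>

lemma abelian_group_cong:
  assumes "abelian_group A" "carrier B = carrier A" "zero B = zero A" "add B = add A"
  shows "abelian_group B"
proof -
  interpret A: abelian_group A by fact
  show ?thesis
    by (rule abelian_groupI)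
      (auto simp: assms(2-4) A.a_ac A.l_neg intro!: bexI[of _ "\<ominus>\<^bsub>A\<^esub> _"])
qed

section \<open>Hom and tensor modules of a bimodule\<close>

locale bimod =
  fixes S :: "('s, 'x) ring_scheme" and R :: "('r, 'y) ring_scheme"
    and C :: "('s, 'r, 'c, 'z) bimodule_scheme"
  assumes ring_R: "ring R" and bimodule: "is_bimodule S R C"
begin

abbreviation "D \<equiv> right_module C"

lemma left_module_C: "left_module S C" and left_module_D: "left_module (opp_ring R) D"
  using bimodule by (simp_all add: is_bimodule_def)

sublocale C: left_module S C by (rule left_module_C)
sublocale D: left_module "opp_ring R" D by (rule left_module_D)

lemma rsmult_closed: "\<lbrakk>c \<in> carrier C; r \<in> carrier R\<rbrakk> \<Longrightarrow> rsmult C c r \<in> carrier C"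
  using D.smult_closed[of r c] by simp

lemma rsmult_add_left:
  "\<lbrakk>c \<in> carrier C; c' \<in> carrier C; r \<in> carrier R\<rbrakk> \<Longrightarrow> rsmult C (c \<oplus>\<^bsub>C\<^esub> c') r = rsmult C c r \<oplus>\<^bsub>C\<^esub> rsmult C c' r"
  using D.smult_r_distr[of r c c'] by simp

lemma rsmult_add_right:
  "\<lbrakk>c \<in> carrier C; r \<in> carrier R; r' \<in> carrier R\<rbrakk> \<Longrightarrow> rsmult C c (r \<oplus>\<^bsub>R\<^esub> r') = rsmult C c r \<oplus>\<^bsub>C\<^esub> rsmult C c r'"
  using D.smult_l_distr[of r r' c] by (simp add: opp_ring_def)

lemma rsmult_assoc:
  "\<lbrakk>c \<in> carrier C; r \<in> carrier R; r' \<in> carrier R\<rbrakk> \<Longrightarrow> rsmult C c (r \<otimes>\<^bsub>R\<^esub> r') = rsmult C (rsmult C c r) r'"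
  using D.smult_assoc1[of r' r c] by (simp add: opp_ring_def)

lemma rsmult_one: "c \<in> carrier C \<Longrightarrow> rsmult C c \<one>\<^bsub>R\<^esub> = c"
  using D.smult_one[of c] by (simp add: opp_ring_def)

lemma smult_rsmult:
  "\<lbrakk>s \<in> carrier S; c \<in> carrier C; r \<in> carrier R\<rbrakk> \<Longrightarrow> s \<odot>\<^bsub>C\<^esub> rsmult C c r = rsmult C (s \<odot>\<^bsub>C\<^esub> c) r"
  using bimodule by (simp add: is_bimodule_def)

lemma rsmult_linear: "r \<in> carrier R \<Longrightarrow> (\<lambda>c. rsmult C c r) \<in> linear_maps S C C"
  by (simp add: linear_maps_def add_homs_def rsmult_closed rsmult_add_left smult_rsmult)

lemma smult_linear: "s \<in> carrier S \<Longrightarrow> (\<lambda>c. s \<odot>\<^bsub>C\<^esub> c) \<in> linear_maps R D D"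
  by (simp add: linear_maps_def add_homs_def C.smult_r_distr smult_rsmult)

lemma left_module_hom_module:
  assumes "left_module S N" shows "left_module R (hom_module S C N)"
proof (rule left_moduleI)
  interpret N: left_module S N by fact
  have cl: "f x \<in> carrier N" if "f \<in> mod_hom S C N" "x \<in> carrier C" for f x
    using that by (auto simp: mod_hom_def)
  have add: "f (x \<oplus>\<^bsub>C\<^esub> y) = f x \<oplus>\<^bsub>N\<^esub> f y" if "f \<in> mod_hom S C N" "x \<in> carrier C" "y \<in> carrier C" for f x y
    using that by (auto simp: mod_hom_def)
  show "abelian_group (hom_module S C N)"
    by (rule abelian_group_cong[OF abelian_group_hom_group[OF left_module_C assms]]) (simp_all add: fun_eq_iff)
  show "r \<odot>\<^bsub>hom_module S C N\<^esub> f \<in> carrier (hom_module S C N)"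
    if "r \<in> carrier R" "f \<in> carrier (hom_module S C N)" for r f
    using restrict_mod_hom[OF left_module_C linear_maps_comp[OF rsmult_linear[OF that(1)] mod_hom_linear]] that(2)
    by simp
  show "\<one>\<^bsub>R\<^esub> \<odot>\<^bsub>hom_module S C N\<^esub> f = f" if "f \<in> carrier (hom_module S C N)" for f
    using that by (auto simp: rsmult_one mod_hom_eq extensional_def restrict_def fun_eq_iff)
qed (auto simp: ring_R rsmult_closed rsmult_add_right rsmult_assoc mod_hom_def intro!: restrict_ext)

lemma tensor_map_pair_D:
  assumes "left_module R M" "left_module R N" "f \<in> linear_maps R D D" "g \<in> linear_maps R M N"
  shows "tensor_map_pair R D M D N f g"
  by (intro tensor_map_pairI left_module_D assms)

text \<open>Associativity and the unit law are functoriality of the tensor product; distributivity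
  over sums of scalars is checked on pure tensors and extended by induction.\<close>

lemma left_module_tensor_module:
  assumes M: "left_module R M" shows "left_module S (tensor_module R C M)"
proof (rule left_moduleI)
  interpret T: tensor_pair R D M by (intro tensor_pairI left_module_D M)
  have s: "tensor_map_pair R D M D M (\<lambda>c. s \<odot>\<^bsub>C\<^esub> c) (\<lambda>m. m)" if "s \<in> carrier S" for s
    using that by (intro tensor_map_pair_D M smult_linear linear_maps_id)
  note sm = tensor_map_pair.map_add_homs[OF s] tensor_map_pair.map_pure[OF s]
  show "abelian_group (tensor_module R C M)"
    by (rule abelian_group_cong[OF T.tensor_abelian_group]) (simp_all add: fun_eq_iff)
  show "ring S" by (rule C.R.ring_axioms)
  show "a \<odot>\<^bsub>tensor_module R C M\<^esub> x \<in> carrier (tensor_module R C M)"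
    if "a \<in> carrier S" "x \<in> carrier (tensor_module R C M)" for a x
    using that add_homs_closed[OF sm(1)] by simp
  show "a \<odot>\<^bsub>tensor_module R C M\<^esub> (x \<oplus>\<^bsub>tensor_module R C M\<^esub> y) =
      a \<odot>\<^bsub>tensor_module R C M\<^esub> x \<oplus>\<^bsub>tensor_module R C M\<^esub> a \<odot>\<^bsub>tensor_module R C M\<^esub> y"
    if "a \<in> carrier S" "x \<in> carrier (tensor_module R C M)" "y \<in> carrier (tensor_module R C M)" for a x y
    using that add_homs_add[OF sm(1)] by simp
  show "(a \<oplus>\<^bsub>S\<^esub> b) \<odot>\<^bsub>tensor_module R C M\<^esub> x =
      a \<odot>\<^bsub>tensor_module R C M\<^esub> x \<oplus>\<^bsub>tensor_module R C M\<^esub> b \<odot>\<^bsub>tensor_module R C M\<^esub> x"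
    if ab: "a \<in> carrier S" "b \<in> carrier S" and "x \<in> carrier (tensor_module R C M)" for a b x
  proof -
    have "x \<in> carrier (tensor R D M)" using that by simp
    then show ?thesis
    proof (induction rule: T.tensor_induct)
      case (pure c m) with ab show ?case
        using T.pure_add_left[of "a \<odot>\<^bsub>C\<^esub> c" "b \<odot>\<^bsub>C\<^esub> c" m] by (simp add: sm(2) C.smult_l_distr)
    next
      case (add t u) with ab show ?case
        using add_homs_closed[OF sm(1)] by (simp add: add_homs_add[OF sm(1)] T.T.a_ac)
    qed
  qed
  show "(a \<otimes>\<^bsub>S\<^esub> b) \<odot>\<^bsub>tensor_module R C M\<^esub> x =
      a \<odot>\<^bsub>tensor_module R C M\<^esub> (b \<odot>\<^bsub>tensor_module R C M\<^esub> x)"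
    if ab: "a \<in> carrier S" "b \<in> carrier S" and "x \<in> carrier (tensor_module R C M)" for a b x
    using that tensor_map_comp[OF s[OF ab(2)] s[OF ab(1)] s[OF C.R.m_closed[OF ab]], of x]
    by (simp add: C.smult_assoc1)
  show "\<one>\<^bsub>S\<^esub> \<odot>\<^bsub>tensor_module R C M\<^esub> x = x" if "x \<in> carrier (tensor_module R C M)" for x
    using that tensor_map_id[OF s[OF C.R.one_closed], of x] by simp
qed

text \<open>Both orders of composing the action of \<open>s\<close> with the induced map give the
  tensor product of multiplication by \<open>s\<close> with \<open>g\<close>.\<close>

lemma tensor_map_linear:
  assumes M: "left_module R M" and N: "left_module R N" and g: "g \<in> linear_maps R M N"
  shows "tensor_map R D M D N (\<lambda>c. c) g \<in> linear_maps S (tensor_module R C M) (tensor_module R C N)"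
proof -
  have g': "tensor_map_pair R D M D N (\<lambda>c. c) g"
    by (intro tensor_map_pair_D assms linear_maps_id)
  have s: "tensor_map_pair R D L D L (\<lambda>c. s \<odot>\<^bsub>C\<^esub> c) (\<lambda>m. m)" if "s \<in> carrier S" "left_module R L" for s L
    using that by (intro tensor_map_pair_D smult_linear linear_maps_id)
  have "tensor_map R D M D N (\<lambda>c. c) g (s \<odot>\<^bsub>tensor_module R C M\<^esub> t) =
      s \<odot>\<^bsub>tensor_module R C N\<^esub> tensor_map R D M D N (\<lambda>c. c) g t"
    if st: "s \<in> carrier S" "t \<in> carrier (tensor R D M)" for s t
  proof -
    have sg: "tensor_map_pair R D M D N (\<lambda>c. s \<odot>\<^bsub>C\<^esub> c) g"
      using st(1) by (intro tensor_map_pair_D assms smult_linear)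
    show ?thesis
      using tensor_map_comp[OF s[OF st(1) M] g' sg st(2)] tensor_map_comp[OF g' s[OF st(1) N] sg st(2)] by simp
  qed
  then show ?thesis using tensor_map_pair.map_add_homs[OF g']
    by (simp add: linear_maps_def add_homs_def)
qed

lemma hom_map_linear:
  assumes "left_module S N" "left_module S N'" "g \<in> linear_maps S N N'"
  shows "compose (carrier C) g \<in> linear_maps R (hom_module S C N) (hom_module S C N')"
proof -
  have "compose (carrier C) g f \<in> mod_hom S C N'" if "f \<in> mod_hom S C N" for f
    using restrict_mod_hom[OF left_module_C linear_maps_comp[OF mod_hom_linear[OF that] assms(3)]]
    by (simp add: compose_def)
  moreover have "f x \<in> carrier N" if "f \<in> mod_hom S C N" "x \<in> carrier C" for f x
    using that by (auto simp: mod_hom_def)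
  ultimately show ?thesis using linear_mapsD[OF assms(3)]
    by (auto simp: linear_maps_def add_homs_def compose_def rsmult_closed intro!: restrict_ext)
qed

end

section \<open>Ext and Tor\<close>

lemma ex_chosen_resolution:
  assumes "left_module R M"
  obtains P d \<epsilon> where "chosen_resolution R M = (P, d, \<epsilon>)" "projective_resolution R M P d \<epsilon>"
proof -
  have "case chosen_resolution R M of (P, d, \<epsilon>) \<Rightarrow> projective_resolution R M P d \<epsilon>"
    unfolding chosen_resolution_def
    by (rule someI_ex) (use ex_projective_resolution[OF assms] in auto)
  then show ?thesis using that by (cases "chosen_resolution R M") auto
qed

lemma trivial_group_subquotient:
  assumes A: "abelian_group A" and Z: "subgroup Z (add_monoid A)" and B: "subgroup B (add_monoid A)" and BZ: "B \<subseteq> Z"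
  shows "trivial_group (subquotient A Z B) \<longleftrightarrow> Z \<subseteq> B"
proof -
  interpret A: abelian_group A by (rule A)
  let ?G = "(add_monoid A)\<lparr>carrier := Z\<rparr>"
  interpret G: comm_group ?G by 
    (rule group.group_comm_groupI[OF A.add.subgroup_imp_group[OF Z]],
      use subgroup.subset[OF Z] in \<open>auto intro!: A.a_comm\<close>)
  have BG: "subgroup B ?G" by (rule A.add.subgroup_incl[OF B Z BZ])
  interpret N: normal B ?G by (rule G.subgroup_imp_normal[OF BG])
  have "group (subquotient A Z B)" unfolding subquotient_def by (rule N.factorgroup_is_group)
  moreover have "carrier (subquotient A Z B) = rcosets\<^bsub>?G\<^esub> B" "\<one>\<^bsub>subquotient A Z B\<^esub> = B"
    by (simp_all add: subquotient_def FactGroup_def)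
  moreover have "rcosets\<^bsub>?G\<^esub> B = {B} \<longleftrightarrow> Z \<subseteq> B"
  proof
    assume *: "rcosets\<^bsub>?G\<^esub> B = {B}"
    show "Z \<subseteq> B"
    proof
      fix z assume "z \<in> Z"
      then have "B #>\<^bsub>?G\<^esub> z = B" "z \<in> B #>\<^bsub>?G\<^esub> z"
        using * G.rcos_self[OF _ BG, of z] by (auto simp: RCOSETS_def)
      then show "z \<in> B" by simp
    qed
  next
    assume "Z \<subseteq> B"
    then have "B #>\<^bsub>?G\<^esub> z = B" if "z \<in> Z" for z
      using that G.coset_join2[OF _ BG, of z] by auto
    moreover have "Z \<noteq> {}" using subgroup.one_closed[OF Z] by auto
    ultimately show "rcosets\<^bsub>?G\<^esub> B = {B}" by (auto simp: RCOSETS_def)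
  qed
  ultimately show ?thesis by (simp add: trivial_group_def)
qed

lemma a_kernel_subgroup:
  assumes "abelian_group A" "abelian_group B" "f \<in> add_homs A B"
  shows "subgroup (a_kernel A B f) (add_monoid A)"
  using group_hom.subgroup_kernel[OF add_homs_group_hom[OF assms]] by (simp add: a_kernel_def)

text \<open>Pointwise forms of exactness of the complexes \<open>Hom(P, N)\<close> and \<open>P \<otimes> M\<close> at a spot of positive
  degree, where \<open>a : P \<rightarrow> Q\<close> and \<open>b : Q \<rightarrow> L\<close> are consecutive differentials.\<close>

definition hom_exact_at where
  "hom_exact_at R P Q L a b N \<longleftrightarrow> (\<forall>f\<in>linear_maps R Q N. (\<forall>x\<in>carrier P. f (a x) = \<zero>\<^bsub>N\<^esub>) \<longrightarrow>
    (\<exists>g\<in>linear_maps R L N. \<forall>x\<in>carrier Q. f x = g (b x)))"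

definition tensor_exact_at where
  "tensor_exact_at R P Q L a b M \<longleftrightarrow> (\<forall>t\<in>carrier (tensor R Q M).
    tensor_map R Q M L M b (\<lambda>m. m) t = \<zero>\<^bsub>tensor R L M\<^esub> \<longrightarrow>
    t \<in> tensor_map R P M Q M a (\<lambda>m. m) ` carrier (tensor R P M))"

lemma projective_resolutionD:
  assumes "projective_resolution R M P d \<epsilon>"
  shows "projective R (P i)" "left_module R (P i)" "d i \<in> linear_maps R (P (Suc i)) (P i)"
    "\<epsilon> \<in> linear_maps R (P 0) M" "\<epsilon> ` carrier (P 0) = carrier M"
    "d 0 ` carrier (P (Suc 0)) = {x \<in> carrier (P 0). \<epsilon> x = \<zero>\<^bsub>M\<^esub>}"
    "d (Suc i) ` carrier (P (Suc (Suc i))) = {x \<in> carrier (P (Suc i)). d i x = \<zero>\<^bsub>P i\<^esub>}"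
  using assms unfolding projective_resolution_def exact_at_def a_kernel_def kernel_def
  by (auto simp: projective_def mod_hom_eq)

text \<open>Vanishing of cohomology means that cocycles are coboundaries. \<open>Ext\<close> is
  built from extensional maps while the right-hand side admits arbitrary linear ones; restriction to
  the carriers passes between the two.\<close>

lemma trivial_Ext_iff:
  assumes ch: "chosen_resolution R M = (P, d, \<epsilon>)" and res: "projective_resolution R M P d \<epsilon>"
    and N: "left_module R N"
  shows "trivial_group (Ext (Suc i) R M N) \<longleftrightarrow>
    hom_exact_at R (P (Suc (Suc i))) (P (Suc i)) (P i) (d (Suc i)) (d i) N"
proof -
  note P = projective_resolutionD(2)[OF res] and d = projective_resolutionD(3)[OF res]
  let ?H = "\<lambda>i. hom_group R (P i) N" and ?\<delta> = "\<lambda>i. precompose (P (Suc i)) (d i)"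
  interpret N: left_module R N by (rule N)
  have ag: "abelian_group (?H i)" for i by (rule abelian_group_hom_group[OF P N])
  have \<delta>: "?\<delta> i f \<in> mod_hom R (P (Suc i)) N" if "f \<in> mod_hom R (P i) N" for i f
    using restrict_mod_hom[OF P linear_maps_comp[OF d mod_hom_linear[OF that]]]
    by (simp add: precompose_def compose_def)
  have \<delta>_hom: "?\<delta> i \<in> add_homs (?H i) (?H (Suc i))" for i
    using \<delta> linear_maps_closed[OF d] by (auto simp: add_homs_def precompose_def compose_def intro!: restrict_ext)
  have \<delta>0: "?\<delta> i f = (\<lambda>x\<in>carrier (P (Suc i)). \<zero>\<^bsub>N\<^esub>) \<longleftrightarrow> (\<forall>x\<in>carrier (P (Suc i)). f (d i x) = \<zero>\<^bsub>N\<^esub>)" for i f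
    by (auto simp: precompose_def compose_def fun_eq_iff)
  have dd: "d i (d (Suc i) x) = \<zero>\<^bsub>P i\<^esub>" if "x \<in> carrier (P (Suc (Suc i)))" for x
    using projective_resolutionD(7)[OF res, of i] that by blast
  let ?Z = "a_kernel (?H (Suc i)) (?H (Suc (Suc i))) (?\<delta> (Suc i))" and ?B = "?\<delta> i ` mod_hom R (P i) N"
  have Z: "f \<in> ?Z \<longleftrightarrow> f \<in> mod_hom R (P (Suc i)) N \<and> (\<forall>x\<in>carrier (P (Suc (Suc i))). f (d (Suc i) x) = \<zero>\<^bsub>N\<^esub>)" for f
    by (simp add: a_kernel_iff \<delta>0)
  have f0: "f \<zero>\<^bsub>P i\<^esub> = \<zero>\<^bsub>N\<^esub>" if "f \<in> mod_hom R (P i) N" for f i by (rule mod_hom_zero[OF P N that])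
  have "Ext (Suc i) R M N = subquotient (?H (Suc i)) ?Z ?B" by (simp add: Ext_def ch)
  moreover have "?B \<subseteq> ?Z"
    unfolding subset_iff Z using \<delta> f0 dd linear_maps_closed[OF d] by (auto simp: precompose_def compose_def)
  moreover have B: "subgroup ?B (add_monoid (?H (Suc i)))"
    using add_homs_image_subgroup[OF ag ag \<delta>_hom[of i]] by simp
  ultimately have "trivial_group (Ext (Suc i) R M N) \<longleftrightarrow> ?Z \<subseteq> ?B"
    using trivial_group_subquotient[OF ag a_kernel_subgroup[OF ag ag \<delta>_hom]
        B] by simp
  also have "\<dots> \<longleftrightarrow> hom_exact_at R (P (Suc (Suc i))) (P (Suc i)) (P i) (d (Suc i)) (d i) N"
  proof
    assume *: "?Z \<subseteq> ?B"
    show "hom_exact_at R (P (Suc (Suc i))) (P (Suc i)) (P i) (d (Suc i)) (d i) N"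
      unfolding hom_exact_at_def
    proof (intro ballI impI)
      fix f assume f: "f \<in> linear_maps R (P (Suc i)) N" "\<forall>x\<in>carrier (P (Suc (Suc i))). f (d (Suc i) x) = \<zero>\<^bsub>N\<^esub>"
      let ?f = "restrict f (carrier (P (Suc i)))"
      have "?f \<in> ?Z" unfolding Z using restrict_mod_hom[OF P f(1)] f(2) linear_maps_closed[OF d] by auto
      then obtain g where g: "g \<in> mod_hom R (P i) N" "?f = ?\<delta> i g" using * by blast
      have "f x = g (d i x)" if "x \<in> carrier (P (Suc i))" for x
        using fun_cong[OF g(2), of x] that by (simp add: precompose_def compose_def)
      then show "\<exists>g\<in>linear_maps R (P i) N. \<forall>x\<in>carrier (P (Suc i)). f x = g (d i x)"
        using mod_hom_linear[OF g(1)] by blast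
    qed
  next
    assume *: "hom_exact_at R (P (Suc (Suc i))) (P (Suc i)) (P i) (d (Suc i)) (d i) N"
    show "?Z \<subseteq> ?B"
    proof
      fix f assume f: "f \<in> ?Z"
      then obtain g where g: "g \<in> linear_maps R (P i) N" "\<forall>x\<in>carrier (P (Suc i)). f x = g (d i x)"
        using *[unfolded hom_exact_at_def, rule_format, OF mod_hom_linear, of f] unfolding Z by blast
      let ?g = "restrict g (carrier (P i))"
      have g': "?g \<in> mod_hom R (P i) N" by (rule restrict_mod_hom[OF P g(1)])
      have "f = ?\<delta> i ?g"
        using f g(2) linear_maps_closed[OF d] unfolding Z
        by (intro mod_hom_extensionality[OF _ \<delta>[OF g']]) (auto simp: precompose_def compose_def)
      with g' show "f \<in> ?B" by blast
    qed
  qed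
  finally show ?thesis .
qed

text \<open>Consecutive differentials compose to zero on pure tensors, hence everywhere, so
  boundaries are cycles and vanishing of \<open>Tor\<close> is the reverse inclusion.\<close>

lemma trivial_Tor_iff:
  assumes ch: "chosen_resolution (opp_ring R) D = (P, d, \<epsilon>)" and res: "projective_resolution (opp_ring R) D P d \<epsilon>"
    and M: "left_module R M"
  shows "trivial_group (Tor (Suc i) R D M) \<longleftrightarrow>
    tensor_exact_at R (P (Suc (Suc i))) (P (Suc i)) (P i) (d (Suc i)) (d i) M"
proof -
  note P = projective_resolutionD(2)[OF res]
  have d: "d i \<in> linear_maps R (P (Suc i)) (P i)" for i using projective_resolutionD(3)[OF res] by simp
  let ?T = "\<lambda>i. tensor R (P i) M" and ?\<delta> = "\<lambda>i. tensor_map R (P (Suc i)) M (P i) M (d i) (\<lambda>m. m)"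
  have tm: "tensor_map_pair R (P (Suc i)) M (P i) M (d i) (\<lambda>m. m)" for i
    by (intro tensor_map_pairI P M d linear_maps_id)
  interpret \<delta>: tensor_map_pair R "P (Suc i)" M "P i" M "d i" "\<lambda>m. m" by (rule tm)
  interpret \<delta>': tensor_map_pair R "P (Suc (Suc i))" M "P (Suc i)" M "d (Suc i)" "\<lambda>m. m" by (rule tm)
  have dd: "d i (d (Suc i) x) = \<zero>\<^bsub>P i\<^esub>" if "x \<in> carrier (P (Suc (Suc i)))" for x
    using projective_resolutionD(7)[OF res, of i] that by blast
  have z: "\<delta>.tm (\<delta>'.tm t) = \<zero>\<^bsub>?T i\<^esub>" if "t \<in> carrier (?T (Suc (Suc i)))" for t
    using that
  proof (induction rule: \<delta>'.src.tensor_induct)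
    case (pure p m) then show ?case
      by (simp add: \<delta>'.map_pure \<delta>.map_pure \<delta>'.fg_closed dd \<delta>.tgt.pure_zero_left)
  next
    case (add t u) then show ?case
      by (simp add: add_homs_add[OF \<delta>.map_add_homs] add_homs_add[OF \<delta>'.map_add_homs] \<delta>'.map_closed)
  qed
  let ?Z = "a_kernel (?T (Suc i)) (?T i) \<delta>.tm" and ?B = "\<delta>'.tm ` carrier (?T (Suc (Suc i)))"
  have "Tor (Suc i) R D M = subquotient (?T (Suc i)) ?Z ?B" by (simp add: Tor_def ch Let_def)
  moreover have "?B \<subseteq> ?Z" using z \<delta>'.map_closed by (auto simp: a_kernel_iff)
  ultimately have "trivial_group (Tor (Suc i) R D M) \<longleftrightarrow> ?Z \<subseteq> ?B"
    using trivial_group_subquotient[OF \<delta>.src.tensor_abelian_group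
        a_kernel_subgroup[OF \<delta>.src.tensor_abelian_group \<delta>.tgt.tensor_abelian_group \<delta>.map_add_homs]
        add_homs_image_subgroup[OF \<delta>'.src.tensor_abelian_group \<delta>.src.tensor_abelian_group \<delta>'.map_add_homs]] by simp
  also have "\<dots> \<longleftrightarrow> tensor_exact_at R (P (Suc (Suc i))) (P (Suc i)) (P i) (d (Suc i)) (d i) M"
    unfolding tensor_exact_at_def subset_iff a_kernel_iff by (simp only: imp_conjL Ball_def)
  finally show ?thesis .
qed

section \<open>Kernels in exact sequences\<close>

text \<open>Linearity of the lift can be tested after applying the injective map \<open>j\<close>,
  where it becomes linearity of \<open>h\<close>.\<close>

lemma linear_lift_inj:
  assumes K: "left_module R K" and X: "left_module R X" and B: "left_module R B"
    and j: "j \<in> linear_maps R K X" "inj_on j (carrier K)" and h: "h \<in> linear_maps R B X"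
    and im: "\<And>y. y \<in> carrier B \<Longrightarrow> h y \<in> j ` carrier K"
  shows "\<exists>w\<in>linear_maps R B K. \<forall>y\<in>carrier B. j (w y) = h y"
proof -
  interpret K: left_module R K by (rule K)
  interpret B: left_module R B by (rule B)
  define w where "w y = inv_into (carrier K) j (h y)" for y
  have w: "w y \<in> carrier K" "j (w y) = h y" if "y \<in> carrier B" for y
    using im[OF that] by (simp_all add: w_def inv_into_into f_inv_into_f)
  have eq: "x = y" if "x \<in> carrier K" "y \<in> carrier K" "j x = j y" for x y
    using inj_onD[OF j(2)] that by blast
  note jh = linear_mapsD[OF j(1)] and hh = linear_mapsD[OF h]
  have "w \<in> linear_maps R B K" unfolding linear_maps_def add_homs_def mem_Collect_eq
  proof (intro conjI ballI)
    fix x y assume "x \<in> carrier B" "y \<in> carrier B"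
    then show "w (x \<oplus>\<^bsub>B\<^esub> y) = w x \<oplus>\<^bsub>K\<^esub> w y"
      using w by (intro eq) (auto simp: add_homs_add[OF jh(1)] add_homs_add[OF hh(1)])
  next
    fix r x assume "r \<in> carrier R" "x \<in> carrier B"
    then show "w (r \<odot>\<^bsub>B\<^esub> x) = r \<odot>\<^bsub>K\<^esub> w x"
      using w by (intro eq) (auto simp: jh(2) hh(2) B.smult_closed K.smult_closed)
  qed (rule w)
  then show ?thesis using w(2) by blast
qed

text \<open>The value at q x is g x; the choice of x does not matter because differences of
  preimages lie in the kernel of \<open>q\<close>, where \<open>g\<close> vanishes.\<close>

lemma linear_factor_surj:
  assumes B: "left_module R B" and Q: "left_module R Q" and N: "left_module R N"
    and q: "q \<in> linear_maps R B Q" "q ` carrier B = carrier Q" and g: "g \<in> linear_maps R B N"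
    and ker: "\<And>x. \<lbrakk>x \<in> carrier B; q x = \<zero>\<^bsub>Q\<^esub>\<rbrakk> \<Longrightarrow> g x = \<zero>\<^bsub>N\<^esub>"
  shows "\<exists>h\<in>linear_maps R Q N. \<forall>x\<in>carrier B. h (q x) = g x"
proof -
  interpret B: left_module R B by (rule B)
  note ag = left_module_abelian_group[OF B] left_module_abelian_group[OF Q] left_module_abelian_group[OF N]
  note qh = linear_mapsD[OF q(1)] and gh = linear_mapsD[OF g]
  have eq: "g x = g y" if "x \<in> carrier B" "y \<in> carrier B" "q x = q y" for x y
    using that ker[of "x \<ominus>\<^bsub>B\<^esub> y"] add_homs_eq_iff[OF ag(1,2) qh(1)] add_homs_eq_iff[OF ag(1,3) gh(1)]
    by simp
  define h where "h z = g (inv_into (carrier B) q z)" for z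
  have h: "h (q x) = g x" if "x \<in> carrier B" for x
    unfolding h_def using that by (intro eq) (auto simp: inv_into_into f_inv_into_f)
  have "h \<in> linear_maps R Q N" unfolding linear_maps_def add_homs_def mem_Collect_eq q(2)[symmetric]
  proof (intro conjI ballI; elim imageE; hypsubst_thin)
    show "h (q x) \<in> carrier N" if "x \<in> carrier B" for x using that linear_maps_closed[OF g] by (simp add: h)
    show "h (q x \<oplus>\<^bsub>Q\<^esub> q y) = h (q x) \<oplus>\<^bsub>N\<^esub> h (q y)" if "x \<in> carrier B" "y \<in> carrier B" for x y
      using that by (simp add: h add_homs_add[OF gh(1)] flip: add_homs_add[OF qh(1)])
    show "h (r \<odot>\<^bsub>Q\<^esub> q x) = r \<odot>\<^bsub>N\<^esub> h (q x)" if "r \<in> carrier R" "x \<in> carrier B" for r x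
      using that by (simp add: h gh(2) B.smult_closed flip: qh(2))
  qed
  then show ?thesis using h by blast
qed

text \<open>Unlike in \<open>exact_sequence\<close>, the differentials need not be extensional: the
  maps \<open>compose (carrier C) (d i)\<close> between Hom modules are not.\<close>

definition linear_sequence ::
    "('r, 'x) ring_scheme \<Rightarrow> (int \<Rightarrow> ('r, 'm, 'z) module_scheme) \<Rightarrow> (int \<Rightarrow> 'm \<Rightarrow> 'm) \<Rightarrow> bool"
  where "linear_sequence R X d \<longleftrightarrow> (\<forall>i. left_module R (X i)) \<and>
    (\<forall>i. d i \<in> linear_maps R (X i) (X (i + 1))) \<and> exact_complex X d"

text \<open>The kernel is given only up to isomorphism, by an injection with the right image; in
  this form \<open>M\<close>, C \<otimes> M and Hom(C, N) can all be treated as kernels.\<close>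

definition kernel_embedding ::
    "('r, 'x) ring_scheme \<Rightarrow> (int \<Rightarrow> ('r, 'm, 'z) module_scheme) \<Rightarrow> (int \<Rightarrow> 'm \<Rightarrow> 'm) \<Rightarrow> int \<Rightarrow>
      ('r, 'k, 'w) module_scheme \<Rightarrow> ('k \<Rightarrow> 'm) \<Rightarrow> bool"
  where "kernel_embedding R X d n K j \<longleftrightarrow> left_module R K \<and> j \<in> linear_maps R K (X n) \<and>
    inj_on j (carrier K) \<and> j ` carrier K = {x \<in> carrier (X n). d n x = \<zero>\<^bsub>X (n + 1)\<^esub>}"

lemma linear_sequenceD:
  assumes "linear_sequence R X d"
  shows "left_module R (X i)" "d i \<in> linear_maps R (X i) (X (i + 1))"
    "\<lbrakk>x \<in> carrier (X (i + 1)); d (i + 1) x = \<zero>\<^bsub>X (i + 2)\<^esub>\<rbrakk> \<Longrightarrow> \<exists>y\<in>carrier (X i). x = d i y"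
    "y \<in> carrier (X i) \<Longrightarrow> d (i + 1) (d i y) = \<zero>\<^bsub>X (i + 2)\<^esub>"
proof -
  have ex: "d i ` carrier (X i) = {x \<in> carrier (X (i + 1)). d (i + 1) x = \<zero>\<^bsub>X (i + 2)\<^esub>}"
    using assms by (simp add: linear_sequence_def exact_complex_def exact_at_def a_kernel_def kernel_def)
  show "\<lbrakk>x \<in> carrier (X (i + 1)); d (i + 1) x = \<zero>\<^bsub>X (i + 2)\<^esub>\<rbrakk> \<Longrightarrow> \<exists>y\<in>carrier (X i). x = d i y"
    "y \<in> carrier (X i) \<Longrightarrow> d (i + 1) (d i y) = \<zero>\<^bsub>X (i + 2)\<^esub>"
    using ex by blast+
qed (use assms in \<open>simp_all add: linear_sequence_def\<close>)

lemma kernel_embeddingD: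
  assumes "kernel_embedding R X d n K j"
  shows "left_module R K" "j \<in> linear_maps R K (X n)" "inj_on j (carrier K)"
    "k \<in> carrier K \<Longrightarrow> d n (j k) = \<zero>\<^bsub>X (n + 1)\<^esub>"
    "\<lbrakk>x \<in> carrier (X n); d n x = \<zero>\<^bsub>X (n + 1)\<^esub>\<rbrakk> \<Longrightarrow> \<exists>k\<in>carrier K. x = j k"
  using assms unfolding kernel_embedding_def by blast+

text \<open>The kernel taken as a submodule has the type of the terms. The inductions on the degree,
  which pass from one kernel to a neighbouring one, can thus stay within a single type.\<close>

lemma ex_kernel_embedding:
  fixes X :: "int \<Rightarrow> ('r, 'm, 'z) module_scheme"
  assumes "linear_sequence R X d"
  shows "\<exists>K :: ('r, 'm, 'z) module_scheme. \<exists>j. kernel_embedding R X d n K j"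
proof (intro exI)
  note X = linear_sequenceD(1,2)[OF assms]
  let ?K = "kernel_module (X n) (X (n + 1)) (d n)"
  \<comment> \<open>Kernels were shown to be modules for extensional maps; restricting
    \<open>d n\<close> to the carrier does not change its kernel.\<close>
  have "left_module R (kernel_module (X n) (X (n + 1)) (restrict (d n) (carrier (X n))))"
    by (intro left_module_kernel_module X restrict_mod_hom)
  moreover have "kernel_module (X n) (X (n + 1)) (restrict (d n) (carrier (X n))) = ?K"
    by (simp add: kernel_module_def a_kernel_def kernel_def cong: conj_cong)
  ultimately show "kernel_embedding R X d n ?K (\<lambda>x. x)"
    unfolding kernel_embedding_def
    by (auto simp: kernel_module_def linear_maps_def add_homs_def a_kernel_def kernel_def)
qed

definition short_exact ::
    "('r, 'x) ring_scheme \<Rightarrow> ('r, 'k, 'u) module_scheme \<Rightarrow> ('r, 'm, 'v) module_scheme \<Rightarrow>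
      ('r, 'l, 'w) module_scheme \<Rightarrow> ('k \<Rightarrow> 'm) \<Rightarrow> ('m \<Rightarrow> 'l) \<Rightarrow> bool"
  where "short_exact R K X L j p \<longleftrightarrow> left_module R K \<and> left_module R X \<and> left_module R L \<and>
    j \<in> linear_maps R K X \<and> inj_on j (carrier K) \<and> p \<in> linear_maps R X L \<and> p ` carrier X = carrier L \<and>
    j ` carrier K = {x \<in> carrier X. p x = \<zero>\<^bsub>L\<^esub>}"

lemma short_exactD:
  assumes "short_exact R K X L j p"
  shows "left_module R K" "left_module R X" "left_module R L" "j \<in> linear_maps R K X"
    "inj_on j (carrier K)" "p \<in> linear_maps R X L" "p ` carrier X = carrier L"
    "\<lbrakk>x \<in> carrier X; p x = \<zero>\<^bsub>L\<^esub>\<rbrakk> \<Longrightarrow> x \<in> j ` carrier K"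
    "k \<in> carrier K \<Longrightarrow> p (j k) = \<zero>\<^bsub>L\<^esub>"
  using assms unfolding short_exact_def by blast+

text \<open>The map \<open>p\<close> is \<open>d n\<close> with its target cut down to the next
  kernel; exactness of \<open>X\<close> at \<open>n + 1\<close> makes it surjective.\<close>

lemma short_exact_kernels:
  assumes X: "linear_sequence R X d" and K: "kernel_embedding R X d n K j"
    and L: "kernel_embedding R X d (n + 1) L j'"
  obtains p where "short_exact R K (X n) L j p" "\<And>x. x \<in> carrier (X n) \<Longrightarrow> j' (p x) = d n x"
proof -
  note X = linear_sequenceD[OF X] and K = kernel_embeddingD[OF K] and L = kernel_embeddingD[OF L]
  interpret L: left_module R L by (rule L(1))
  note ag = left_module_abelian_group[OF L(1)] left_module_abelian_group[OF X(1)]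
  have d_im: "d n x \<in> j' ` carrier L" if "x \<in> carrier (X n)" for x
    using L(5)[of "d n x"] X(4)[OF that] linear_maps_closed[OF X(2) that] by (auto simp: add.assoc)
  obtain p where p: "p \<in> linear_maps R (X n) L" "\<And>x. x \<in> carrier (X n) \<Longrightarrow> j' (p x) = d n x"
    using linear_lift_inj[OF L(1) X(1) X(1) L(2,3) X(2) d_im] by blast
  have j0: "j' \<zero>\<^bsub>L\<^esub> = \<zero>\<^bsub>X (n + 1)\<^esub>" by (rule add_homs_zero[OF ag linear_mapsD(1)[OF L(2)]])
  have p0: "p x = \<zero>\<^bsub>L\<^esub> \<longleftrightarrow> d n x = \<zero>\<^bsub>X (n + 1)\<^esub>" if "x \<in> carrier (X n)" for x
    using p(2)[OF that] j0 inj_onD[OF L(3), of "p x" "\<zero>\<^bsub>L\<^esub>"] linear_maps_closed[OF p(1) that] by auto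
  have "p ` carrier (X n) = carrier L"
  proof
    show "p ` carrier (X n) \<subseteq> carrier L" using linear_maps_closed[OF p(1)] by blast
    show "carrier L \<subseteq> p ` carrier (X n)"
    proof
      fix l assume l: "l \<in> carrier L"
      obtain x where x: "x \<in> carrier (X n)" "j' l = d n x"
        using X(3)[of "j' l" n] L(4)[OF l] linear_maps_closed[OF L(2) l] by (auto simp: add.assoc)
      then have "l = p x"
        using inj_onD[OF L(3)] l p(2)[OF x(1)] linear_maps_closed[OF p(1) x(1)] by simp
      then show "l \<in> p ` carrier (X n)" using x(1) by blast
    qed
  qed
  moreover have "j ` carrier K = {x \<in> carrier (X n). p x = \<zero>\<^bsub>L\<^esub>}"
    using K(4,5) p0 linear_maps_closed[OF K(2)] by auto
  ultimately have "short_exact R K (X n) L j p"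
    unfolding short_exact_def using K(1-3) X(1) L(1) p(1) by blast
  then show ?thesis using that p(2) by blast
qed

section \<open>Ext of kernels\<close>

text \<open>After \<open>j\<close> the cocycle \<open>f\<close> becomes a coboundary, j f = u a.
  Correcting \<open>u\<close> by v b moves it into the kernel of \<open>p\<close>, that is, into the
  image of \<open>j\<close>, and changes nothing after \<open>a\<close> because b a = 0. The map
  \<open>b\<close> may be a differential or the augmentation onto \<open>C\<close>, so that degree 1
  and higher degrees are treated alike.\<close>

lemma Ext_chase:
  assumes se: "short_exact R K X L j p"
    and A: "left_module R A" and B: "left_module R B" and E: "left_module R E"
    and a: "a \<in> linear_maps R A B" and b: "b \<in> linear_maps R B E"
    and ba: "\<And>x. x \<in> carrier A \<Longrightarrow> b (a x) = \<zero>\<^bsub>E\<^esub>"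
    and f: "f \<in> linear_maps R A K" and u: "u \<in> linear_maps R B X" and v: "v \<in> linear_maps R E X"
    and fu: "\<And>x. x \<in> carrier A \<Longrightarrow> j (f x) = u (a x)"
    and uv: "\<And>y. y \<in> carrier B \<Longrightarrow> p (u y) = p (v (b y))"
  shows "\<exists>w\<in>linear_maps R B K. \<forall>x\<in>carrier A. f x = w (a x)"
proof -
  note se = short_exactD[OF se]
  interpret X: left_module R X by (rule se(2))
  note ag = left_module_abelian_group[OF se(2)] left_module_abelian_group[OF se(3)] left_module_abelian_group[OF E]
  have h: "(\<lambda>y. u y \<ominus>\<^bsub>X\<^esub> v (b y)) \<in> linear_maps R B X"
    by (rule linear_maps_minus[OF se(2) u linear_maps_comp[OF b v]])
  have "u y \<ominus>\<^bsub>X\<^esub> v (b y) \<in> j ` carrier K" if "y \<in> carrier B" for y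
    using se(8)[OF linear_maps_closed[OF h that]] uv[OF that] linear_maps_closed[OF u that]
      linear_maps_closed[OF v linear_maps_closed[OF b that]]
      add_homs_eq_iff[OF ag(1,2) linear_mapsD(1)[OF se(6)]] by simp
  then obtain w where w: "w \<in> linear_maps R B K" "\<And>y. y \<in> carrier B \<Longrightarrow> j (w y) = u y \<ominus>\<^bsub>X\<^esub> v (b y)"
    using linear_lift_inj[OF se(1,2) B se(4,5) h] by blast
  have "f x = w (a x)" if x: "x \<in> carrier A" for x
  proof -
    have "j (w (a x)) = u (a x) \<ominus>\<^bsub>X\<^esub> v \<zero>\<^bsub>E\<^esub>" using w(2) linear_maps_closed[OF a x] ba[OF x] by simp
    also have "\<dots> = j (f x)"
      using add_homs_zero[OF ag(3,1) linear_mapsD(1)[OF v]] fu[OF x]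
        linear_maps_closed[OF u linear_maps_closed[OF a x]] by (simp add: a_minus_def)
    finally show ?thesis
      using inj_onD[OF se(5)] linear_maps_closed[OF w(1) linear_maps_closed[OF a x]] linear_maps_closed[OF f x] by simp
  qed
  then show ?thesis using w(1) by blast
qed

lemma projective_lift_linear:
  assumes P: "projective R P" and M: "left_module R M" and N: "left_module R N"
    and g: "g \<in> linear_maps R M N" "g ` carrier M = carrier N" and f: "f \<in> linear_maps R P N"
  shows "\<exists>h\<in>linear_maps R P M. \<forall>x\<in>carrier P. g (h x) = f x"
proof -
  have LP: "left_module R P" using P by (simp add: projective_def)
  have "restrict g (carrier M) ` carrier M = carrier N" using g(2) by auto
  then obtain h where "h \<in> mod_hom R P M"
    "\<forall>x\<in>carrier P. restrict g (carrier M) (h x) = restrict f (carrier P) x"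
    using projective_lifting[OF P M N restrict_mod_hom[OF M g(1)] _ restrict_mod_hom[OF LP f]] by blast
  moreover from this have "h x \<in> carrier M" if "x \<in> carrier P" for x
    using linear_maps_closed[OF mod_hom_linear that] by blast
  ultimately show ?thesis by (intro bexI[of _ h]) (auto simp: mod_hom_linear)
qed

lemma hom_exact_atD:
  assumes "hom_exact_at R P Q L a b N" "f \<in> linear_maps R Q N" "\<forall>x\<in>carrier P. f (a x) = \<zero>\<^bsub>N\<^esub>"
  shows "\<exists>g\<in>linear_maps R L N. \<forall>x\<in>carrier Q. f x = g (b x)"
  using assms by (simp add: hom_exact_at_def)

text \<open>For k at least 1, Ext in degree k + 1 of the kernel at \<open>n\<close> vanishes because
  Ext in degree k of the kernel at \<open>n + 1\<close> does; hence the induction on the degree for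
  all \<open>n\<close> at once. Degree 1 rests on \<open>hom_ex\<close>, the exactness of Hom(C,
  X).\<close>

lemma Ext_kernel_trivial:
  fixes X :: "int \<Rightarrow> ('s, 'm, 'z) module_scheme" and K :: "('s, 'm, 'z) module_scheme"
  assumes C: "left_module S C" and X: "linear_sequence S X d"
    and hom_ex: "\<And>n h. \<lbrakk>h \<in> linear_maps S C (X (n + 1)); \<And>c. c \<in> carrier C \<Longrightarrow> d (n + 1) (h c) = \<zero>\<^bsub>X (n + 2)\<^esub>\<rbrakk> \<Longrightarrow>
      \<exists>g\<in>linear_maps S C (X n). \<forall>c\<in>carrier C. h c = d n (g c)"
    and ext: "\<And>n i. trivial_group (Ext (Suc i) S C (X n))"
    and K: "kernel_embedding S X d n K j"
  shows "trivial_group (Ext (Suc i) S C K)"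
proof -
  obtain P \<delta> \<epsilon> where ch: "chosen_resolution S C = (P, \<delta>, \<epsilon>)" and res: "projective_resolution S C P \<delta> \<epsilon>"
    by (rule ex_chosen_resolution[OF C])
  note iff = trivial_Ext_iff[OF ch res] and P = projective_resolutionD[OF res]
  have \<delta>0: "\<epsilon> (\<delta> 0 x) = \<zero>\<^bsub>C\<^esub>" if "x \<in> carrier (P (Suc 0))" for x using P(6) that by blast
  have \<delta>\<delta>: "\<delta> i (\<delta> (Suc i) x) = \<zero>\<^bsub>P i\<^esub>" if "x \<in> carrier (P (Suc (Suc i)))" for i x using P(7)[of i] that by blast
  show ?thesis using K
  proof (induction i arbitrary: n K j)
    case (0 n K j)
    obtain L :: "('s, 'm, 'z) module_scheme" and j' where L: "kernel_embedding S X d (n + 1) L j'"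
      using ex_kernel_embedding[OF X] by blast
    obtain p where se: "short_exact S K (X n) L j p" and p: "\<And>x. x \<in> carrier (X n) \<Longrightarrow> j' (p x) = d n x"
      by (rule short_exact_kernels[OF X 0 L]) (rule that)
    note se' = short_exactD[OF se] and L = kernel_embeddingD[OF L]
    show ?case unfolding iff[OF se'(1)] hom_exact_at_def
    proof (intro ballI impI)
      fix f assume f: "f \<in> linear_maps S (P (Suc 0)) K" "\<forall>x\<in>carrier (P (Suc (Suc 0))). f (\<delta> (Suc 0) x) = \<zero>\<^bsub>K\<^esub>"
      have jf: "\<forall>x\<in>carrier (P (Suc (Suc 0))). j (f (\<delta> (Suc 0) x)) = \<zero>\<^bsub>X n\<^esub>"
        using f(2) add_homs_zero[OF left_module_abelian_group[OF se'(1)] left_module_abelian_group[OF se'(2)] linear_mapsD(1)[OF se'(4)]]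
        by simp
      obtain u where u: "u \<in> linear_maps S (P 0) (X n)" "\<And>x. x \<in> carrier (P (Suc 0)) \<Longrightarrow> j (f x) = u (\<delta> 0 x)"
        using hom_exact_atD[OF ext[of 0 n, unfolded iff[OF se'(2)]] linear_maps_comp[OF f(1) se'(4)], OF jf] by blast
      \<comment> \<open>The kernel of \<open>\<epsilon>\<close> is the image of
        \<open>\<delta> 0\<close>, where p u equals p j f = 0; so p u descends to a map
        \<open>g\<close> from \<open>C\<close> to \<open>L\<close>.\<close>
      have "p (u y) = \<zero>\<^bsub>L\<^esub>" if y: "y \<in> carrier (P 0)" "\<epsilon> y = \<zero>\<^bsub>C\<^esub>" for y
      proof -
        obtain x where "x \<in> carrier (P (Suc 0))" "y = \<delta> 0 x" using P(6) y by blast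
        then show ?thesis using u(2) se'(9) linear_maps_closed[OF f(1)] by metis
      qed
      then obtain g where g: "g \<in> linear_maps S C L" "\<And>y. y \<in> carrier (P 0) \<Longrightarrow> g (\<epsilon> y) = p (u y)"
        using linear_factor_surj[OF P(2) C se'(3) P(4,5) linear_maps_comp[OF u(1) se'(6)]] by blast
      \<comment> \<open>Composed with the embedding of \<open>L\<close> into
        \<open>X (n + 1)\<close>, \<open>g\<close> is a cycle of Hom(C, X); a preimage
        \<open>v\<close> of it lifts \<open>g\<close> along \<open>p\<close>.\<close>
      obtain v where v: "v \<in> linear_maps S C (X n)" "\<And>c. c \<in> carrier C \<Longrightarrow> j' (g c) = d n (v c)"
        using hom_ex[OF linear_maps_comp[OF g(1) L(2)]] L(4)[OF linear_maps_closed[OF g(1)]]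
        by (auto simp: add.assoc)
      have pv: "p (v c) = g c" if "c \<in> carrier C" for c
        using inj_onD[OF L(3)] v(2)[OF that] p[OF linear_maps_closed[OF v(1) that]]
          linear_maps_closed[OF g(1) that] linear_maps_closed[OF se'(6) linear_maps_closed[OF v(1) that]] by simp
      show "\<exists>g\<in>linear_maps S (P 0) K. \<forall>x\<in>carrier (P (Suc 0)). f x = g (\<delta> 0 x)"
        by (rule Ext_chase[OF se P(2,2) C P(3,4) _ f(1) u(1) v(1)])
          (use \<delta>0 u(2) g(2) pv linear_maps_closed[OF P(4)] in auto)
    qed
  next
    case (Suc i n K j)
    obtain L :: "('s, 'm, 'z) module_scheme" and j' where L: "kernel_embedding S X d (n + 1) L j'"
      using ex_kernel_embedding[OF X] by blast
    obtain p where se: "short_exact S K (X n) L j p"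
      by (rule short_exact_kernels[OF X Suc.prems L]) (rule that)
    note se' = short_exactD[OF se]
    show ?case unfolding iff[OF se'(1)] hom_exact_at_def
    proof (intro ballI impI)
      fix f assume f: "f \<in> linear_maps S (P (Suc (Suc i))) K"
        "\<forall>x\<in>carrier (P (Suc (Suc (Suc i)))). f (\<delta> (Suc (Suc i)) x) = \<zero>\<^bsub>K\<^esub>"
      have jf: "\<forall>x\<in>carrier (P (Suc (Suc (Suc i)))). j (f (\<delta> (Suc (Suc i)) x)) = \<zero>\<^bsub>X n\<^esub>"
        using f(2) add_homs_zero[OF left_module_abelian_group[OF se'(1)] left_module_abelian_group[OF se'(2)] linear_mapsD(1)[OF se'(4)]]
        by simp
      obtain u where u: "u \<in> linear_maps S (P (Suc i)) (X n)"
        "\<And>x. x \<in> carrier (P (Suc (Suc i))) \<Longrightarrow> j (f x) = u (\<delta> (Suc i) x)"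
        using hom_exact_atD[OF ext[of "Suc i" n, unfolded iff[OF se'(2)]] linear_maps_comp[OF f(1) se'(4)], OF jf] by blast
      \<comment> \<open>p u is a cocycle with values in \<open>L\<close>, one degree lower, where
        the induction hypothesis applies.\<close>
      have pu: "\<forall>x\<in>carrier (P (Suc (Suc i))). p (u (\<delta> (Suc i) x)) = \<zero>\<^bsub>L\<^esub>"
        using se'(9)[OF linear_maps_closed[OF f(1)]] by (simp flip: u(2))
      obtain g where g: "g \<in> linear_maps S (P i) L" "\<And>y. y \<in> carrier (P (Suc i)) \<Longrightarrow> p (u y) = g (\<delta> i y)"
        using hom_exact_atD[OF Suc.IH[OF L, unfolded iff[OF se'(3)]] linear_maps_comp[OF u(1) se'(6)], OF pu] by blast
      \<comment> \<open>Projectivity of \<open>P i\<close> lifts \<open>g\<close>; in degree 1 the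
        source was \<open>C\<close> and the lift had to come from \<open>hom_ex\<close>.\<close>
      obtain v where v: "v \<in> linear_maps S (P i) (X n)" "\<And>y. y \<in> carrier (P i) \<Longrightarrow> p (v y) = g y"
        using projective_lift_linear[OF P(1) se'(2,3,6,7) g(1)] by blast
      show "\<exists>g\<in>linear_maps S (P (Suc i)) K. \<forall>x\<in>carrier (P (Suc (Suc i))). f x = g (\<delta> (Suc i) x)"
        by (rule Ext_chase[OF se P(2,2,2) P(3,3) _ f(1) u(1) v(1)])
          (use \<delta>\<delta> u(2) g(2) v(2) linear_maps_closed[OF P(3)] in auto)
    qed
  qed
qed

section \<open>Tor of kernels\<close>

text \<open>Lift a cycle z of B \<otimes> L to y in B \<otimes> X. Its boundary comes from some w in
  D \<otimes> K, and \<open>inj\<close> makes w a cycle, so exactness for \<open>K\<close> gives w =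
  b v. Then y - j v is a cycle of B \<otimes> X, hence a boundary, and still lies over z.
  \<open>E\<close> may be a term of the resolution or the resolved module itself, with
  \<open>e\<close> the augmentation.\<close>

lemma Tor_chase:
  assumes se: "short_exact R K X L j p"
    and A: "left_module (opp_ring R) A" and B: "left_module (opp_ring R) B"
    and D: "left_module (opp_ring R) D" and E: "left_module (opp_ring R) E"
    and a: "a \<in> linear_maps R A B" and b: "b \<in> linear_maps R B D" and e: "e \<in> linear_maps R D E"
    and eb: "\<And>x. x \<in> carrier B \<Longrightarrow> e (b x) = \<zero>\<^bsub>E\<^esub>"
    and exX: "tensor_exact_at R A B D a b X" and exK: "tensor_exact_at R B D E b e K"
    and inj: "\<And>t. \<lbrakk>t \<in> carrier (tensor R E K); tensor_map R E K E X (\<lambda>x. x) j t = \<zero>\<^bsub>tensor R E X\<^esub>\<rbrakk> \<Longrightarrow>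
      t = \<zero>\<^bsub>tensor R E K\<^esub>"
  shows "tensor_exact_at R A B D a b L"
  unfolding tensor_exact_at_def
proof (intro ballI impI)
  note se' = short_exactD[OF se]
  have pr: "tensor_map_pair R Q N Q' N' f g"
    if "left_module (opp_ring R) Q" "left_module (opp_ring R) Q'" "left_module R N" "left_module R N'"
      "f \<in> linear_maps R Q Q'" "g \<in> linear_maps R N N'" for Q Q' N N' f g
    by (intro tensor_map_pairI that)
  note id = linear_maps_id[of R]
  note tp = tensor_pair.tensor_abelian_group[OF tensor_pairI]
  let ?jB = "tensor_map R B K B X (\<lambda>x. x) j" and ?jD = "tensor_map R D K D X (\<lambda>x. x) j"
    and ?jE = "tensor_map R E K E X (\<lambda>x. x) j"
    and ?pA = "tensor_map R A X A L (\<lambda>x. x) p" and ?pB = "tensor_map R B X B L (\<lambda>x. x) p"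
    and ?pD = "tensor_map R D X D L (\<lambda>x. x) p"
    and ?aX = "tensor_map R A X B X a (\<lambda>x. x)" and ?aL = "tensor_map R A L B L a (\<lambda>x. x)"
    and ?bX = "tensor_map R B X D X b (\<lambda>x. x)" and ?bL = "tensor_map R B L D L b (\<lambda>x. x)"
    and ?bK = "tensor_map R B K D K b (\<lambda>x. x)"
    and ?eK = "tensor_map R D K E K e (\<lambda>x. x)" and ?eX = "tensor_map R D X E X e (\<lambda>x. x)"
  note pairs = pr[OF B B se'(1,2) id se'(4)] pr[OF D D se'(1,2) id se'(4)] pr[OF E E se'(1,2) id se'(4)]
    pr[OF A A se'(2,3) id se'(6)] pr[OF B B se'(2,3) id se'(6)] pr[OF D D se'(2,3) id se'(6)]
    pr[OF A B se'(2,2) a id] pr[OF A B se'(3,3) a id] pr[OF B D se'(2,2) b id] pr[OF B D se'(3,3) b id]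
    pr[OF B D se'(1,1) b id] pr[OF D E se'(1,1) e id] pr[OF D E se'(2,2) e id]
  note cl = pairs[THEN tensor_map_pair.map_closed] and hom = pairs[THEN tensor_map_pair.map_add_homs]
  fix z assume z: "z \<in> carrier (tensor R B L)" "?bL z = \<zero>\<^bsub>tensor R D L\<^esub>"
  have "z \<in> ?pB ` carrier (tensor R B X)"
    using tensor_map_pair.map_surj[OF pairs(5) _ se'(7)] z(1) by simp
  then obtain y where y: "y \<in> carrier (tensor R B X)" "z = ?pB y" by blast
  have "?pD (?bX y) = ?bL (?pB y)"
    using tensor_map_comp[OF pairs(9) pairs(6) pr[OF B D se'(2,3) b se'(6)] y(1)]
      tensor_map_comp[OF pairs(5) pairs(10) pr[OF B D se'(2,3) b se'(6)] y(1)] by simp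
  then have "?bX y \<in> ?jD ` carrier (tensor R D K)"
    using z(2) y cl(9)[OF y(1)]
    by (intro tensor_right_exact_right[OF D se'(1-3) se'(4) se'(6,7) se'(8)]) simp_all
  then obtain w where w: "w \<in> carrier (tensor R D K)" "?bX y = ?jD w" by blast
  \<comment> \<open>In E \<otimes> X the boundary of w becomes e b applied to y, which vanishes;
    \<open>inj\<close> brings this back to E \<otimes> K.\<close>
  have "?jE (?eK w) = ?eX (?jD w)"
    using tensor_map_comp[OF pairs(12) pairs(3) pr[OF D E se'(1,2) e se'(4)] w(1)]
      tensor_map_comp[OF pairs(2) pairs(13) pr[OF D E se'(1,2) e se'(4)] w(1)] by simp
  also have "\<dots> = \<zero>\<^bsub>tensor R E X\<^esub>" unfolding w(2)[symmetric] using y(1)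
  proof (induction rule: tensor_pair.tensor_induct[OF tensor_pairI[OF B se'(2)], consumes 1, case_names pure add])
    case (pure x m) then show ?case
      using tensor_pair.pure_zero_left[OF tensor_pairI[OF E se'(2)]] linear_maps_closed[OF b] eb
      by (simp add: tensor_map_pair.map_pure[OF pairs(9)] tensor_map_pair.map_pure[OF pairs(13)])
  next
    case (add t u)
    interpret T: abelian_group "tensor R E X" by (rule tp[OF E se'(2)])
    from add show ?case by (simp add: add_homs_add[OF hom(9)] add_homs_add[OF hom(13)] cl(9))
  qed
  finally have "?eK w = \<zero>\<^bsub>tensor R E K\<^esub>" by (rule inj[OF cl(12)[OF w(1)]])
  then obtain v where v: "v \<in> carrier (tensor R B K)" "w = ?bK v"
    using exK w(1) unfolding tensor_exact_at_def by blast
  interpret TBX: abelian_group "tensor R B X" by (rule tp[OF B se'(2)])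
  interpret TBL: abelian_group "tensor R B L" by (rule tp[OF B se'(3)])
  have "?bX (?jB v) = ?jD (?bK v)"
    using tensor_map_comp[OF pairs(1) pairs(9) pr[OF B D se'(1,2) b se'(4)] v(1)]
      tensor_map_comp[OF pairs(11) pairs(2) pr[OF B D se'(1,2) b se'(4)] v(1)] by simp
  then have "?bX (y \<ominus>\<^bsub>tensor R B X\<^esub> ?jB v) = \<zero>\<^bsub>tensor R D X\<^esub>"
    using add_homs_eq_iff[OF tp[OF B se'(2)] tp[OF D se'(2)] hom(9) y(1) cl(1)[OF v(1)]] w(2) v(2) by simp
  then obtain u where u: "u \<in> carrier (tensor R A X)" "y \<ominus>\<^bsub>tensor R B X\<^esub> ?jB v = ?aX u"
    using exX y(1) cl(1)[OF v(1)] unfolding tensor_exact_at_def by (meson TBX.minus_closed imageE)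
  have "?pB (?jB v) = \<zero>\<^bsub>tensor R B L\<^esub>"
    using tensor_map_comp[OF pairs(1) pairs(5) pr[OF B B se'(1,3) id linear_maps_comp[OF se'(4,6)]] v(1)]
      tensor_map_pair.map_trivial[OF pr[OF B B se'(1,3) id linear_maps_comp[OF se'(4,6)]] se'(9) v(1)] by simp
  then have "z = ?pB (?aX u)"
    using add_homs_minus[OF tp[OF B se'(2)] tp[OF B se'(3)] hom(5) y(1) cl(1)[OF v(1)]] u(2) y cl(5)[OF y(1)]
    by (simp add: a_minus_def)
  also have "\<dots> = ?aL (?pA u)"
    using tensor_map_comp[OF pairs(7) pairs(5) pr[OF A B se'(2,3) a se'(6)] u(1)]
      tensor_map_comp[OF pairs(4) pairs(8) pr[OF A B se'(2,3) a se'(6)] u(1)] by simp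
  finally show "z \<in> ?aL ` carrier (tensor R A L)" using cl(4)[OF u(1)] by blast
qed

text \<open>As \<open>X\<^bsub>n+1\<^esub>\<close> maps onto \<open>K\<close> with kernel the image of \<open>X\<^sub>n\<close>, exactness of \<open>Q \<otimes> X\<close> at
  \<open>Q \<otimes> X\<^bsub>n+1\<^esub>\<close> makes \<open>Q \<otimes> K \<rightarrow> Q \<otimes> X\<^bsub>n+2\<^esub>\<close> injective.\<close>

lemma tensor_kernel_injective_aux:
  fixes X :: "int \<Rightarrow> ('r, 'm, 'z) module_scheme"
  assumes Q: "left_module (opp_ring R) Q" and X: "linear_sequence R X d"
    and ex: "exact_complex (\<lambda>i. tensor R Q (X i)) (\<lambda>i. tensor_map R Q (X i) Q (X (i + 1)) (\<lambda>q. q) (d i))"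
    and K: "kernel_embedding R X d (n + 2) K j"
    and t: "t \<in> carrier (tensor R Q K)" "tensor_map R Q K Q (X (n + 2)) (\<lambda>q. q) j t = \<zero>\<^bsub>tensor R Q (X (n + 2))\<^esub>"
  shows "t = \<zero>\<^bsub>tensor R Q K\<^esub>"
proof -
  obtain K' :: "('r, 'm, 'z) module_scheme" and j' where K': "kernel_embedding R X d (n + 1) K' j'"
    using ex_kernel_embedding[OF X] by blast
  have K2: "kernel_embedding R X d (n + 1 + 1) K j" using K by (simp add: add.assoc)
  obtain p where se: "short_exact R K' (X (n + 1)) K j' p"
    and p: "\<And>x. x \<in> carrier (X (n + 1)) \<Longrightarrow> j (p x) = d (n + 1) x"
    by (rule short_exact_kernels[OF X K' K2]) (rule that)
  note se = short_exactD[OF se] and X = linear_sequenceD[OF X] and K = kernel_embeddingD[OF K]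
  have d1: "d (n + 1) \<in> linear_maps R (X (n + 1)) (X (n + 2))" using X(2)[of "n + 1"] by (simp add: add.assoc)
  have pr: "tensor_map_pair R Q N Q N' (\<lambda>q. q) g"
    if "left_module R N" "left_module R N'" "g \<in> linear_maps R N N'" for N N' g
    by (intro tensor_map_pairI that Q linear_maps_id)
  note pp = pr[OF X(1) K(1) se(6)] and pj = pr[OF K(1) X(1) K(2)] and pd = pr[OF X(1,1) X(2)]
    and pd1 = pr[OF X(1,1) d1]
  have "t \<in> tensor_map R Q (X (n + 1)) Q K (\<lambda>q. q) p ` carrier (tensor R Q (X (n + 1)))"
    using tensor_map_pair.map_surj[OF pp _ se(7)] t(1) by simp
  then obtain s where s: "s \<in> carrier (tensor R Q (X (n + 1)))" "t = tensor_map R Q (X (n + 1)) Q K (\<lambda>q. q) p s"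
    by blast
  have "tensor_map R Q (X (n + 1)) Q (X (n + 2)) (\<lambda>q. q) (d (n + 1)) s = \<zero>\<^bsub>tensor R Q (X (n + 2))\<^esub>"
    using tensor_map_comp[OF pp pj pd1 s(1)] t(2) s(2) p by simp
  moreover have "tensor_map R Q (X n) Q (X (n + 1)) (\<lambda>q. q) (d n) ` carrier (tensor R Q (X n)) =
      a_kernel (tensor R Q (X (n + 1))) (tensor R Q (X (n + 2)))
        (tensor_map R Q (X (n + 1)) Q (X (n + 2)) (\<lambda>q. q) (d (n + 1)))"
    using ex unfolding exact_complex_def exact_at_def by (simp add: add.assoc)
  ultimately have "s \<in> tensor_map R Q (X n) Q (X (n + 1)) (\<lambda>q. q) (d n) ` carrier (tensor R Q (X n))"
    using s(1) by (simp add: a_kernel_iff)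
  then obtain r where r: "r \<in> carrier (tensor R Q (X n))" "s = tensor_map R Q (X n) Q (X (n + 1)) (\<lambda>q. q) (d n) r"
    by blast
  have pd0: "p (d n x) = \<zero>\<^bsub>K\<^esub>" if x: "x \<in> carrier (X n)" for x
  proof (rule inj_onD[OF K(3)])
    show "j (p (d n x)) = j \<zero>\<^bsub>K\<^esub>"
      using p[OF linear_maps_closed[OF X(2) x]] X(4)[OF x]
        add_homs_zero[OF left_module_abelian_group[OF K(1)] left_module_abelian_group[OF X(1)] linear_mapsD(1)[OF K(2)]]
      by simp
  qed (use linear_maps_closed[OF se(6) linear_maps_closed[OF X(2) x]]
      abelian_monoid.zero_closed[OF abelian_group.axioms(1)[OF left_module_abelian_group[OF K(1)]]] in simp_all)
  \<comment> \<open>As t is the image of s and s that of r, t is the image of r under Q \<otimes> (p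
    d), which is zero.\<close>
  have "t = tensor_map R Q (X n) Q K (\<lambda>q. q) (\<lambda>x. p (d n x)) r"
    using tensor_map_comp[OF pd pp pr[OF X(1) K(1) linear_maps_comp[OF X(2) se(6)]] r(1)] s(2) r(2) by simp
  also have "\<dots> = \<zero>\<^bsub>tensor R Q K\<^esub>"
    by (rule tensor_map_pair.map_trivial[OF pr[OF X(1) K(1) linear_maps_comp[OF X(2) se(6)]] pd0 r(1)])
  finally show ?thesis .
qed

text \<open>Reindexed to put the kernel at \<open>n\<close>; every \<open>n\<close> is reached
  because the sequence is unbounded to the left.\<close>

lemmas tensor_kernel_injective = tensor_kernel_injective_aux[of _ _ _ _ "n - 2" for n, simplified]

text \<open>Right exactness identifies the image with the kernel of the map from Q \<otimes> X to Q
  \<otimes> L, for \<open>L\<close> the next kernel. As Q \<otimes> L injects into the next term,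
  this is the kernel of the differential.\<close>

lemma tensor_kernel_exact:
  fixes X :: "int \<Rightarrow> ('r, 'm, 'z) module_scheme"
  assumes Q: "left_module (opp_ring R) Q" and X: "linear_sequence R X d"
    and ex: "exact_complex (\<lambda>i. tensor R Q (X i)) (\<lambda>i. tensor_map R Q (X i) Q (X (i + 1)) (\<lambda>q. q) (d i))"
    and K: "kernel_embedding R X d n K j"
  shows "tensor_map R Q K Q (X n) (\<lambda>q. q) j ` carrier (tensor R Q K) =
    {s \<in> carrier (tensor R Q (X n)).
      tensor_map R Q (X n) Q (X (n + 1)) (\<lambda>q. q) (d n) s = \<zero>\<^bsub>tensor R Q (X (n + 1))\<^esub>}"
proof -
  obtain L :: "('r, 'm, 'z) module_scheme" and j' where L: "kernel_embedding R X d (n + 1) L j'"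
    using ex_kernel_embedding[OF X] by blast
  obtain p where se: "short_exact R K (X n) L j p"
    and p: "\<And>x. x \<in> carrier (X n) \<Longrightarrow> j' (p x) = d n x"
    by (rule short_exact_kernels[OF X K L]) (rule that)
  note inj = tensor_kernel_injective[OF Q X ex L]
  note se = short_exactD[OF se] and X = linear_sequenceD[OF X] and K = kernel_embeddingD[OF K]
    and L = kernel_embeddingD[OF L]
  have pr: "tensor_map_pair R Q N Q N' (\<lambda>q. q) g"
    if "left_module R N" "left_module R N'" "g \<in> linear_maps R N N'" for N N' g
    by (intro tensor_map_pairI that Q linear_maps_id)
  note pp = pr[OF X(1) L(1) se(6)] and pj = pr[OF K(1) X(1) K(2)] and pj' = pr[OF L(1) X(1) L(2)]
    and pd = pr[OF X(1,1) X(2)]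
  show ?thesis
  proof (intro equalityI subsetI)
    fix s assume "s \<in> tensor_map R Q K Q (X n) (\<lambda>q. q) j ` carrier (tensor R Q K)"
    then obtain t where t: "t \<in> carrier (tensor R Q K)" "s = tensor_map R Q K Q (X n) (\<lambda>q. q) j t" by blast
    have "tensor_map R Q (X n) Q (X (n + 1)) (\<lambda>q. q) (d n) s = tensor_map R Q K Q (X (n + 1)) (\<lambda>q. q) (\<lambda>x. d n (j x)) t"
      using tensor_map_comp[OF pj pd pr[OF K(1) X(1) linear_maps_comp[OF K(2) X(2)]] t(1)] t(2) by simp
    also have "\<dots> = \<zero>\<^bsub>tensor R Q (X (n + 1))\<^esub>"
      by (rule tensor_map_pair.map_trivial[OF pr[OF K(1) X(1) linear_maps_comp[OF K(2) X(2)]] K(4) t(1)])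
    finally show "s \<in> {s \<in> carrier (tensor R Q (X n)).
        tensor_map R Q (X n) Q (X (n + 1)) (\<lambda>q. q) (d n) s = \<zero>\<^bsub>tensor R Q (X (n + 1))\<^esub>}"
      using tensor_map_pair.map_closed[OF pj t(1)] t(2) by simp
  next
    fix s assume "s \<in> {s \<in> carrier (tensor R Q (X n)).
        tensor_map R Q (X n) Q (X (n + 1)) (\<lambda>q. q) (d n) s = \<zero>\<^bsub>tensor R Q (X (n + 1))\<^esub>}"
    then have s: "s \<in> carrier (tensor R Q (X n))"
      "tensor_map R Q (X n) Q (X (n + 1)) (\<lambda>q. q) (d n) s = \<zero>\<^bsub>tensor R Q (X (n + 1))\<^esub>" by simp_all
    have "tensor_map R Q (X n) Q L (\<lambda>q. q) p s = \<zero>\<^bsub>tensor R Q L\<^esub>"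
      using tensor_map_comp[OF pp pj' pd s(1)] s(2) p
      by (intro inj tensor_map_pair.map_closed[OF pp s(1)]) simp
    then show "s \<in> tensor_map R Q K Q (X n) (\<lambda>q. q) j ` carrier (tensor R Q K)"
      using se(8) by (intro tensor_right_exact_right[OF Q se(1-4,6,7) _ s(1)])
  qed
qed

text \<open>The shift goes to the left: the kernel at \<open>n\<close> is the quotient of
  \<open>X (n - 1)\<close> by the kernel \<open>K\<close> at \<open>n - 1\<close>, so its Tor in
  degree k + 1 is governed by Tor of \<open>K\<close> in degree k. In degree 1 the decisive fact is
  injectivity of the map from D \<otimes> K to D \<otimes> X.\<close>

lemma Tor_kernel_trivial:
  fixes X :: "int \<Rightarrow> ('r, 'm, 'z) module_scheme" and K :: "('r, 'm, 'z) module_scheme"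
  assumes D: "left_module (opp_ring R) D" and X: "linear_sequence R X d"
    and ex: "exact_complex (\<lambda>i. tensor R D (X i)) (\<lambda>i. tensor_map R D (X i) D (X (i + 1)) (\<lambda>c. c) (d i))"
    and tor: "\<And>n i. trivial_group (Tor (Suc i) R D (X n))"
    and K: "kernel_embedding R X d n K j"
  shows "trivial_group (Tor (Suc i) R D K)"
proof -
  obtain P \<delta> \<epsilon> where ch: "chosen_resolution (opp_ring R) D = (P, \<delta>, \<epsilon>)"
    and res: "projective_resolution (opp_ring R) D P \<delta> \<epsilon>"
    by (rule ex_chosen_resolution[OF D])
  note iff = trivial_Tor_iff[OF ch res]
  note P = projective_resolutionD[OF res, unfolded linear_maps_opp_ring]
  have \<delta>0: "\<epsilon> (\<delta> 0 x) = \<zero>\<^bsub>D\<^esub>" if "x \<in> carrier (P (Suc 0))" for x using P(6) that by blast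
  have \<delta>\<delta>: "\<delta> i (\<delta> (Suc i) x) = \<zero>\<^bsub>P i\<^esub>" if "x \<in> carrier (P (Suc (Suc i)))" for i x using P(7)[of i] that by blast
  show ?thesis using K
  proof (induction i arbitrary: n K j)
    case (0 n L j')
    obtain K :: "('r, 'm, 'z) module_scheme" and j where K: "kernel_embedding R X d (n - 1) K j"
      using ex_kernel_embedding[OF X] by blast
    obtain p where se: "short_exact R K (X (n - 1)) L j p"
      by (rule short_exact_kernels[OF X K, of L j']) (use 0 that in auto)
    note se' = short_exactD[OF se]
    \<comment> \<open>The last differential in this chase is the augmentation; exactness for
      \<open>K\<close> at this spot is right exactness of the tensor product.\<close>
    have "tensor_exact_at R (P (Suc 0)) (P 0) D (\<delta> 0) \<epsilon> K"
      unfolding tensor_exact_at_def using P(6)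
      by (intro ballI impI tensor_right_exact_left[OF se'(1) P(2,2) D P(3,4,5)]) simp_all
    then show ?case unfolding iff[OF se'(3)]
      using \<delta>0 tensor_kernel_injective[OF D X ex K]
      by (intro Tor_chase[OF se P(2,2,2) D P(3,3,4) _ tor[of 0 "n - 1", unfolded iff[OF se'(2)]]])
  next
    case (Suc i n L j')
    obtain K :: "('r, 'm, 'z) module_scheme" and j where K: "kernel_embedding R X d (n - 1) K j"
      using ex_kernel_embedding[OF X] by blast
    obtain p where se: "short_exact R K (X (n - 1)) L j p"
      by (rule short_exact_kernels[OF X K, of L j']) (use Suc.prems that in auto)
    note se' = short_exactD[OF se]
    \<comment> \<open>In higher degrees the injectivity demanded by the chase is flatness of
      \<open>P i\<close>.\<close>
    show ?case unfolding iff[OF se'(3)]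
      using \<delta>\<delta> projective_flat[OF P(1) se'(1,2,4,5)]
      by (intro Tor_chase[OF se P(2,2,2,2) P(3,3,3) _ tor[of "Suc i" "n - 1", unfolded iff[OF se'(2)]]
            Suc.IH[OF K, unfolded iff[OF se'(1)]]])
  qed
qed

section \<open>Units and counits\<close>

context bimod
begin

abbreviation "unit M \<equiv> \<lambda>m\<in>carrier M. \<lambda>c\<in>carrier C. pure_tensor R D M c m"
abbreviation "counit N \<equiv> tensor_lift R D (hom_module S C N) N (\<lambda>c f. f c)"

lemma tensor_pair_D: "left_module R M \<Longrightarrow> tensor_pair R D M"
  by (intro tensor_pairI left_module_D)

lemma tensor_smult_pure:
  assumes "left_module R M" "s \<in> carrier S" "c \<in> carrier C" "m \<in> carrier M"
  shows "s \<odot>\<^bsub>tensor_module R C M\<^esub> pure_tensor R D M c m = pure_tensor R D M (s \<odot>\<^bsub>C\<^esub> c) m"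
  using tensor_map_pair.map_pure[OF tensor_map_pair_D[OF assms(1,1) smult_linear[OF assms(2)] linear_maps_id]] assms(3,4)
  by simp

lemma pure_linear:
  assumes M: "left_module R M" and m: "m \<in> carrier M"
  shows "(\<lambda>c. pure_tensor R D M c m) \<in> linear_maps S C (tensor_module R C M)"
proof -
  interpret T: tensor_pair R D M by (rule tensor_pair_D[OF M])
  show ?thesis
    using m T.pure_add_left tensor_smult_pure[OF M] T.pure_closed
    by (auto simp: linear_maps_def add_homs_def simp del: tensor_module_simps(4))
qed

lemma unit_hom:
  assumes M: "left_module R M"
  shows "unit M \<in> mod_hom R M (hom_module S C (tensor_module R C M))"
proof (rule restrict_mod_hom[OF M])
  interpret T: tensor_pair R D M by (rule tensor_pair_D[OF M])
  have "(\<lambda>c\<in>carrier C. pure_tensor R D M c m) \<in> mod_hom S C (tensor_module R C M)" if "m \<in> carrier M" for m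
    by (rule restrict_mod_hom[OF left_module_C pure_linear[OF M that]])
  then show "(\<lambda>m. \<lambda>c\<in>carrier C. pure_tensor R D M c m) \<in> linear_maps R M (hom_module S C (tensor_module R C M))"
    using T.pure_add_right T.pure_smult
    by (auto simp: linear_maps_def add_homs_def rsmult_closed intro!: restrict_ext)
qed

text \<open>The exactness arguments produce linear maps that need not be extensional, so
  surjectivity is restated for these; injectivity becomes triviality of the kernel.\<close>

lemma unit_iso_iff:
  assumes M: "left_module R M"
  shows "unit M \<in> mod_iso R M (hom_module S C (tensor_module R C M)) \<longleftrightarrow>
    (\<forall>m\<in>carrier M. (\<forall>c\<in>carrier C. pure_tensor R D M c m = \<zero>\<^bsub>tensor R D M\<^esub>) \<longrightarrow> m = \<zero>\<^bsub>M\<^esub>) \<and>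
    (\<forall>h\<in>linear_maps S C (tensor_module R C M). \<exists>m\<in>carrier M. \<forall>c\<in>carrier C. h c = pure_tensor R D M c m)"
    (is "?iso \<longleftrightarrow> ?inj \<and> ?surj")
proof -
  interpret T: tensor_pair R D M by (rule tensor_pair_D[OF M])
  let ?H = "hom_module S C (tensor_module R C M)"
  note H = left_module_hom_module[OF left_module_tensor_module[OF M]]
  note ag = left_module_abelian_group[OF M] left_module_abelian_group[OF H]
  have u: "unit M \<in> add_homs M ?H" by (rule linear_mapsD(1)[OF mod_hom_linear[OF unit_hom[OF M]]])
  have ker: "unit M m = \<zero>\<^bsub>?H\<^esub> \<longleftrightarrow> (\<forall>c\<in>carrier C. pure_tensor R D M c m = \<zero>\<^bsub>tensor R D M\<^esub>)"
    if "m \<in> carrier M" for m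
    using that by (auto simp: fun_eq_iff)
  have "inj_on (unit M) (carrier M) \<longleftrightarrow> ?inj"
  proof
    assume *: "inj_on (unit M) (carrier M)"
    show ?inj
    proof (intro ballI impI)
      fix m assume m: "m \<in> carrier M" "\<forall>c\<in>carrier C. pure_tensor R D M c m = \<zero>\<^bsub>tensor R D M\<^esub>"
      then have "unit M m = unit M \<zero>\<^bsub>M\<^esub>" using ker[OF m(1)] add_homs_zero[OF ag u] by simp
      then show "m = \<zero>\<^bsub>M\<^esub>" using inj_onD[OF *] m(1) by blast
    qed
  next
    assume ?inj
    then show "inj_on (unit M) (carrier M)" using ker by (intro add_homs_inj_on[OF ag u]) blast
  qed
  moreover have "unit M ` carrier M = carrier ?H \<longleftrightarrow> ?surj"
  proof
    assume *: "unit M ` carrier M = carrier ?H"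
    show ?surj
    proof
      fix h assume "h \<in> linear_maps S C (tensor_module R C M)"
      then have "restrict h (carrier C) \<in> unit M ` carrier M"
        unfolding * using restrict_mod_hom[OF left_module_C] by simp
      then obtain m where m: "m \<in> carrier M" "restrict h (carrier C) = unit M m" by blast
      have "h c = pure_tensor R D M c m" if "c \<in> carrier C" for c
        using fun_cong[OF m(2), of c] m(1) that by simp
      with m(1) show "\<exists>m\<in>carrier M. \<forall>c\<in>carrier C. h c = pure_tensor R D M c m" by blast
    qed
  next
    assume *: ?surj
    have "h \<in> unit M ` carrier M" if h: "h \<in> mod_hom S C (tensor_module R C M)" for h
    proof -
      obtain m where m: "m \<in> carrier M" "\<forall>c\<in>carrier C. h c = pure_tensor R D M c m"
        using * mod_hom_linear[OF h] by blast
      have "h = unit M m" using m h by (auto simp: mod_hom_eq extensional_def fun_eq_iff)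
      with m(1) show ?thesis by blast
    qed
    then show "unit M ` carrier M = carrier ?H" using add_homs_closed[OF u] by auto
  qed
  ultimately show ?thesis using unit_hom[OF M] by (simp add: mod_iso_def bij_betw_def)
qed

lemma counit_balanced:
  assumes "left_module S N" shows "balanced R D (hom_module S C N) N (\<lambda>c f. f c)"
  by (auto simp: balanced_def mod_hom_def rsmult_closed)

lemma counit_pure:
  assumes N: "left_module S N" and "c \<in> carrier C" "f \<in> mod_hom S C N"
  shows "counit N (pure_tensor R D (hom_module S C N) c f) = f c"
  using tensor_pair.tensor_lift_pure[OF tensor_pair_D[OF left_module_hom_module[OF N]]
      left_module_abelian_group[OF N] counit_balanced[OF N]] assms(2,3) by simp

lemma counit_add_homs:
  assumes N: "left_module S N" shows "counit N \<in> add_homs (tensor R D (hom_module S C N)) N"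
  by (rule tensor_pair.tensor_lift_add_homs[OF tensor_pair_D[OF left_module_hom_module[OF N]]
      left_module_abelian_group[OF N] counit_balanced[OF N]])

lemma counit_hom:
  assumes N: "left_module S N"
  shows "counit N \<in> mod_hom S (tensor_module R C (hom_module S C N)) N"
proof -
  interpret N: left_module S N by (rule N)
  note H = left_module_hom_module[OF N]
  interpret T: tensor_pair R D "hom_module S C N" by (rule tensor_pair_D[OF H])
  have "counit N (s \<odot>\<^bsub>tensor_module R C (hom_module S C N)\<^esub> t) = s \<odot>\<^bsub>N\<^esub> counit N t"
    if s: "s \<in> carrier S" and "t \<in> carrier (tensor R D (hom_module S C N))" for s t
    using that(2)
  proof (induction rule: T.tensor_induct)
    case (pure c f)
    then show ?case
      using s counit_pure[OF N] linear_mapsD(2)[OF mod_hom_linear, of f S C N s c]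
      by (simp add: tensor_smult_pure[OF H] del: tensor_module_simps(4))
  next
    case (add t u)
    have sl: "(\<lambda>x. s \<odot>\<^bsub>tensor_module R C (hom_module S C N)\<^esub> x) \<in>
        add_homs (tensor R D (hom_module S C N)) (tensor R D (hom_module S C N))"
      using tensor_map_pair.map_add_homs[OF tensor_map_pair_D[OF H H smult_linear[OF s] linear_maps_id]] by simp
    show ?case
      using add s add_homs_closed[OF sl] add_homs_closed[OF counit_add_homs[OF N]]
      by (simp add: add_homs_add[OF sl] add_homs_add[OF counit_add_homs[OF N]] N.smult_r_distr
          del: tensor_module_simps(4))
  qed
  then show ?thesis
    using counit_add_homs[OF N]
    by (simp add: mod_hom_eq linear_maps_def add_homs_def tensor_lift_def del: tensor_module_simps(4))
qed

lemma counit_iso_iff: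
  assumes N: "left_module S N"
  shows "counit N \<in> mod_iso S (tensor_module R C (hom_module S C N)) N \<longleftrightarrow>
    (\<forall>t\<in>carrier (tensor R D (hom_module S C N)). counit N t = \<zero>\<^bsub>N\<^esub> \<longrightarrow> t = \<zero>\<^bsub>tensor R D (hom_module S C N)\<^esub>) \<and>
    counit N ` carrier (tensor R D (hom_module S C N)) = carrier N"
proof -
  note H = left_module_hom_module[OF N]
  interpret T: tensor_pair R D "hom_module S C N" by (rule tensor_pair_D[OF H])
  note ag = T.tensor_abelian_group left_module_abelian_group[OF N]
  note c = counit_add_homs[OF N]
  have "inj_on (counit N) (carrier (tensor R D (hom_module S C N))) \<longleftrightarrow>
    (\<forall>t\<in>carrier (tensor R D (hom_module S C N)). counit N t = \<zero>\<^bsub>N\<^esub> \<longrightarrow> t = \<zero>\<^bsub>tensor R D (hom_module S C N)\<^esub>)"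
  proof
    assume *: "inj_on (counit N) (carrier (tensor R D (hom_module S C N)))"
    then show "\<forall>t\<in>carrier (tensor R D (hom_module S C N)). counit N t = \<zero>\<^bsub>N\<^esub> \<longrightarrow> t = \<zero>\<^bsub>tensor R D (hom_module S C N)\<^esub>"
      using add_homs_zero[OF ag c] inj_onD[OF *] T.T.zero_closed by metis
  qed (intro add_homs_inj_on[OF ag c], blast)
  then show ?thesis using counit_hom[OF N] by (simp add: mod_iso_def bij_betw_def)
qed

text \<open>On a pure tensor c \<otimes> f both sides are g (f c).\<close>

lemma counit_natural:
  assumes N: "left_module S N" and N': "left_module S N'" and g: "g \<in> linear_maps S N N'"
    and t: "t \<in> carrier (tensor R D (hom_module S C N))"
  shows "counit N' (tensor_map R D (hom_module S C N) D (hom_module S C N') (\<lambda>c. c) (compose (carrier C) g) t) =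
    g (counit N t)"
proof -
  note H = left_module_hom_module[OF N] left_module_hom_module[OF N']
  note gl = hom_map_linear[OF N N' g]
  interpret g: tensor_map_pair R D "hom_module S C N" D "hom_module S C N'" "\<lambda>c. c" "compose (carrier C) g"
    by (intro tensor_map_pair_D H gl linear_maps_id)
  show ?thesis using t
  proof (induction rule: g.src.tensor_induct)
    case (pure c f)
    then show ?case using linear_maps_closed[OF gl, of f]
      by (simp add: g.map_pure counit_pure[OF N] counit_pure[OF N'] compose_eq)
  next
    case (add t u)
    then show ?case
      using add_homs_closed[OF counit_add_homs[OF N]]
      by (simp add: add_homs_add[OF g.map_add_homs] add_homs_add[OF counit_add_homs[OF N]]
          add_homs_add[OF counit_add_homs[OF N']] add_homs_add[OF linear_mapsD(1)[OF g]] g.map_closed)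
  qed
qed

end

section \<open>Cokernels and kernels of differentials\<close>

context
  fixes R :: "('r, 'x) ring_scheme" and B :: "('r, 'm, 'y) module_scheme" and E :: "('r, 'n, 'z) module_scheme"
    and g :: "'m \<Rightarrow> 'n" and U :: "'m set"
  assumes B: "left_module R B" and E: "left_module R E" and g: "g \<in> linear_maps R B E"
    and U: "U = {x \<in> carrier B. g x = \<zero>\<^bsub>E\<^esub>}"
begin

interpretation B: left_module R B by (rule B)
interpretation E: left_module R E by (rule E)

lemma kernel_subgroup: "subgroup U (add_monoid B)"
  using a_kernel_subgroup[OF left_module_abelian_group[OF B] left_module_abelian_group[OF E] linear_mapsD(1)[OF g]]
  by (simp add: U a_kernel_def kernel_def)

lemma coset_self: "x \<in> carrier B \<Longrightarrow> x \<in> U +>\<^bsub>B\<^esub> x"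
  using subgroup.one_closed[OF kernel_subgroup] by (force simp: a_r_coset_def')

text \<open>Since \<open>U\<close> is the kernel of \<open>g\<close>, its cosets are classified by
  the values of \<open>g\<close>; the quotient can be handled as the image of
  \<open>g\<close>.\<close>

lemma coset_eq_iff:
  assumes "x \<in> carrier B" "y \<in> carrier B"
  shows "U +>\<^bsub>B\<^esub> x = U +>\<^bsub>B\<^esub> y \<longleftrightarrow> g x = g y"
proof -
  have gz: "g x = g y \<longleftrightarrow> x \<ominus>\<^bsub>B\<^esub> y \<in> U"
    using assms add_homs_eq_iff[OF left_module_abelian_group[OF B] left_module_abelian_group[OF E] linear_mapsD(1)[OF g]]
    by (simp add: U)
  show ?thesis
  proof
    assume "U +>\<^bsub>B\<^esub> x = U +>\<^bsub>B\<^esub> y"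
    then have "x \<in> U +>\<^bsub>B\<^esub> y" using coset_self[OF assms(1)] by simp
    then obtain u where u: "u \<in> U" "x = u \<oplus>\<^bsub>B\<^esub> y" by (auto simp: a_r_coset_def')
    then show "g x = g y"
      using assms linear_maps_closed[OF g] by (auto simp: U add_homs_add[OF linear_mapsD(1)[OF g]])
  next
    assume "g x = g y"
    then have "x \<ominus>\<^bsub>B\<^esub> y \<in> U" by (simp add: gz)
    moreover have "x = (x \<ominus>\<^bsub>B\<^esub> y) \<oplus>\<^bsub>B\<^esub> y" using assms by (simp add: a_minus_def B.M.a_assoc B.M.l_neg)
    ultimately have "x \<in> U +>\<^bsub>B\<^esub> y" by (auto simp: a_r_coset_def')
    then show "U +>\<^bsub>B\<^esub> x = U +>\<^bsub>B\<^esub> y" using B.a_repr_independence[OF _ assms(2) kernel_subgroup] by simp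
  qed
qed

lemma coset_linear:
  "(\<lambda>x. U +>\<^bsub>B\<^esub> x) \<in> linear_maps R B (quotient_module B U)"
  "(\<lambda>x. U +>\<^bsub>B\<^esub> x) ` carrier B = carrier (quotient_module B U)"
proof -
  have asub: "abelian_subgroup U B"
    by (intro abelian_subgroupI3 additive_subgroup.intro kernel_subgroup B.M.abelian_group_axioms)
  show im: "(\<lambda>x. U +>\<^bsub>B\<^esub> x) ` carrier B = carrier (quotient_module B U)"
    by (auto simp: quotient_module_def A_RCOSETS_def')
  \<comment> \<open>The scalar action of \<open>quotient_module\<close> is a union over all
    representatives; it collapses because each of them yields the same coset.\<close>
  have sm: "(\<Union>x'\<in>U +>\<^bsub>B\<^esub> x. U +>\<^bsub>B\<^esub> (r \<odot>\<^bsub>B\<^esub> x')) = U +>\<^bsub>B\<^esub> (r \<odot>\<^bsub>B\<^esub> x)"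
    if rx: "r \<in> carrier R" "x \<in> carrier B" for r x
  proof -
    have "U +>\<^bsub>B\<^esub> (r \<odot>\<^bsub>B\<^esub> x') = U +>\<^bsub>B\<^esub> (r \<odot>\<^bsub>B\<^esub> x)" if x'U: "x' \<in> U +>\<^bsub>B\<^esub> x" for x'
    proof -
      obtain u where u: "u \<in> U" "x' = u \<oplus>\<^bsub>B\<^esub> x" using x'U by (auto simp: a_r_coset_def')
      then have x': "x' \<in> carrier B" "g x' = g x"
        using rx linear_maps_closed[OF g] by (auto simp: U add_homs_add[OF linear_mapsD(1)[OF g]])
      then show ?thesis using rx by (subst coset_eq_iff) (simp_all add: linear_mapsD(2)[OF g])
    qed
    moreover have "x \<in> U +>\<^bsub>B\<^esub> x" by (rule coset_self[OF rx(2)])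
    ultimately show ?thesis by blast
  qed
  show "(\<lambda>x. U +>\<^bsub>B\<^esub> x) \<in> linear_maps R B (quotient_module B U)"
    using im abelian_subgroup.a_rcos_sum[OF asub] sm
    by (auto simp: linear_maps_def add_homs_def quotient_module_def)
qed

end

text \<open>By exactness the cokernel of \<open>d (-2)\<close> is \<open>X (-1)\<close> modulo the
  kernel of \<open>d (-1)\<close>, hence isomorphic to the image of \<open>d (-1)\<close>, which is
  the kernel of \<open>d 0\<close>.\<close>

lemma kernel_embedding_of_cokernel:
  fixes M :: "('r, 'm, 'z) module_scheme"
  assumes X: "linear_sequence R X d" and M: "left_module R M"
    and iso: "mod_isomorphic R M (cokernel_module (X (-2)) (X (-1)) (d (-2)))"
  shows "\<exists>j. kernel_embedding R X d 0 M j"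
proof -
  note XD = linear_sequenceD[OF X]
  interpret B: left_module R "X (-1)" by (rule XD(1))
  interpret M: left_module R M by (rule M)
  let ?B = "X (-1)" and ?U = "d (-2) ` carrier (X (-2))" and ?g = "d (-1)"
  let ?Q = "quotient_module ?B ?U" and ?k = "\<lambda>x. ?U +>\<^bsub>?B\<^esub> x"
  have g: "?g \<in> linear_maps R ?B (X 0)" using XD(2)[of "-1"] by simp
  have d2: "d (-2) \<in> linear_maps R (X (-2)) ?B" using XD(2)[of "-2"] by simp
  have U: "?U = {x \<in> carrier ?B. ?g x = \<zero>\<^bsub>X 0\<^esub>}"
    using XD(3)[of _ "-2"] XD(4)[of _ "-2"] linear_maps_closed[OF d2] by auto
  have im: "?g ` carrier ?B = {x \<in> carrier (X 0). d 0 x = \<zero>\<^bsub>X 1\<^esub>}"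
    using XD(3)[of _ "-1"] XD(4)[of _ "-1"] linear_maps_closed[OF g] by auto
  note eq = coset_eq_iff[OF XD(1) XD(1) g U] and k = coset_linear[OF XD(1) XD(1) g U]
  obtain \<phi> where \<phi>: "\<phi> \<in> linear_maps R M ?Q" "bij_betw \<phi> (carrier M) (carrier ?Q)"
    using iso mod_hom_linear unfolding mod_isomorphic_def mod_iso_def cokernel_module_def by blast
  \<comment> \<open>A representative in \<open>X (-1)\<close> of the coset \<phi>(m). The map
    \<open>j\<close> below depends on the coset alone, since \<open>d (-1)\<close> is constant on
    it.\<close>
  define b where "b m = inv_into (carrier ?B) ?k (\<phi> m)" for m
  have b: "b m \<in> carrier ?B" "?k (b m) = \<phi> m" if "m \<in> carrier M" for m
  proof -
    have "\<phi> m \<in> ?k ` carrier ?B" using linear_maps_closed[OF \<phi>(1) that] k(2) by simp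
    then show "b m \<in> carrier ?B" "?k (b m) = \<phi> m" unfolding b_def by (rule inv_into_into, rule f_inv_into_f)
  qed
  define j where "j m = ?g (b m)" for m
  have j: "j m = ?g x" if "m \<in> carrier M" "x \<in> carrier ?B" "\<phi> m = ?k x" for m x
    unfolding j_def using eq[OF b(1)[OF that(1)] that(2)] b(2)[OF that(1)] that(3) by simp
  have "j \<in> linear_maps R M (X 0)" unfolding linear_maps_def add_homs_def mem_Collect_eq
  proof (intro conjI ballI)
    fix m m' assume mm: "m \<in> carrier M" "m' \<in> carrier M"
    show "j m \<in> carrier (X 0)" unfolding j_def by (intro linear_maps_closed[OF g] b mm)
    have "\<phi> (m \<oplus>\<^bsub>M\<^esub> m') = ?k (b m \<oplus>\<^bsub>?B\<^esub> b m')"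
      using mm b add_homs_add[OF linear_mapsD(1)[OF \<phi>(1)]] add_homs_add[OF linear_mapsD(1)[OF k(1)]] by simp
    then have "j (m \<oplus>\<^bsub>M\<^esub> m') = ?g (b m \<oplus>\<^bsub>?B\<^esub> b m')" using mm b by (intro j) simp_all
    then show "j (m \<oplus>\<^bsub>M\<^esub> m') = j m \<oplus>\<^bsub>X 0\<^esub> j m'"
      using mm b add_homs_add[OF linear_mapsD(1)[OF g]] by (simp add: j_def)
  next
    fix r m assume rm: "r \<in> carrier R" "m \<in> carrier M"
    have "\<phi> (r \<odot>\<^bsub>M\<^esub> m) = ?k (r \<odot>\<^bsub>?B\<^esub> b m)"
      using rm b linear_mapsD(2)[OF \<phi>(1)] linear_mapsD(2)[OF k(1)] by simp
    then have "j (r \<odot>\<^bsub>M\<^esub> m) = ?g (r \<odot>\<^bsub>?B\<^esub> b m)" using rm b by (intro j) simp_all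
    then show "j (r \<odot>\<^bsub>M\<^esub> m) = r \<odot>\<^bsub>X 0\<^esub> j m"
      using rm b linear_mapsD(2)[OF g] by (simp add: j_def)
  qed
  moreover have "inj_on j (carrier M)"
  proof (rule inj_onI)
    fix m m' assume mm: "m \<in> carrier M" "m' \<in> carrier M" "j m = j m'"
    then have "\<phi> m = \<phi> m'" using eq[OF b(1) b(1)] b(2) by (simp add: j_def)
    then show "m = m'" using \<phi>(2) mm by (simp add: bij_betw_def inj_on_def)
  qed
  moreover have "j ` carrier M = ?g ` carrier ?B"
  proof
    show "j ` carrier M \<subseteq> ?g ` carrier ?B" using b(1) by (auto simp: j_def)
    show "?g ` carrier ?B \<subseteq> j ` carrier M"
    proof
      fix y assume "y \<in> ?g ` carrier ?B"
      then obtain x where x: "x \<in> carrier ?B" "y = ?g x" by blast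
      have "?k x \<in> \<phi> ` carrier M" using \<phi>(2) linear_maps_closed[OF k(1) x(1)] by (simp add: bij_betw_def)
      then obtain m where m: "m \<in> carrier M" "?k x = \<phi> m" by (rule imageE)
      have "y = j m" using j[OF m(1) x(1) m(2)[symmetric]] x(2) by simp
      then show "y \<in> j ` carrier M" using m(1) by simp
    qed
  qed
  ultimately have "kernel_embedding R X d 0 M j" unfolding kernel_embedding_def using M im by simp
  then show ?thesis by blast
qed

lemma kernel_embedding_of_kernel:
  fixes M :: "('r, 'm, 'z) module_scheme"
  assumes M: "left_module R M" and iso: "mod_isomorphic R M (kernel_module (X 0) (X 1) (d 0))"
  shows "\<exists>j. kernel_embedding R X d 0 M j"
proof -
  obtain j where j: "j \<in> linear_maps R M (kernel_module (X 0) (X 1) (d 0))"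
    "bij_betw j (carrier M) (carrier (kernel_module (X 0) (X 1) (d 0)))"
    using iso mod_hom_linear unfolding mod_isomorphic_def mod_iso_def by blast
  have "j \<in> linear_maps R M (X 0)"
    using j(1) by (auto simp: linear_maps_def add_homs_def kernel_module_def a_kernel_def kernel_def)
  then have "kernel_embedding R X d 0 M j"
    using j(2) M by (auto simp: kernel_embedding_def bij_betw_def kernel_module_def a_kernel_def kernel_def)
  then show ?thesis by blast
qed

lemma exact_sequence_linear: "exact_sequence R X d \<Longrightarrow> linear_sequence R X d"
  by (simp add: exact_sequence_def linear_sequence_def mod_hom_linear)

section \<open>The classes are closed under the step operations\<close>

lemma all_ge1_iff: "(\<forall>i\<ge>1. P i) \<longleftrightarrow> (\<forall>i. P (Suc i))"
  by (metis One_nat_def Suc_le_D Suc_le_mono le0)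

context bimod
begin

abbreviation "tensored X d i \<equiv> tensor_map R D (X i) D (X (i + 1)) (\<lambda>c. c) (d i)"

lemma tensor_exact_iff:
  "tensor_exact R C X d \<longleftrightarrow> exact_complex (\<lambda>i. tensor R D (X i)) (\<lambda>i. tensored X d i)"
  by (simp add: tensor_exact_def Let_def exact_complex_def exact_at_def a_kernel_def kernel_def)

lemma auslander_classD:
  assumes "M \<in> auslander_class S R C"
  shows "left_module R M" "trivial_group (Tor (Suc i) R D M)"
    "trivial_group (Ext (Suc i) S C (tensor_module R C M))"
    "\<lbrakk>m \<in> carrier M; \<And>c. c \<in> carrier C \<Longrightarrow> pure_tensor R D M c m = \<zero>\<^bsub>tensor R D M\<^esub>\<rbrakk> \<Longrightarrow> m = \<zero>\<^bsub>M\<^esub>"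
    "h \<in> linear_maps S C (tensor_module R C M) \<Longrightarrow> \<exists>m\<in>carrier M. \<forall>c\<in>carrier C. h c = pure_tensor R D M c m"
proof -
  show M: "left_module R M" using assms by (simp add: auslander_class_def)
  have "unit M \<in> mod_iso R M (hom_module S C (tensor_module R C M))"
    using assms by (simp add: auslander_class_def)
  then show
    "\<lbrakk>m \<in> carrier M; \<And>c. c \<in> carrier C \<Longrightarrow> pure_tensor R D M c m = \<zero>\<^bsub>tensor R D M\<^esub>\<rbrakk> \<Longrightarrow> m = \<zero>\<^bsub>M\<^esub>"
    "h \<in> linear_maps S C (tensor_module R C M) \<Longrightarrow> \<exists>m\<in>carrier M. \<forall>c\<in>carrier C. h c = pure_tensor R D M c m"
    unfolding unit_iso_iff[OF M] by blast+
qed (use assms in \<open>simp_all add: auslander_class_def\<close>)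

lemma bass_classD:
  assumes "N \<in> bass_class S R C"
  shows "left_module S N" "trivial_group (Ext (Suc i) S C N)"
    "trivial_group (Tor (Suc i) R D (hom_module S C N))"
    "\<lbrakk>t \<in> carrier (tensor R D (hom_module S C N)); counit N t = \<zero>\<^bsub>N\<^esub>\<rbrakk> \<Longrightarrow> t = \<zero>\<^bsub>tensor R D (hom_module S C N)\<^esub>"
    "counit N ` carrier (tensor R D (hom_module S C N)) = carrier N"
proof -
  show N: "left_module S N" using assms by (simp add: bass_class_def)
  have "counit N \<in> mod_iso S (tensor_module R C (hom_module S C N)) N"
    using assms by (simp add: bass_class_def)
  then show
    "\<lbrakk>t \<in> carrier (tensor R D (hom_module S C N)); counit N t = \<zero>\<^bsub>N\<^esub>\<rbrakk> \<Longrightarrow> t = \<zero>\<^bsub>tensor R D (hom_module S C N)\<^esub>"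
    "counit N ` carrier (tensor R D (hom_module S C N)) = carrier N"
    unfolding counit_iso_iff[OF N] by blast+
qed (use assms in \<open>simp_all add: bass_class_def\<close>)

lemma auslander_kernel:
  fixes X :: "int \<Rightarrow> ('r, 'm) module" and M :: "('r, 'm) module"
  assumes X: "linear_sequence R X d" and ex: "tensor_exact R C X d"
    and XA: "\<And>i. X i \<in> auslander_class S R C" and M: "kernel_embedding R X d n M j"
  shows "M \<in> auslander_class S R C"
proof -
  note XD = linear_sequenceD[OF X] and MD = kernel_embeddingD[OF M] and A = auslander_classD[OF XA]
  note ex' = ex[unfolded tensor_exact_iff]
  let ?Y = "\<lambda>i. tensor_module R C (X i)"
  have tmp: "tensor_map_pair R D N D N' (\<lambda>c. c) g"
    if "left_module R N" "left_module R N'" "g \<in> linear_maps R N N'"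
    for N N' :: "('r, 'm) module" and g
    by (intro tensor_map_pair_D that linear_maps_id)
  note td = tensor_map_pair.map_pure[OF tmp[OF XD(1,1) XD(2)]]
  have Y: "linear_sequence S ?Y (tensored X d)"
    unfolding linear_sequence_def
    using left_module_tensor_module[OF XD(1)] tensor_map_linear[OF XD(1,1) XD(2)] ex
    by (simp add: tensor_exact_def Let_def)
  have tor: "trivial_group (Tor (Suc i) R D M)" for i
    by (rule Tor_kernel_trivial[OF left_module_D X ex' A(2) M])
  let ?j = "tensor_map R D M D (X n) (\<lambda>c. c) j"
  note jp = tmp[OF MD(1) XD(1) MD(2)]
  note jl = tensor_map_linear[OF MD(1) XD(1) MD(2)]
  interpret TM: tensor_pair R D M by (rule tensor_pair_D[OF MD(1)])
  note agT = left_module_abelian_group[OF left_module_tensor_module[OF MD(1)]]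
    left_module_abelian_group[OF left_module_tensor_module[OF XD(1)]]
  have j0: "t = \<zero>\<^bsub>tensor R D M\<^esub>" if "t \<in> carrier (tensor R D M)" "?j t = \<zero>\<^bsub>tensor R D (X n)\<^esub>" for t
    by (rule tensor_kernel_injective[OF left_module_D X ex' M that])
  have jinj: "inj_on ?j (carrier (tensor R D M))"
    using j0 add_homs_inj_on[OF agT linear_mapsD(1)[OF jl]] by simp
  \<comment> \<open>C \<otimes> M is again a kernel, now in the sequence C \<otimes> X over
    \<open>S\<close>, so the statement on Ext of kernels applies to it.\<close>
  have K: "kernel_embedding S ?Y (tensored X d) n (tensor_module R C M) ?j"
    unfolding kernel_embedding_def
    using left_module_tensor_module[OF MD(1)] jl jinj tensor_kernel_exact[OF left_module_D X ex' M] by simp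
  \<comment> \<open>Surjectivity of the unit of \<open>X (n + 1)\<close> writes \<open>h\<close> as
    c \<mapsto> c \<otimes> x. Injectivity of the unit of \<open>X (n + 2)\<close> gives d x = 0,
    and exactness of \<open>X\<close> supplies a preimage of x.\<close>
  have hom_ex: "\<exists>g\<in>linear_maps S C (?Y n). \<forall>c\<in>carrier C. h c = tensored X d n (g c)"
    if h: "h \<in> linear_maps S C (?Y (n + 1))"
      and dh: "\<And>c. c \<in> carrier C \<Longrightarrow> tensored X d (n + 1) (h c) = \<zero>\<^bsub>?Y (n + 2)\<^esub>" for n h
  proof -
    obtain x where x: "x \<in> carrier (X (n + 1))" "\<forall>c\<in>carrier C. h c = pure_tensor R D (X (n + 1)) c x"
      using A(5)[OF h] by blast
    have dx: "d (n + 1) x \<in> carrier (X (n + 2))"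
      using linear_maps_closed[OF XD(2) x(1)] by (simp add: add.assoc)
    have "d (n + 1) x = \<zero>\<^bsub>X (n + 2)\<^esub>"
      using dh x td[of _ x "n + 1"] by (intro A(4)[OF dx]) (simp add: add.assoc)
    then obtain y where y: "y \<in> carrier (X n)" "x = d n y" using XD(3)[OF x(1)] by blast
    have "\<forall>c\<in>carrier C. h c = tensored X d n (pure_tensor R D (X n) c y)"
      using x(2) y td[of _ y n] by simp
    then show ?thesis using pure_linear[OF XD(1) y(1)] by (rule bexI)
  qed
  have ext: "trivial_group (Ext (Suc i) S C (tensor_module R C M))" for i
    by (rule Ext_kernel_trivial[OF left_module_C Y hom_ex A(3) K])
  have "unit M \<in> mod_iso R M (hom_module S C (tensor_module R C M))"
    unfolding unit_iso_iff[OF MD(1)]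
  proof (intro conjI ballI impI)
    fix m assume m: "m \<in> carrier M" "\<forall>c\<in>carrier C. pure_tensor R D M c m = \<zero>\<^bsub>tensor R D M\<^esub>"
    have "pure_tensor R D (X n) c (j m) = \<zero>\<^bsub>tensor R D (X n)\<^esub>" if "c \<in> carrier C" for c
      using tensor_map_pair.map_pure[OF jp, of c m] tensor_map_pair.map_zero[OF jp] m that by simp
    then have "j m = \<zero>\<^bsub>X n\<^esub>" by (rule A(4)[OF linear_maps_closed[OF MD(2) m(1)]])
    also have "\<dots> = j \<zero>\<^bsub>M\<^esub>"
      using add_homs_zero[OF left_module_abelian_group[OF MD(1)] left_module_abelian_group[OF XD(1)] linear_mapsD(1)[OF MD(2)]]
      by simp
    finally show "m = \<zero>\<^bsub>M\<^esub>" using inj_onD[OF MD(3)] m(1) TM.M.M.zero_closed by blast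
  next
    fix h assume h: "h \<in> linear_maps S C (tensor_module R C M)"
    \<comment> \<open>Followed by the embedding into C \<otimes> X, the map \<open>h\<close> is
      given by an element x of \<open>X n\<close>. Injectivity of the unit of
      \<open>X (n + 1)\<close> shows d x = 0, so x comes from \<open>M\<close>.\<close>
    obtain x where x: "x \<in> carrier (X n)" "\<forall>c\<in>carrier C. ?j (h c) = pure_tensor R D (X n) c x"
      using A(5)[OF linear_maps_comp[OF h jl]] by blast
    have "pure_tensor R D (X (n + 1)) c (d n x) = \<zero>\<^bsub>tensor R D (X (n + 1))\<^esub>" if c: "c \<in> carrier C" for c
      using td[of c x n] x c kernel_embeddingD(4)[OF K linear_maps_closed[OF h c]] by simp
    then have "d n x = \<zero>\<^bsub>X (n + 1)\<^esub>" by (rule A(4)[OF linear_maps_closed[OF XD(2) x(1)]])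
    then obtain m where m: "m \<in> carrier M" "x = j m" using MD(5)[OF x(1)] by blast
    have "h c = pure_tensor R D M c m" if c: "c \<in> carrier C" for c
    proof (rule inj_onD[OF jinj])
      show "?j (h c) = ?j (pure_tensor R D M c m)"
        using tensor_map_pair.map_pure[OF jp, of c m] m x(2) c by simp
      show "h c \<in> carrier (tensor R D M)" using linear_maps_closed[OF h c] by simp
      show "pure_tensor R D M c m \<in> carrier (tensor R D M)" using c m(1) by (intro TM.pure_closed) simp_all
    qed
    then show "\<exists>m\<in>carrier M. \<forall>c\<in>carrier C. h c = pure_tensor R D M c m" using m(1) by blast
  qed
  then show ?thesis using MD(1) tor ext unfolding auslander_class_def all_ge1_iff by simp
qed

lemma bass_kernel:
  fixes Y :: "int \<Rightarrow> ('s, 'n) module" and N :: "('s, 'n) module"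
  assumes Y: "linear_sequence S Y d" and ex: "hom_exact S C Y d"
    and YB: "\<And>i. Y i \<in> bass_class S R C" and N: "kernel_embedding S Y d n N j"
  shows "N \<in> bass_class S R C"
proof -
  note YD = linear_sequenceD[OF Y] and ND = kernel_embeddingD[OF N] and B = bass_classD[OF YB]
  let ?X = "\<lambda>i. hom_module S C (Y i)" and ?d = "\<lambda>i. compose (carrier C) (d i)"
  note HX = left_module_hom_module[OF YD(1)] and dX = hom_map_linear[OF YD(1,1) YD(2)]
  note HN = left_module_hom_module[OF ND(1)] and jX = hom_map_linear[OF ND(1) YD(1) ND(2)]
  have X: "linear_sequence R ?X ?d"
    unfolding linear_sequence_def using HX dX ex by (simp add: hom_exact_def)
  have cv: "counit (Y i) t \<in> carrier (Y i)" if "t \<in> carrier (tensor R D (?X i))" for i t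
    by (rule add_homs_closed[OF counit_add_homs[OF YD(1)] that])
  have c0: "counit (Y i) t = \<zero>\<^bsub>Y i\<^esub> \<longleftrightarrow> t = \<zero>\<^bsub>tensor R D (?X i)\<^esub>" if "t \<in> carrier (tensor R D (?X i))" for i t
    using B(4)[OF that] add_homs_zero[OF tensor_pair.tensor_abelian_group[OF tensor_pair_D[OF HX]]
        left_module_abelian_group[OF YD(1)] counit_add_homs[OF YD(1)]] by blast
  note ceq = add_homs_inj_on[OF tensor_pair.tensor_abelian_group[OF tensor_pair_D[OF HX]]
        left_module_abelian_group[OF YD(1)] counit_add_homs[OF YD(1)] B(4)]
  have tmp: "tensor_map_pair R D (?X i) D (?X (i + 1)) (\<lambda>c. c) (?d i)" for i
    by (intro tensor_map_pair_D HX dX linear_maps_id)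
  note tcl = tensor_map_pair.map_closed[OF tmp]
  have nat: "counit (Y (i + 1)) (tensored ?X ?d i t) = d i (counit (Y i) t)"
    if "t \<in> carrier (tensor R D (?X i))" for i t
    by (rule counit_natural[OF YD(1,1) YD(2) that])
  have ker: "tensored ?X ?d i t = \<zero>\<^bsub>tensor R D (?X (i + 1))\<^esub> \<longleftrightarrow> d i (counit (Y i) t) = \<zero>\<^bsub>Y (i + 1)\<^esub>"
    if "t \<in> carrier (tensor R D (?X i))" for i t
    using c0[OF tcl[OF that]] nat[OF that] by simp
  \<comment> \<open>The counits of the terms are natural isomorphisms, so C \<otimes> Hom(C, Y) is a
    copy of \<open>Y\<close> and inherits its exactness.\<close>
  have texact: "exact_complex (\<lambda>i. tensor R D (?X i)) (\<lambda>i. tensored ?X ?d i)"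
    unfolding exact_complex_def exact_at_def
  proof (intro allI equalityI subsetI)
    fix i t assume "t \<in> tensored ?X ?d i ` carrier (tensor R D (?X i))"
    then obtain s where s: "s \<in> carrier (tensor R D (?X i))" "t = tensored ?X ?d i s" by blast
    then have "d (i + 1) (counit (Y (i + 1)) t) = \<zero>\<^bsub>Y (i + 2)\<^esub>"
      using YD(4)[OF cv[OF s(1)]] nat[OF s(1)] by simp
    then show "t \<in> a_kernel (tensor R D (?X (i + 1))) (tensor R D (?X (i + 2))) (tensored ?X ?d (i + 1))"
      using ker[OF tcl[OF s(1)]] tcl[OF s(1)] s(2) by (simp add: a_kernel_iff add.assoc)
  next
    fix i t assume "t \<in> a_kernel (tensor R D (?X (i + 1))) (tensor R D (?X (i + 2))) (tensored ?X ?d (i + 1))"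
    then have t: "t \<in> carrier (tensor R D (?X (i + 1)))" "tensored ?X ?d (i + 1) t = \<zero>\<^bsub>tensor R D (?X (i + 2))\<^esub>"
      by (simp_all add: a_kernel_iff)
    then have "d (i + 1) (counit (Y (i + 1)) t) = \<zero>\<^bsub>Y (i + 2)\<^esub>"
      using ker[OF t(1)] by (simp add: add.assoc)
    then obtain y where y: "y \<in> carrier (Y i)" "counit (Y (i + 1)) t = d i y" using YD(3)[OF cv[OF t(1)]] by blast
    obtain s where s: "s \<in> carrier (tensor R D (?X i))" "y = counit (Y i) s" using B(5)[of i] y(1) by blast
    have "t = tensored ?X ?d i s"
      using inj_onD[OF ceq[of "i + 1"]] nat[OF s(1)] y(2) s(2) t(1) tcl[OF s(1)] by metis
    then show "t \<in> tensored ?X ?d i ` carrier (tensor R D (?X i))" using s(1) by blast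
  qed
  \<comment> \<open>Left exactness of Hom: a map into \<open>Y n\<close> killed by
    \<open>d n\<close> takes values in the image of \<open>j\<close> and lifts uniquely to
    \<open>N\<close>.\<close>
  have K: "kernel_embedding R ?X ?d n (hom_module S C N) (compose (carrier C) j)"
    unfolding kernel_embedding_def
  proof (intro conjI HN jX equalityI subsetI inj_onI)
    fix f g assume fg: "f \<in> carrier (hom_module S C N)" "g \<in> carrier (hom_module S C N)"
      "compose (carrier C) j f = compose (carrier C) j g"
    then have fg': "f \<in> mod_hom S C N" "g \<in> mod_hom S C N" by simp_all
    show "f = g"
    proof (rule mod_hom_extensionality[OF fg'])
      fix c assume c: "c \<in> carrier C"
      have "j (f c) = j (g c)" using fun_cong[OF fg(3), of c] c by (simp add: compose_eq)
      then show "f c = g c"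
        using inj_onD[OF ND(3)] linear_maps_closed[OF mod_hom_linear[OF fg'(1)] c]
          linear_maps_closed[OF mod_hom_linear[OF fg'(2)] c] by blast
    qed
  next
    fix h assume "h \<in> compose (carrier C) j ` carrier (hom_module S C N)"
    then obtain f where f: "f \<in> carrier (hom_module S C N)" "h = compose (carrier C) j f" by blast
    have "compose (carrier C) (d n) h = (\<lambda>c\<in>carrier C. \<zero>\<^bsub>Y (n + 1)\<^esub>)"
      using f(1) ND(4) linear_maps_closed[OF mod_hom_linear, of f S C N]
      unfolding f(2) by (auto simp: compose_def intro!: restrict_ext)
    then show "h \<in> {h \<in> carrier (?X n). ?d n h = \<zero>\<^bsub>?X (n + 1)\<^esub>}"
      using linear_maps_closed[OF jX f(1)] f(2) by simp
  next
    fix h assume "h \<in> {h \<in> carrier (?X n). ?d n h = \<zero>\<^bsub>?X (n + 1)\<^esub>}"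
    then have h: "h \<in> mod_hom S C (Y n)" and dh: "?d n h = (\<lambda>c\<in>carrier C. \<zero>\<^bsub>Y (n + 1)\<^esub>)" by simp_all
    have "h c \<in> j ` carrier N" if c: "c \<in> carrier C" for c
      using fun_cong[OF dh, of c] c ND(5)[OF linear_maps_closed[OF mod_hom_linear[OF h] c]]
      by (auto simp: compose_eq)
    then obtain w where w: "w \<in> linear_maps S C N" "\<forall>c\<in>carrier C. j (w c) = h c"
      using linear_lift_inj[OF ND(1) YD(1) left_module_C ND(2,3) mod_hom_linear[OF h]] by blast
    have w': "restrict w (carrier C) \<in> mod_hom S C N" by (rule restrict_mod_hom[OF left_module_C w(1)])
    moreover have "h = compose (carrier C) j (restrict w (carrier C))"
      using w(2) h by (auto simp: mod_hom_eq extensional_def compose_def fun_eq_iff)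
    ultimately show "h \<in> compose (carrier C) j ` carrier (hom_module S C N)" by simp
  qed
  have tor: "trivial_group (Tor (Suc i) R D (hom_module S C N))" for i
    by (rule Tor_kernel_trivial[OF left_module_D X texact B(3) K])
  \<comment> \<open>The assumed exactness of Hom(C, Y), restated for maps that need not be
    extensional.\<close>
  have hom_ex: "\<exists>g\<in>linear_maps S C (Y n). \<forall>c\<in>carrier C. h c = d n (g c)"
    if h: "h \<in> linear_maps S C (Y (n + 1))"
      and dh: "\<And>c. c \<in> carrier C \<Longrightarrow> d (n + 1) (h c) = \<zero>\<^bsub>Y (n + 2)\<^esub>" for n h
  proof -
    have h': "restrict h (carrier C) \<in> carrier (?X (n + 1))"
      using restrict_mod_hom[OF left_module_C h] by simp
    have "?d (n + 1) (restrict h (carrier C)) = \<zero>\<^bsub>?X (n + 2)\<^esub>"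
      using dh by (auto simp: compose_def intro!: restrict_ext)
    then obtain g where g: "g \<in> carrier (?X n)" "restrict h (carrier C) = ?d n g"
      using linear_sequenceD(3)[OF X h'] by blast
    have "h c = d n (g c)" if "c \<in> carrier C" for c
      using fun_cong[OF g(2), of c] that by (simp add: compose_eq)
    then show ?thesis using mod_hom_linear[of g S C "Y n"] g(1) by (intro bexI[of _ g]) simp_all
  qed
  have ext: "trivial_group (Ext (Suc i) S C N)" for i
    by (rule Ext_kernel_trivial[OF left_module_C Y hom_ex B(2) N])
  let ?T = "tensor R D (hom_module S C N)" and ?J = "tensor_map R D (hom_module S C N) D (?X n) (\<lambda>c. c) (compose (carrier C) j)"
  have natj: "counit (Y n) (?J t) = j (counit N t)" if "t \<in> carrier ?T" for t
    by (rule counit_natural[OF ND(1) YD(1) ND(2) that])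
  have Jcl: "?J t \<in> carrier (tensor R D (?X n))" if "t \<in> carrier ?T" for t
    using tensor_map_pair.map_closed[OF tensor_map_pair_D[OF HN HX linear_maps_id jX] that] .
  have j0: "j \<zero>\<^bsub>N\<^esub> = \<zero>\<^bsub>Y n\<^esub>"
    by (rule add_homs_zero[OF left_module_abelian_group[OF ND(1)] left_module_abelian_group[OF YD(1)] linear_mapsD(1)[OF ND(2)]])
  note cN = add_homs_closed[OF counit_add_homs[OF ND(1)]]
  have "counit N \<in> mod_iso S (tensor_module R C (hom_module S C N)) N"
    unfolding counit_iso_iff[OF ND(1)]
  proof (intro conjI ballI impI)
    fix t assume t: "t \<in> carrier ?T" "counit N t = \<zero>\<^bsub>N\<^esub>"
    \<comment> \<open>The counit of \<open>N\<close> is compared with that of \<open>Y n\<close>,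
      which is injective; \<open>?J\<close> is injective as well, since Hom(C, N) is a kernel in the
      tensor-exact sequence Hom(C, Y).\<close>
    then have "?J t = \<zero>\<^bsub>tensor R D (?X n)\<^esub>" using natj[OF t(1)] j0 c0[OF Jcl[OF t(1)]] by simp
    then show "t = \<zero>\<^bsub>?T\<^esub>" by (rule tensor_kernel_injective[OF left_module_D X texact K t(1)])
  next
    show "counit N ` carrier ?T = carrier N"
    proof (intro equalityI subsetI)
      fix x assume "x \<in> counit N ` carrier ?T"
      then show "x \<in> carrier N" using cN by blast
    next
      fix x assume x: "x \<in> carrier N"
      obtain s where s: "s \<in> carrier (tensor R D (?X n))" "j x = counit (Y n) s"
        using B(5)[of n] linear_maps_closed[OF ND(2) x] by blast
      \<comment> \<open>The preimage s of j x under the counit is a cycle, hence comes from C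
        \<otimes> Hom(C, N).\<close>
      have "tensored ?X ?d n s = \<zero>\<^bsub>tensor R D (?X (n + 1))\<^esub>" using ker[OF s(1)] s(2) ND(4)[OF x] by simp
      then obtain t where t: "t \<in> carrier ?T" "s = ?J t"
        using tensor_kernel_exact[OF left_module_D X texact K] s(1) by blast
      have "x = counit N t"
        using inj_onD[OF ND(3)] x cN[OF t(1)] natj[OF t(1)] s(2) t(2) by simp
      then show "x \<in> counit N ` carrier ?T" using t(1) by blast
    qed
  qed
  then show ?thesis using ND(1) tor ext unfolding bass_class_def all_ge1_iff by simp
qed

end

text \<open>Conversely, every module is a kernel in the contractible complex
  \<open>\<cdots> \<rightarrow> M \<rightarrow> M \<rightarrow> M \<rightarrow> \<cdots>\<close> whose differentials are alternately \<open>0\<close> and the identity.\<close>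

definition alternating :: "('a, 'x) ring_scheme \<Rightarrow> int \<Rightarrow> 'a \<Rightarrow> 'a"
  where "alternating M i = (\<lambda>x\<in>carrier M. if even i then \<zero>\<^bsub>M\<^esub> else x)"

text \<open>Stated for maps that agree with the alternating ones on the carrier, so that it covers
  the sequence itself and its images under the tensor and Hom functors.\<close>

lemma alternating_exact_complex:
  assumes "abelian_group A" and f: "\<And>i x. x \<in> carrier A \<Longrightarrow> f i x = (if even i then \<zero>\<^bsub>A\<^esub> else x)"
  shows "exact_complex (\<lambda>_. A) f"
proof -
  interpret abelian_group A by fact
  have "f i ` carrier A = a_kernel A A (f (i + 1))" for i
  proof (cases "even i")
    case True
    then have "f i ` carrier A = {\<zero>\<^bsub>A\<^esub>}" using f[of _ i] zero_closed by force
    moreover have "a_kernel A A (f (i + 1)) = {\<zero>\<^bsub>A\<^esub>}" using True f[of _ "i + 1"] by (auto simp: a_kernel_iff)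
    ultimately show ?thesis by simp
  next
    case False
    then have "f i ` carrier A = carrier A" using f[of _ i] by simp
    moreover have "a_kernel A A (f (i + 1)) = carrier A" using False f[of _ "i + 1"] by (auto simp: a_kernel_iff)
    ultimately show ?thesis by simp
  qed
  then show ?thesis by (simp add: exact_complex_def exact_at_def)
qed

lemma alternating_linear:
  assumes "left_module R M" shows "alternating M i \<in> mod_hom R M M"
  using restrict_mod_hom[OF assms linear_maps_zero[OF assms]] restrict_mod_hom[OF assms linear_maps_id]
  by (cases "even i") (simp_all add: alternating_def)

lemma alternating_exact_sequence:
  assumes "left_module R M" shows "exact_sequence R (\<lambda>_. M) (alternating M)"
  unfolding exact_sequence_def
  using assms alternating_linear[OF assms] alternating_exact_complex[OF left_module_abelian_group[OF assms]]
  by (simp add: alternating_def)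

text \<open>The index -2 is even, so the differential is zero and the cokernel is \<open>M\<close>
  modulo 0. The zero submodule is described as the kernel of the identity to make the facts on
  cosets applicable.\<close>

lemma alternating_cokernel:
  assumes M: "left_module R M"
  shows "mod_isomorphic R M (cokernel_module M M (alternating M (-2)))"
proof -
  interpret left_module R M by (rule M)
  have U: "alternating M (-2) ` carrier M = {x \<in> carrier M. x = \<zero>\<^bsub>M\<^esub>}"
    by (auto simp: alternating_def)
  let ?k = "\<lambda>x. alternating M (-2) ` carrier M +>\<^bsub>M\<^esub> x"
  note k = coset_linear[OF M M linear_maps_id U] and eq = coset_eq_iff[OF M M linear_maps_id U]
  have "inj_on ?k (carrier M)" using eq by (auto intro: inj_onI)
  then have "restrict ?k (carrier M) \<in> mod_iso R M (cokernel_module M M (alternating M (-2)))"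
    using restrict_mod_hom[OF M k(1)] k(2) by (simp add: mod_iso_def bij_betw_def cokernel_module_def)
  then show ?thesis unfolding mod_isomorphic_def by blast
qed

text \<open>The index 0 is even, so the differential is zero and its kernel is all of
  \<open>M\<close>.\<close>

lemma alternating_kernel:
  assumes M: "left_module R M"
  shows "mod_isomorphic R M (kernel_module M M (alternating M 0))"
proof -
  have "carrier (kernel_module M M (alternating M 0)) = carrier M"
    by (auto simp: kernel_module_def a_kernel_iff alternating_def)
  then have "(\<lambda>x. x) \<in> linear_maps R M (kernel_module M M (alternating M 0))"
    by (simp add: linear_maps_def add_homs_def) (simp add: kernel_module_def)
  from restrict_mod_hom[OF M this] have "restrict (\<lambda>x. x) (carrier M) \<in> mod_iso R M (kernel_module M M (alternating M 0))"
    using \<open>carrier (kernel_module M M (alternating M 0)) = carrier M\<close> by (simp add: mod_iso_def bij_betw_def)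
  then show ?thesis unfolding mod_isomorphic_def by blast
qed

context bimod
begin

lemma alternating_tensor_exact:
  assumes M: "left_module R M" shows "tensor_exact R C (\<lambda>_. M) (alternating M)"
proof -
  note tm = tensor_map_pair_D[OF M M linear_maps_id mod_hom_linear[OF alternating_linear[OF M]]]
  interpret T: tensor_pair R D M by (rule tensor_pair_D[OF M])
  have "tensor_map R D M D M (\<lambda>c. c) (alternating M i) t = (if even i then \<zero>\<^bsub>tensor R D M\<^esub> else t)"
    if "t \<in> carrier (tensor R D M)" for i t
  proof (cases "even i")
    case True then show ?thesis
      using tensor_map_pair.map_trivial[OF tm[of i] _ that] by (simp add: alternating_def)
  next
    case False then show ?thesis using tensor_map_id[OF tm[of i] that] by (simp add: alternating_def)
  qed
  then show ?thesis unfolding tensor_exact_iff by (rule alternating_exact_complex[OF T.tensor_abelian_group])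
qed

lemma alternating_hom_exact:
  assumes N: "left_module S N" shows "hom_exact S C (\<lambda>_. N) (alternating N)"
proof -
  have "compose (carrier C) (alternating N i) f = (if even i then \<zero>\<^bsub>hom_module S C N\<^esub> else f)"
    if "f \<in> carrier (hom_module S C N)" for i f
    using that linear_maps_closed[OF mod_hom_linear, of f S C N]
    by (auto simp: compose_def alternating_def mod_hom_eq extensional_def fun_eq_iff)
  then show ?thesis unfolding hom_exact_def
    by (rule alternating_exact_complex[OF left_module_abelian_group[OF left_module_hom_module[OF N]]])
qed

section \<open>Both classes are fixed by their step operations\<close>

theorem auslander_step_eq:
  "auslander_step R C (auslander_class S R C) = (auslander_class S R C :: ('r, 'm) module set)"
proof (intro equalityI subsetI)
  fix M :: "('r, 'm) module" assume "M \<in> auslander_step R C (auslander_class S R C)"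
  then obtain X :: "int \<Rightarrow> ('r, 'm) module" and d where X: "exact_sequence R X d" "tensor_exact R C X d" "\<And>i. X i \<in> auslander_class S R C"
    and M: "left_module R M" "mod_isomorphic R M (cokernel_module (X (-2)) (X (-1)) (d (-2)))"
    unfolding auslander_step_def by blast
  note X' = exact_sequence_linear[OF X(1)]
  obtain j where "kernel_embedding R X d 0 M j" using kernel_embedding_of_cokernel[OF X' M] by blast
  then show "M \<in> auslander_class S R C" by (rule auslander_kernel[OF X' X(2,3)])
next
  fix M :: "('r, 'm) module" assume M: "M \<in> auslander_class S R C"
  note L = auslander_classD(1)[OF M]
  show "M \<in> auslander_step R C (auslander_class S R C)"
    unfolding auslander_step_def
    using M L alternating_exact_sequence[OF L] alternating_tensor_exact[OF L] alternating_cokernel[OF L] by blast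
qed

theorem bass_step_eq:
  "bass_step S C (bass_class S R C) = (bass_class S R C :: ('s, 'n) module set)"
proof (intro equalityI subsetI)
  fix N :: "('s, 'n) module" assume "N \<in> bass_step S C (bass_class S R C)"
  then obtain Y :: "int \<Rightarrow> ('s, 'n) module" and d where Y: "exact_sequence S Y d" "hom_exact S C Y d" "\<And>i. Y i \<in> bass_class S R C"
    and N: "left_module S N" "mod_isomorphic S N (kernel_module (Y 0) (Y 1) (d 0))"
    unfolding bass_step_def by blast
  note Y' = exact_sequence_linear[OF Y(1)]
  obtain j where "kernel_embedding S Y d 0 N j" using kernel_embedding_of_kernel[of S N Y d, OF N] by blast
  then show "N \<in> bass_class S R C" by (rule bass_kernel[OF Y' Y(2,3)])
next
  fix N :: "('s, 'n) module" assume N: "N \<in> bass_class S R C"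
  note L = bass_classD(1)[OF N]
  show "N \<in> bass_step S C (bass_class S R C)"
    unfolding bass_step_def
    using N L alternating_exact_sequence[OF L] alternating_hom_exact[OF L] alternating_kernel[OF L] by blast
qed

end

lemma funpow_fixpoint: "F A = A \<Longrightarrow> (F ^^ n) A = A"
  by (induction n) simp_all

theorem theoremB:
  fixes R :: "'r ring" and S :: "'s ring" and C :: "('s, 'r, 'c) bimodule" and n :: nat
  assumes "ring R" and "ring S"
    and "faithfully_semidualizing S R C"
    and "n \<ge> 1"
  shows "(auslander_iter S R C n :: ('r, 'm) module set) = auslander_class S R C \<and>
    (bass_iter S R C n :: ('s, 'n) module set) = bass_class S R C"
proof -
  have "is_bimodule S R C" using assms(3) by (simp add: faithfully_semidualizing_def semidualizing_def)
  with assms(1) interpret bimod S R C by (rule bimod.intro)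
  show ?thesis unfolding auslander_iter_def bass_iter_def
    using funpow_fixpoint[of "auslander_step R C", OF auslander_step_eq]
      funpow_fixpoint[of "bass_step S C", OF bass_step_eq] by blast
qed

end
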